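(* Let $d\ge1$, let $(\gamma_{\alpha,\beta})_{\alpha,\beta\in\mathbb{N}_0^d}\subseteq\mathbb{D}$ be a family with $\gamma_{\alpha,\alpha}=0$ and $\gamma_{\beta,\alpha}=\overline{\gamma_{\alpha,\beta}}$, and let $(s_\alpha)_{\alpha\in\mathbb{N}_0^d}$ be a sequence of positive real numbers. Let $K$ be the unique positive kernel on $\mathbb{N}_0^d$ (all of whose finite sections are positive definite) with Verblunsky coefficients $(\gamma_{\alpha,\beta})_{\alpha,\beta\in\mathbb{N}_0^d}$ and diagonal $K(\alpha,\alpha)=s_\alpha$ for all $\alpha\in\mathbb{N}_0^d$. Then there is a unique positive measure $\mu$ on $\partial\mathbb{B}^d$ with Verblunsky coefficients $(\gamma_{\alpha,\beta})_{\alpha,\beta\in\mathbb{N}_0^d}$ such that $$\int_{\partial\mathbb{B}^d}|\zeta^\alpha|^2\,d\mu(\zeta)=s_\alpha\quad\text{for all }\alpha\in\mathbb{N}_0^d$$ if and only if $$K(\alpha,\beta)=\sum_{j=1}^dK(\alpha+e_j,\beta+e_j)\quad\text{for all }\alpha,\beta\in\mathbb{N}_0^d;$$ in this case, the moment kernel of $\mu$ is $K$.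
   Context: $\mathbb{D}$ is the open unit disc; $\partial\mathbb{B}^d$ is the unit sphere of $\mathbb{C}^d$; positive measures are finite positive Borel measures. $e_j$ is the $j$-th standard basis multi-index, $|\alpha|=\alpha_1+\dots+\alpha_d$, $z^\alpha=z_1^{\alpha_1}\cdots z_d^{\alpha_d}$. The shortlex order $\prec$ on $\mathbb{N}_0^d$: $\alpha\prec\beta$ if $|\alpha|<|\beta|$, or if $|\alpha|=|\beta|$ and $\alpha_i>\beta_i$ at the first index $i$ where they differ. A kernel on $\mathbb{N}_0^d$ is a map $K:\mathbb{N}_0^d\times\mathbb{N}_0^d\to\mathbb{C}$; it is positive if all its finite sections are positive semi-definite Hermitian matrices. The moment kernel of $\mu$ is $K(\alpha,\beta)=\int_{\partial\mathbb{B}^d}\zeta^\alpha\overline{\zeta}^\beta\,d\mu(\zeta)$. Verblunsky coefficients of a kernel $K$ whose finite sections are all positive definite (scalar Schur--Constantinescu parameters): for $\alpha\prec\beta$ let $S=\{\delta:\alpha\prec\delta\prec\beta\}$, $M=[K(\delta,\delta')]_{\delta,\delta'\in S}$, $u=[K(\alpha,\delta)]_{\delta\in S}$ (row), $v=[K(\delta,\beta)]_{\delta\in S}$ (column), and $$\gamma_{\alpha,\beta}=\frac{K(\alpha,\beta)-uM^{-1}v}{\sqrt{K(\alpha,\alpha)-uM^{-1}u^*}\,\sqrt{K(\beta,\beta)-v^*M^{-1}v}},$$ where terms involving $M$ are omitted if $S=\emptyset$; also $\gamma_{\alpha,\alpha}=0$ and $\gamma_{\beta,\alpha}=\overline{\gamma_{\alpha,\beta}}$.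 The existence and uniqueness of such a kernel with prescribed positive diagonal and prescribed coefficients in $\mathbb{D}$ is a known fact (Constantinescu). The Verblunsky coefficients of a measure $\mu$ are those of its moment kernel. *)

theory Defs
  imports "HOL-Analysis.Analysis"
begin

text \<open>
  The dimension \<open>d \<ge> 1\<close> is the cardinality of the index type \<open>'d\<close>, whose linear order is the order
  of the coordinates. Multi-indices are elements of \<^typ>\<open>nat ^ 'd\<close>; the standard basis
  multi-index \<open>e\<^sub>j\<close> is \<open>axis j 1\<close>.
\<close>

type_synonym 'd multi_index = "nat ^ 'd"

type_synonym 'd kernel = "nat ^ 'd \<Rightarrow> nat ^ 'd \<Rightarrow> complex"

definition total_degree :: "'d::finite multi_index \<Rightarrow> nat" where
  "total_degree \<alpha> = (\<Sum>i\<in>UNIV. \<alpha> $ i)"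

definition monomial :: "'d::finite multi_index \<Rightarrow> complex ^ 'd \<Rightarrow> complex" where
  "monomial \<alpha> z = (\<Prod>i\<in>UNIV. (z $ i) ^ (\<alpha> $ i))"

definition shortlex :: "'d::{finite,linorder} multi_index \<Rightarrow> 'd multi_index \<Rightarrow> bool"
    (infix \<open>\<prec>\<close> 50) where
  "\<alpha> \<prec> \<beta> \<longleftrightarrow> total_degree \<alpha> < total_degree \<beta> \<or>
     total_degree \<alpha> = total_degree \<beta> \<and> (\<exists>i. \<alpha> $ i > \<beta> $ i \<and> (\<forall>j<i. \<alpha> $ j = \<beta> $ j))"


subsection \<open>Finite sections and positivity\<close>

definition hermitian_on :: "'a set \<Rightarrow> ('a \<Rightarrow> 'a \<Rightarrow> complex) \<Rightarrow> bool" where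
  "hermitian_on F M \<longleftrightarrow> (\<forall>\<alpha>\<in>F. \<forall>\<beta>\<in>F. M \<beta> \<alpha> = cnj (M \<alpha> \<beta>))"

definition bilin_on ::
  "'a set \<Rightarrow> ('a \<Rightarrow> complex) \<Rightarrow> ('a \<Rightarrow> 'a \<Rightarrow> complex) \<Rightarrow> ('a \<Rightarrow> complex) \<Rightarrow> complex" where
  "bilin_on F u M v = (\<Sum>\<delta>\<in>F. \<Sum>\<delta>'\<in>F. u \<delta> * M \<delta> \<delta>' * v \<delta>')"

text \<open>For Hermitian \<open>M\<close> the form \<open>c\<^sup>* M c\<close> is real, so taking real parts loses nothing.\<close>

definition pos_semidef_on :: "'a set \<Rightarrow> ('a \<Rightarrow> 'a \<Rightarrow> complex) \<Rightarrow> bool" where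
  "pos_semidef_on F M \<longleftrightarrow>
     hermitian_on F M \<and> (\<forall>c. 0 \<le> Re (bilin_on F (\<lambda>\<delta>. cnj (c \<delta>)) M c))"

definition pos_def_on :: "'a set \<Rightarrow> ('a \<Rightarrow> 'a \<Rightarrow> complex) \<Rightarrow> bool" where
  "pos_def_on F M \<longleftrightarrow>
     hermitian_on F M \<and>
     (\<forall>c. (\<exists>\<delta>\<in>F. c \<delta> \<noteq> 0) \<longrightarrow> 0 < Re (bilin_on F (\<lambda>\<delta>. cnj (c \<delta>)) M c))"

definition positive_kernel :: "'d kernel \<Rightarrow> bool" where
  "positive_kernel K \<longleftrightarrow> (\<forall>F. finite F \<longrightarrow> pos_semidef_on F K)"

definition pos_def_kernel :: "'d kernel \<Rightarrow> bool" where
  "pos_def_kernel K \<longleftrightarrow> (\<forall>F. finite F \<longrightarrow> pos_def_on F K)"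


subsection \<open>Verblunsky coefficients\<close>

text \<open>
  The inverse of a square matrix indexed by a finite set. If \<open>M\<close> is invertible, the choice
  operator determines the entries on \<open>F \<times> F\<close> uniquely; the other values are irrelevant.
\<close>

definition inverse_on :: "'a set \<Rightarrow> ('a \<Rightarrow> 'a \<Rightarrow> complex) \<Rightarrow> ('a \<Rightarrow> 'a \<Rightarrow> complex)" where
  "inverse_on F M = (SOME N. \<forall>\<delta>\<in>F. \<forall>\<delta>'\<in>F.
     (\<Sum>\<epsilon>\<in>F. M \<delta> \<epsilon> * N \<epsilon> \<delta>') = (if \<delta> = \<delta>' then 1 else 0) \<and>
     (\<Sum>\<epsilon>\<in>F. N \<delta> \<epsilon> * M \<epsilon> \<delta>') = (if \<delta> = \<delta>' then 1 else 0))"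

text \<open>
  The case \<open>\<alpha> \<prec> \<beta>\<close>. If no multi-index lies strictly between \<open>\<alpha>\<close> and \<open>\<beta>\<close>, the sums over \<open>S\<close>
  are empty. For positive definite \<open>K\<close> the arguments of \<open>csqrt\<close> are positive reals.
\<close>

definition schur_parameter :: "'d::{finite,linorder} kernel \<Rightarrow> 'd kernel" where
  "schur_parameter K \<alpha> \<beta> =
    (let S = {\<delta>. \<alpha> \<prec> \<delta> \<and> \<delta> \<prec> \<beta>};
         N = inverse_on S K;
         u = (\<lambda>\<delta>. K \<alpha> \<delta>);
         v = (\<lambda>\<delta>. K \<delta> \<beta>)
     in (K \<alpha> \<beta> - bilin_on S u N v) /
        (csqrt (K \<alpha> \<alpha> - bilin_on S u N (\<lambda>\<delta>. cnj (u \<delta>))) *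
         csqrt (K \<beta> \<beta> - bilin_on S (\<lambda>\<delta>. cnj (v \<delta>)) N v)))"

definition verblunsky :: "'d::{finite,linorder} kernel \<Rightarrow> 'd kernel" where
  "verblunsky K \<alpha> \<beta> =
    (if \<alpha> \<prec> \<beta> then schur_parameter K \<alpha> \<beta>
     else if \<beta> \<prec> \<alpha> then cnj (schur_parameter K \<beta> \<alpha>)
     else 0)"

text \<open>Verblunsky coefficients are only defined for kernels with positive definite sections.\<close>

definition has_verblunsky :: "'d::{finite,linorder} kernel \<Rightarrow> 'd kernel \<Rightarrow> bool" where
  "has_verblunsky K \<gamma> \<longleftrightarrow> pos_def_kernel K \<and> (\<forall>\<alpha> \<beta>. verblunsky K \<alpha> \<beta> = \<gamma> \<alpha> \<beta>)"


subsection \<open>Measures on the unit sphere\<close>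

definition sphere_measure :: "(complex ^ 'd::finite) measure \<Rightarrow> bool" where
  "sphere_measure \<mu> \<longleftrightarrow>
     finite_measure \<mu> \<and> sets \<mu> = sets (restrict_space borel (sphere 0 1))"

definition moment_kernel :: "(complex ^ 'd::finite) measure \<Rightarrow> 'd kernel" where
  "moment_kernel \<mu> \<alpha> \<beta> = (\<integral>\<zeta>. monomial \<alpha> \<zeta> * cnj (monomial \<beta> \<zeta>) \<partial>\<mu>)"

definition solves_moment_problem ::
  "'d::{finite,linorder} kernel \<Rightarrow> ('d multi_index \<Rightarrow> real) \<Rightarrow> (complex, 'd) vec measure \<Rightarrow> bool"
  where
  "solves_moment_problem \<gamma> s \<mu> \<longleftrightarrow>
     sphere_measure \<mu> \<and> has_verblunsky (moment_kernel \<mu>) \<gamma> \<and>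
     (\<forall>\<alpha>. (\<integral>\<zeta>. (cmod (monomial \<alpha> \<zeta>))\<^sup>2 \<partial>\<mu>) = s \<alpha>)"

end

theory Submission
  imports Defs "HOL-Probability.Helly_Selection"
begin

text \<open>
  A measure that solves the moment problem has a moment kernel with positive definite sections, with
  the coefficients \<open>\<gamma>\<close> and with the diagonal \<open>s\<close>. Solving the definition of \<open>\<gamma>\<^sub>\<alpha>\<^sub>\<beta>\<close> for \<open>K(\<alpha>,\<beta>)\<close>
  expresses that entry by \<open>\<gamma>\<^sub>\<alpha>\<^sub>\<beta>\<close>, diagonal entries and entries that belong to strictly shorter shortlex
  intervals, so such a kernel is unique (\<open>pos_def_kernel_eqI_verblunsky\<close>): the moment kernel is \<open>K\<close>.
  The shift identity for a moment kernel is \<open>\<Sum>\<^sub>j |\<zeta>\<^sub>j|\<^sup>2 = 1\<close> under the integral sign, and by the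
  Stone-Weierstrass theorem a measure on the sphere is determined by its moment kernel
  (\<open>sphere_measure_eqI_moments\<close>).

  What remains is to construct a measure with moment kernel \<open>K\<close> from positivity and the shift
  identity (\<open>positive_kernel_is_moment_kernel\<close>). This is the subnormality of spherical isometries; the argument below is that of the quantum
  de Finetti theorem. Let \<open>\<sigma>\<close> be the uniform probability measure on the sphere, for which
  \<open>\<integral> |\<zeta>\<^sup>\<alpha>|\<^sup>2 d\<sigma> = \<alpha>! (d-1)! / (|\<alpha>|+d-1)!\<close> and distinct monomials are orthogonal. For each \<open>n\<close> the
  function
  \<open>q\<^sub>n(\<zeta>) = (1/n) \<Sum>\<^sub>\<delta>\<^sub>,\<^sub>\<delta>\<^sub>' a\<^sub>\<delta> a\<^sub>\<delta>\<^sub>' K(\<delta>,\<delta>') cnj(\<zeta>\<^sup>\<delta>) \<zeta>\<^sup>\<delta>\<^sup>'\<close>, with \<open>\<delta>, \<delta>'\<close> of degree in \<open>[n, 2n)\<close>, is nonnegative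
  because \<open>K\<close> is positive. Its moments with respect to \<open>\<sigma>\<close> can be computed in closed form: only pairs
  with \<open>\<alpha> + \<delta>' = \<beta> + \<delta>\<close> contribute, a Vandermonde convolution rewrites the resulting factorials
  (the passage from antinormal to normal order), and the multinomial form of the shift identity
  \<open>K(\<alpha>,\<beta>) = \<Sum>\<^sub>|\<^sub>\<gamma>\<^sub>|\<^sub>=\<^sub>m (m!/\<gamma>!) K(\<alpha>+\<gamma>,\<beta>+\<gamma>)\<close> sums each term. The outcome is a combination of
  \<open>K(\<alpha>-\<kappa>,\<beta>-\<kappa>)\<close> with \<open>\<kappa> \<le> \<alpha>, \<beta>\<close>, in which the term \<open>\<kappa> = 0\<close> has a weight tending to \<open>1\<close> and all others
  have weights tending to \<open>0\<close> (\<open>sum_window_overlap\<close>, \<open>overlap_average_tendsto\<close>). The window of \<open>n\<close> consecutive degrees plays the role of a Fejer kernel: it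
  makes the moments with \<open>|\<alpha>| \<noteq> |\<beta>|\<close> come out right. Hence the measures \<open>q\<^sub>n d\<sigma>\<close> have moments
  converging to \<open>K\<close>, and a weak limit has moment kernel \<open>K\<close>.

  Weak limits in several dimensions come from Helly's theorem on the line
  (\<open>weakly_convergent_subsequence_bounded_support\<close>): Schoenberg's space-filling curve has a Borel
  section, through which measures on a cube are transported to \<open>[0,1]\<close> and back. The same device yields
  the measure \<open>\<sigma>\<close>, as a limit of uniform distributions on finite grids, from its moments alone.
\<close>

(* The infix symbol also denotes comparison of cardinalities in the library; here it is shortlex. *)
no_notation lesspoll (infixl \<open>\<prec>\<close> 50)

section \<open>Positive definite kernels are determined by diagonal and Verblunsky coefficients\<close>

lemma shortlex_irrefl: "\<not> \<alpha> \<prec> \<alpha>"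
  by (auto simp: shortlex_def)

lemma shortlex_trans:
  assumes "\<alpha> \<prec> \<beta>" "\<beta> \<prec> \<gamma>"
  shows "\<alpha> \<prec> \<gamma>"
proof (cases "total_degree \<alpha> = total_degree \<beta> \<and> total_degree \<beta> = total_degree \<gamma>")
  case True
  then obtain i j where i: "\<alpha> $ i > \<beta> $ i" "\<And>k. k < i \<Longrightarrow> \<alpha> $ k = \<beta> $ k"
    and j: "\<beta> $ j > \<gamma> $ j" "\<And>k. k < j \<Longrightarrow> \<beta> $ k = \<gamma> $ k"
    using assms by (auto simp: shortlex_def)
  have "\<alpha> $ (min i j) > \<gamma> $ (min i j)"
    using i j by (cases i j rule: linorder_cases) auto
  moreover have "\<forall>k < min i j. \<alpha> $ k = \<gamma> $ k"
    using i j by simp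
  ultimately show ?thesis using True by (auto simp: shortlex_def)
next
  case False
  then show ?thesis using assms by (auto simp: shortlex_def)
qed

lemma shortlex_total:
  assumes "\<alpha> \<noteq> \<beta>"
  shows "\<alpha> \<prec> \<beta> \<or> \<beta> \<prec> \<alpha>"
proof -
  define D where "D = {i. \<alpha> $ i \<noteq> \<beta> $ i}"
  have "D \<noteq> {}" "finite D" using assms by (auto simp: D_def vec_eq_iff)
  have mem: "i \<in> D \<longleftrightarrow> \<alpha> $ i \<noteq> \<beta> $ i" for i by (simp add: D_def)
  have m: "Min D \<in> D" by (intro Min_in) fact+
  have "k \<notin> D" if "k < Min D" for k
    using Min_le[OF \<open>finite D\<close>, of k] that leD by blast
  with m have "\<alpha> $ Min D \<noteq> \<beta> $ Min D" "\<forall>k<Min D. \<alpha> $ k = \<beta> $ k" using mem by blast+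
  then show ?thesis unfolding shortlex_def
    by (metis linorder_neqE_nat)
qed

lemma finite_total_degree_le: "finite {\<delta>::'d::finite multi_index. total_degree \<delta> \<le> n}"
proof (rule finite_subset)
  show "{\<delta>::'d multi_index. total_degree \<delta> \<le> n} \<subseteq> vec_lambda ` (UNIV \<rightarrow>\<^sub>E {..n})"
  proof
    fix \<delta> :: "'d multi_index" assume "\<delta> \<in> {\<delta>. total_degree \<delta> \<le> n}"
    then have "\<delta> $ i \<le> n" for i
      using member_le_sum[of i UNIV "\<lambda>i. \<delta> $ i"] by (auto simp: total_degree_def)
    then have "vec_nth \<delta> \<in> UNIV \<rightarrow>\<^sub>E {..n}" by auto
    then show "\<delta> \<in> vec_lambda ` (UNIV \<rightarrow>\<^sub>E {..n})"
      by (metis imageI vec_nth_inverse)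
  qed
qed (auto intro!: finite_imageI finite_PiE)

lemma finite_shortlex_interval: "finite {\<delta>. \<alpha> \<prec> \<delta> \<and> \<delta> \<prec> \<beta>}"
  by (rule finite_subset[OF _ finite_total_degree_le[of "total_degree \<beta>"]])
     (auto simp: shortlex_def)

lemma hermitian_on_subset: "hermitian_on F M \<Longrightarrow> G \<subseteq> F \<Longrightarrow> hermitian_on G M"
  by (auto simp: hermitian_on_def)

lemma bilin_on_insert:
  assumes "finite G" "a \<notin> G"
  shows "bilin_on (insert a G) u M v = u a * M a a * v a
    + u a * (\<Sum>\<delta>\<in>G. M a \<delta> * v \<delta>) + (\<Sum>\<delta>\<in>G. u \<delta> * M \<delta> a) * v a + bilin_on G u M v"
  using assms by (simp add: bilin_on_def sum.distrib sum_distrib_left sum_distrib_right algebra_simps)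

lemma pos_def_on_insertD:
  assumes "pos_def_on (insert a G) M" "finite G" "a \<notin> G"
  shows "pos_def_on G M"
  unfolding pos_def_on_def
proof (intro conjI allI impI)
  show "hermitian_on G M" using assms by (auto simp: pos_def_on_def intro: hermitian_on_subset)
  fix c :: "_ \<Rightarrow> complex" assume c: "\<exists>\<delta>\<in>G. c \<delta> \<noteq> 0"
  define c' where "c' = c(a := 0)"
  have "0 < Re (bilin_on (insert a G) (\<lambda>\<delta>. cnj (c' \<delta>)) M c')"
  proof -
    obtain \<delta> where "\<delta> \<in> G" "c \<delta> \<noteq> 0" using c by blast
    then have "\<exists>\<delta>\<in>insert a G. c' \<delta> \<noteq> 0"
      using assms(3) by (intro bexI[of _ \<delta>]) (auto simp: c'_def)
    then show ?thesis using assms(1) unfolding pos_def_on_def by blast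
  qed
  also have "bilin_on (insert a G) (\<lambda>\<delta>. cnj (c' \<delta>)) M c' = bilin_on G (\<lambda>\<delta>. cnj (c' \<delta>)) M c'"
    using assms by (simp add: bilin_on_insert c'_def)
  also have "\<dots> = bilin_on G (\<lambda>\<delta>. cnj (c \<delta>)) M c"
    using assms unfolding bilin_on_def c'_def by (intro sum.cong) auto
  finally show "0 < Re (bilin_on G (\<lambda>\<delta>. cnj (c \<delta>)) M c)" .
qed

text \<open>
  The vector with entry \<open>1\<close> at \<open>a\<close> and \<open>-y\<close> on \<open>G\<close> is annihilated by the rows in \<open>G\<close>; if the Schur
  complement vanished it would be annihilated by all rows, contradicting definiteness.
\<close>
lemma schur_complement_nonzero:
  assumes M: "pos_def_on (insert a G) M" and "finite G" "a \<notin> G"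
    and y: "\<And>\<delta>. \<delta> \<in> G \<Longrightarrow> (\<Sum>\<epsilon>\<in>G. M \<delta> \<epsilon> * y \<epsilon>) = M \<delta> a"
  shows "M a a - (\<Sum>\<epsilon>\<in>G. M a \<epsilon> * y \<epsilon>) \<noteq> 0"
proof
  assume eq: "M a a - (\<Sum>\<epsilon>\<in>G. M a \<epsilon> * y \<epsilon>) = 0"
  (* The null vector of the full matrix. *)
  define c where "c = (\<lambda>\<delta>. if \<delta> = a then 1 else - y \<delta>)"
  have cG: "(\<Sum>\<delta>\<in>G. f \<delta> * c \<delta>) = - (\<Sum>\<delta>\<in>G. f \<delta> * y \<delta>)" for f
    unfolding sum_negf[symmetric] using assms by (intro sum.cong) (auto simp: c_def)
  have "bilin_on (insert a G) (\<lambda>\<delta>. cnj (c \<delta>)) M c =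
     (\<Sum>\<delta>\<in>insert a G. cnj (c \<delta>) * (\<Sum>\<epsilon>\<in>insert a G. M \<delta> \<epsilon> * c \<epsilon>))"
    by (simp add: bilin_on_def sum_distrib_left mult.assoc)
  also have "\<dots> = (\<Sum>\<delta>\<in>insert a G. 0)"
  proof (rule sum.cong)
    fix \<delta> assume \<delta>: "\<delta> \<in> insert a G"
    have "(\<Sum>\<epsilon>\<in>insert a G. M \<delta> \<epsilon> * c \<epsilon>) = M \<delta> a - (\<Sum>\<epsilon>\<in>G. M \<delta> \<epsilon> * y \<epsilon>)"
      using assms cG[of "M \<delta>"] by (simp add: c_def)
    also have "\<dots> = 0" using \<delta> y eq by auto
    finally show "cnj (c \<delta>) * (\<Sum>\<epsilon>\<in>insert a G. M \<delta> \<epsilon> * c \<epsilon>) = 0" by simp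
  qed simp
  finally have "bilin_on (insert a G) (\<lambda>\<delta>. cnj (c \<delta>)) M c = 0" by simp
  moreover have "0 < Re (bilin_on (insert a G) (\<lambda>\<delta>. cnj (c \<delta>)) M c)"
  proof -
    have "\<exists>\<delta>\<in>insert a G. c \<delta> \<noteq> 0" by (intro bexI[of _ a]) (auto simp: c_def)
    then show ?thesis using M unfolding pos_def_on_def by blast
  qed
  ultimately show False by simp
qed

text \<open>
  Invertibility of positive definite matrices, by elimination of one index at a time; the pivot is the
  Schur complement.
\<close>
lemma pos_def_on_solvable:
  assumes "finite F" "pos_def_on F M"
  shows "\<exists>x. \<forall>\<delta>\<in>F. (\<Sum>\<epsilon>\<in>F. M \<delta> \<epsilon> * x \<epsilon>) = b \<delta>"
  using assms
proof (induction F arbitrary: b rule: finite_induct)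
  case (insert a G)
  have G: "pos_def_on G M" using pos_def_on_insertD[OF insert.prems insert.hyps] .
  obtain y where y: "\<And>\<delta>. \<delta> \<in> G \<Longrightarrow> (\<Sum>\<epsilon>\<in>G. M \<delta> \<epsilon> * y \<epsilon>) = M \<delta> a"
    using insert.IH[OF G, of "\<lambda>\<delta>. M \<delta> a"] by blast
  obtain z where z: "\<And>\<delta>. \<delta> \<in> G \<Longrightarrow> (\<Sum>\<epsilon>\<in>G. M \<delta> \<epsilon> * z \<epsilon>) = b \<delta>"
    using insert.IH[OF G, of b] by blast
  (* y solves the reduced system for column a, z for b; the row of a fixes the multiple t of y. *)
  define s where "s = M a a - (\<Sum>\<epsilon>\<in>G. M a \<epsilon> * y \<epsilon>)"
  have s: "s \<noteq> 0" unfolding s_def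
    by (rule schur_complement_nonzero[OF insert.prems insert.hyps y])
  define t where "t = (b a - (\<Sum>\<epsilon>\<in>G. M a \<epsilon> * z \<epsilon>)) / s"
  define x where "x = (\<lambda>\<epsilon>. if \<epsilon> = a then t else z \<epsilon> - t * y \<epsilon>)"
  have "(\<Sum>\<epsilon>\<in>G. M \<delta> \<epsilon> * x \<epsilon>) = (\<Sum>\<epsilon>\<in>G. M \<delta> \<epsilon> * z \<epsilon>) - t * (\<Sum>\<epsilon>\<in>G. M \<delta> \<epsilon> * y \<epsilon>)" for \<delta>
    unfolding sum_distrib_left sum_subtractf[symmetric] using insert
    by (intro sum.cong) (auto simp: x_def algebra_simps)
  then have eq: "(\<Sum>\<epsilon>\<in>insert a G. M \<delta> \<epsilon> * x \<epsilon>) =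
      M \<delta> a * t + (\<Sum>\<epsilon>\<in>G. M \<delta> \<epsilon> * z \<epsilon>) - t * (\<Sum>\<epsilon>\<in>G. M \<delta> \<epsilon> * y \<epsilon>)" for \<delta>
    using insert by (simp add: x_def)
  have "(\<Sum>\<epsilon>\<in>insert a G. M a \<epsilon> * x \<epsilon>) = t * s + (\<Sum>\<epsilon>\<in>G. M a \<epsilon> * z \<epsilon>)"
    unfolding eq by (simp add: s_def algebra_simps)
  then have "(\<Sum>\<epsilon>\<in>insert a G. M a \<epsilon> * x \<epsilon>) = b a"
    using s by (simp add: t_def)
  moreover have "(\<Sum>\<epsilon>\<in>insert a G. M \<delta> \<epsilon> * x \<epsilon>) = b \<delta>" if "\<delta> \<in> G" for \<delta>
    unfolding eq using y[OF that] z[OF that] by simp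
  ultimately show ?case by blast
qed auto

text \<open>
  The choice in \<^const>\<open>inverse_on\<close> needs a two-sided inverse: the adjoint of a right inverse of a
  Hermitian matrix is a left inverse, and the two coincide.
\<close>
lemma inverse_on_right:
  assumes F: "finite F" and M: "pos_def_on F M" and "\<delta> \<in> F" "\<delta>' \<in> F"
  shows "(\<Sum>\<epsilon>\<in>F. M \<delta> \<epsilon> * inverse_on F M \<epsilon> \<delta>') = (if \<delta> = \<delta>' then 1 else 0)"
proof -
  obtain N where N: "\<And>\<delta>' \<delta>. \<delta> \<in> F \<Longrightarrow> (\<Sum>\<epsilon>\<in>F. M \<delta> \<epsilon> * N \<delta>' \<epsilon>) = (if \<delta> = \<delta>' then 1 else 0)"
    using pos_def_on_solvable[OF F M, of "\<lambda>\<delta>. if \<delta> = _ then 1 else 0"] by metis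
  define R where "R = (\<lambda>\<epsilon> \<delta>'. N \<delta>' \<epsilon>)"
  define L where "L = (\<lambda>\<delta> \<epsilon>. cnj (R \<epsilon> \<delta>))"
  have R: "(\<Sum>\<epsilon>\<in>F. M \<delta> \<epsilon> * R \<epsilon> \<delta>') = (if \<delta> = \<delta>' then 1 else 0)" if "\<delta> \<in> F" for \<delta> \<delta>'
    using N that by (simp add: R_def)
  have L: "(\<Sum>\<epsilon>\<in>F. L \<delta> \<epsilon> * M \<epsilon> \<delta>') = (if \<delta> = \<delta>' then 1 else 0)" if "\<delta> \<in> F" "\<delta>' \<in> F" for \<delta> \<delta>'
  proof -
    have "(\<Sum>\<epsilon>\<in>F. L \<delta> \<epsilon> * M \<epsilon> \<delta>') = (\<Sum>\<epsilon>\<in>F. cnj (M \<delta>' \<epsilon> * R \<epsilon> \<delta>))"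
    proof (intro sum.cong refl)
      fix \<epsilon> assume "\<epsilon> \<in> F"
      then have "M \<epsilon> \<delta>' = cnj (M \<delta>' \<epsilon>)"
        using M that unfolding pos_def_on_def hermitian_on_def by blast
      then show "L \<delta> \<epsilon> * M \<epsilon> \<delta>' = cnj (M \<delta>' \<epsilon> * R \<epsilon> \<delta>)" by (simp add: L_def)
    qed
    also have "\<dots> = cnj (\<Sum>\<epsilon>\<in>F. M \<delta>' \<epsilon> * R \<epsilon> \<delta>)" by simp
    also have "\<dots> = (if \<delta> = \<delta>' then 1 else 0)" using R that by auto
    finally show ?thesis .
  qed
  have LR: "L \<delta> \<delta>' = R \<delta> \<delta>'" if "\<delta> \<in> F" "\<delta>' \<in> F" for \<delta> \<delta>'
  proof -
    have "L \<delta> \<delta>' = (\<Sum>\<epsilon>\<in>F. L \<delta> \<epsilon> * (\<Sum>\<eta>\<in>F. M \<epsilon> \<eta> * R \<eta> \<delta>'))"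
      using that F by (simp add: R if_distrib[of "(*) _"] cong: if_cong)
    also have "\<dots> = (\<Sum>\<eta>\<in>F. (\<Sum>\<epsilon>\<in>F. L \<delta> \<epsilon> * M \<epsilon> \<eta>) * R \<eta> \<delta>')"
      unfolding sum_distrib_left sum_distrib_right by (subst sum.swap) (simp add: mult.assoc)
    also have "\<dots> = (\<Sum>\<eta>\<in>F. if \<delta> = \<eta> then R \<eta> \<delta>' else 0)"
      using that by (intro sum.cong) (auto simp: L)
    also have "\<dots> = R \<delta> \<delta>'" using that F by simp
    finally show ?thesis .
  qed
  have "(\<Sum>\<epsilon>\<in>F. R \<delta> \<epsilon> * M \<epsilon> \<delta>') = (if \<delta> = \<delta>' then 1 else 0)" if "\<delta> \<in> F" "\<delta>' \<in> F" for \<delta> \<delta>'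
    using L[OF that] LR that by (simp cong: sum.cong)
  then have "\<forall>\<delta>\<in>F. \<forall>\<delta>'\<in>F. (\<Sum>\<epsilon>\<in>F. M \<delta> \<epsilon> * R \<epsilon> \<delta>') = (if \<delta> = \<delta>' then 1 else 0) \<and>
      (\<Sum>\<epsilon>\<in>F. R \<delta> \<epsilon> * M \<epsilon> \<delta>') = (if \<delta> = \<delta>' then 1 else 0)"
    using R by blast
  from someI[of "\<lambda>N. \<forall>\<delta>\<in>F. \<forall>\<delta>'\<in>F. (\<Sum>\<epsilon>\<in>F. M \<delta> \<epsilon> * N \<epsilon> \<delta>') = (if \<delta> = \<delta>' then 1 else 0) \<and>
      (\<Sum>\<epsilon>\<in>F. N \<delta> \<epsilon> * M \<epsilon> \<delta>') = (if \<delta> = \<delta>' then 1 else 0)", OF this]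
  show ?thesis using assms unfolding inverse_on_def by blast
qed

lemma inverse_on_cong:
  assumes "\<And>\<delta> \<epsilon>. \<delta> \<in> F \<Longrightarrow> \<epsilon> \<in> F \<Longrightarrow> M \<delta> \<epsilon> = M' \<delta> \<epsilon>"
  shows "inverse_on F M = inverse_on F M'"
  unfolding inverse_on_def using assms by (simp cong: sum.cong)

lemma bilin_on_cong:
  assumes "\<And>\<delta>. \<delta> \<in> F \<Longrightarrow> u \<delta> = u' \<delta>" "\<And>\<delta>. \<delta> \<in> F \<Longrightarrow> v \<delta> = v' \<delta>"
  shows "bilin_on F u N v = bilin_on F u' N v'"
  unfolding bilin_on_def using assms by (intro sum.cong) auto

lemma schur_complement_inverse_on_nonzero:
  assumes M: "pos_def_on (insert a G) M" and G: "finite G" "a \<notin> G"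
  shows "M a a - bilin_on G (\<lambda>\<delta>. M a \<delta>) (inverse_on G M) (\<lambda>\<delta>. M \<delta> a) \<noteq> 0"
proof -
  define y where "y = (\<lambda>\<epsilon>. \<Sum>\<delta>\<in>G. inverse_on G M \<epsilon> \<delta> * M \<delta> a)"
  have MG: "pos_def_on G M" using pos_def_on_insertD[OF assms] .
  have "(\<Sum>\<epsilon>\<in>G. M \<delta> \<epsilon> * y \<epsilon>) = M \<delta> a" if "\<delta> \<in> G" for \<delta>
  proof -
    have "(\<Sum>\<epsilon>\<in>G. M \<delta> \<epsilon> * y \<epsilon>) = (\<Sum>\<delta>'\<in>G. (\<Sum>\<epsilon>\<in>G. M \<delta> \<epsilon> * inverse_on G M \<epsilon> \<delta>') * M \<delta>' a)"
      unfolding y_def sum_distrib_left sum_distrib_right by (subst sum.swap) (simp add: mult.assoc)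
    also have "\<dots> = (\<Sum>\<delta>'\<in>G. if \<delta> = \<delta>' then M \<delta>' a else 0)"
      using that G MG by (intro sum.cong) (auto simp: inverse_on_right)
    also have "\<dots> = M \<delta> a" using that G by simp
    finally show ?thesis .
  qed
  then have "M a a - (\<Sum>\<epsilon>\<in>G. M a \<epsilon> * y \<epsilon>) \<noteq> 0"
    by (rule schur_complement_nonzero[OF M G])
  also have "(\<Sum>\<epsilon>\<in>G. M a \<epsilon> * y \<epsilon>) = bilin_on G (\<lambda>\<delta>. M a \<delta>) (inverse_on G M) (\<lambda>\<delta>. M \<delta> a)"
    by (simp add: y_def bilin_on_def sum_distrib_left mult.assoc)
  finally show ?thesis .
qed

text \<open>
  Induction on the number of multi-indices strictly between \<open>\<alpha>\<close> and \<open>\<beta>\<close>. All data in the definition of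
  the coefficient other than \<open>K(\<alpha>,\<beta>)\<close> itself come from pairs with fewer indices in between, hence
  agree for both kernels; the two square roots are nonzero Schur complements, so the equation can be
  solved for \<open>K(\<alpha>,\<beta>)\<close>.
\<close>
theorem pos_def_kernel_eqI_verblunsky:
  fixes K K' :: "'d::{finite,linorder} kernel"
  assumes K: "pos_def_kernel K" and K': "pos_def_kernel K'"
    and diag: "\<And>\<alpha>. K \<alpha> \<alpha> = K' \<alpha> \<alpha>"
    and verb: "\<And>\<alpha> \<beta>. verblunsky K \<alpha> \<beta> = verblunsky K' \<alpha> \<beta>"
  shows "K = K'"
proof -
  have herm: "L \<beta> \<alpha> = cnj (L \<alpha> \<beta>)" if "pos_def_kernel L" for L :: "'d kernel" and \<alpha> \<beta>
  proof -
    have "hermitian_on {\<alpha>, \<beta>} L" using that by (auto simp: pos_def_kernel_def pos_def_on_def)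
    then show ?thesis unfolding hermitian_on_def by blast
  qed
  have up: "K \<alpha> \<beta> = K' \<alpha> \<beta>" if "\<alpha> \<prec> \<beta>" for \<alpha> \<beta>
    using that
  proof (induction "card {\<delta>. \<alpha> \<prec> \<delta> \<and> \<delta> \<prec> \<beta>}" arbitrary: \<alpha> \<beta> rule: less_induct)
    case less
    define S where "S = {\<delta>. \<alpha> \<prec> \<delta> \<and> \<delta> \<prec> \<beta>}"
    have fin: "finite S" unfolding S_def by (rule finite_shortlex_interval)
    have notin: "\<alpha> \<notin> S" "\<beta> \<notin> S" by (auto simp: S_def shortlex_irrefl)
    have sub: "K x y = K' x y"
      if xy: "x \<prec> y" "x \<in> insert \<alpha> S" "y \<in> insert \<beta> S" and ne: "x \<in> S \<or> y \<in> S" for x y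
    proof -
      have "{\<delta>. x \<prec> \<delta> \<and> \<delta> \<prec> y} \<subset> S"
      proof
        show "{\<delta>. x \<prec> \<delta> \<and> \<delta> \<prec> y} \<subseteq> S"
          using xy unfolding S_def by (auto intro: shortlex_trans)
        show "{\<delta>. x \<prec> \<delta> \<and> \<delta> \<prec> y} \<noteq> S"
          using ne shortlex_irrefl by blast
      qed
      then have "card {\<delta>. x \<prec> \<delta> \<and> \<delta> \<prec> y} < card S"
        using fin by (rule psubset_card_mono[rotated])
      then show ?thesis using less.hyps[of x y] xy(1) by (simp add: S_def)
    qed
    have up_\<alpha>: "K \<alpha> \<delta> = K' \<alpha> \<delta>" if "\<delta> \<in> S" for \<delta>
      using that sub[of \<alpha> \<delta>] by (auto simp: S_def)
    have up_\<beta>: "K \<delta> \<beta> = K' \<delta> \<beta>" if "\<delta> \<in> S" for \<delta>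
      using that sub[of \<delta> \<beta>] by (auto simp: S_def)
    have SS: "K \<delta> \<epsilon> = K' \<delta> \<epsilon>" if "\<delta> \<in> S" "\<epsilon> \<in> S" for \<delta> \<epsilon>
    proof (cases "\<delta> = \<epsilon>")
      case False
      then consider "\<delta> \<prec> \<epsilon>" | "\<epsilon> \<prec> \<delta>" using shortlex_total by blast
      then show ?thesis
      proof cases
        case 1
        then show ?thesis using sub[of \<delta> \<epsilon>] that by simp
      next
        case 2
        then have "K \<epsilon> \<delta> = K' \<epsilon> \<delta>" using sub[of \<epsilon> \<delta>] that by simp
        then show ?thesis using herm[OF K, of \<delta> \<epsilon>] herm[OF K', of \<delta> \<epsilon>] by simp
      qed
    qed (simp add: diag)
    define N where "N = inverse_on S K"
    have N': "inverse_on S K' = N" unfolding N_def using SS by (intro inverse_on_cong) auto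
    define A where "A = bilin_on S (\<lambda>\<delta>. K \<alpha> \<delta>) N (\<lambda>\<delta>. K \<delta> \<beta>)"
    define B where "B = K \<alpha> \<alpha> - bilin_on S (\<lambda>\<delta>. K \<alpha> \<delta>) N (\<lambda>\<delta>. cnj (K \<alpha> \<delta>))"
    define C where "C = K \<beta> \<beta> - bilin_on S (\<lambda>\<delta>. cnj (K \<delta> \<beta>)) N (\<lambda>\<delta>. K \<delta> \<beta>)"
    have pd: "pos_def_on (insert x S) K" for x
      using K fin by (auto simp: pos_def_kernel_def)
    have hK: "cnj (K x y) = K y x" for x y using herm[OF K, of x y] by simp
    have "B \<noteq> 0" "C \<noteq> 0"
      using schur_complement_inverse_on_nonzero[OF pd fin notin(1)]
        schur_complement_inverse_on_nonzero[OF pd fin notin(2)]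
      by (auto simp: B_def C_def N_def hK)
    moreover have "schur_parameter K \<alpha> \<beta> = (K \<alpha> \<beta> - A) / (csqrt B * csqrt C)"
      by (simp add: schur_parameter_def Let_def A_def B_def C_def N_def S_def)
    moreover have "schur_parameter K' \<alpha> \<beta> = (K' \<alpha> \<beta> - A) / (csqrt B * csqrt C)"
    proof -
      have "A = bilin_on S (\<lambda>\<delta>. K' \<alpha> \<delta>) N (\<lambda>\<delta>. K' \<delta> \<beta>)"
        unfolding A_def using up_\<alpha> up_\<beta> by (intro bilin_on_cong) auto
      moreover have "B = K' \<alpha> \<alpha> - bilin_on S (\<lambda>\<delta>. K' \<alpha> \<delta>) N (\<lambda>\<delta>. cnj (K' \<alpha> \<delta>))"
        unfolding B_def diag using up_\<alpha> by (intro arg_cong2[of _ _ _ _ "(-)"] bilin_on_cong) auto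
      moreover have "C = K' \<beta> \<beta> - bilin_on S (\<lambda>\<delta>. cnj (K' \<delta> \<beta>)) N (\<lambda>\<delta>. K' \<delta> \<beta>)"
        unfolding C_def diag using up_\<beta> by (intro arg_cong2[of _ _ _ _ "(-)"] bilin_on_cong) auto
      ultimately show ?thesis
        unfolding schur_parameter_def Let_def S_def[symmetric] N' by simp
    qed
    moreover have "schur_parameter K \<alpha> \<beta> = schur_parameter K' \<alpha> \<beta>"
      using verb[of \<alpha> \<beta>] less.prems by (simp add: verblunsky_def)
    ultimately show "K \<alpha> \<beta> = K' \<alpha> \<beta>" by simp
  qed
  show ?thesis
  proof (intro ext)
    fix \<alpha> \<beta> :: "'d multi_index"
    consider "\<alpha> = \<beta>" | "\<alpha> \<prec> \<beta>" | "\<beta> \<prec> \<alpha>" using shortlex_total by blast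
    then show "K \<alpha> \<beta> = K' \<alpha> \<beta>"
    proof cases
      case 3
      then show ?thesis
        using herm[OF K, of \<alpha> \<beta>] herm[OF K', of \<alpha> \<beta>] up[OF 3] by simp
    qed (simp_all add: diag up)
  qed
qed

section \<open>Measures on the sphere are determined by their moments\<close>

lemma continuous_on_monomial [continuous_intros]: "continuous_on A (monomial \<alpha>)"
  unfolding monomial_def[abs_def] by (intro continuous_intros)

lemma monomial_add: "monomial (\<alpha> + \<beta>) \<zeta> = monomial \<alpha> \<zeta> * monomial \<beta> \<zeta>"
  by (simp add: monomial_def power_add prod.distrib)

lemma monomial_axis: "monomial (axis j 1) \<zeta> = \<zeta> $ j"
proof -
  have "monomial (axis j 1) \<zeta> = (\<Prod>i\<in>UNIV. if i = j then \<zeta> $ i else 1)"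
    unfolding monomial_def axis_def by (intro prod.cong) auto
  then show ?thesis by simp
qed

lemma monomial_0 [simp]: "monomial 0 \<zeta> = 1"
  by (simp add: monomial_def)

lemma sphere_measure_space:
  assumes "sphere_measure \<mu>"
  shows "space \<mu> = sphere 0 1"
proof -
  have "space \<mu> = space (restrict_space borel (sphere 0 1 :: (complex^'a) set))"
    using assms by (intro sets_eq_imp_space_eq) (simp add: sphere_measure_def)
  then show ?thesis by (simp add: space_restrict_space)
qed

lemma sphere_measure_measurable:
  fixes f :: "complex ^ 'd::finite \<Rightarrow> 'b::topological_space"
  assumes "sphere_measure \<mu>" "continuous_on (sphere 0 1) f"
  shows "f \<in> borel_measurable \<mu>"
  using borel_measurable_continuous_on_restrict[OF assms(2)] assms(1)
  by (simp add: sphere_measure_def cong: measurable_cong_sets)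

lemma sphere_measure_integrable:
  fixes f :: "complex ^ 'd::finite \<Rightarrow> 'b::{banach,second_countable_topology}"
  assumes \<mu>: "sphere_measure \<mu>" and f: "continuous_on (sphere 0 1) f"
  shows "integrable \<mu> f"
proof -
  interpret finite_measure \<mu> using \<mu> by (simp add: sphere_measure_def)
  have "bounded (f ` sphere 0 1)"
    using f by (intro compact_imp_bounded compact_continuous_image) auto
  then obtain B where "\<And>x. x \<in> sphere 0 1 \<Longrightarrow> norm (f x) \<le> B" unfolding bounded_iff by blast
  then show ?thesis
    by (intro integrable_const_bound[of _ B] sphere_measure_measurable[OF \<mu> f] AE_I2)
       (simp add: sphere_measure_space[OF \<mu>])
qed

lemma bounded_linear_complex_vec:
  fixes f :: "complex ^ 'd::finite \<Rightarrow> real"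
  assumes "bounded_linear f"
  obtains c c' where "\<And>\<zeta>. complex_of_real (f \<zeta>) = (\<Sum>j\<in>UNIV. c j * (\<zeta> $ j) + c' j * cnj (\<zeta> $ j))"
proof
  interpret bounded_linear f by fact
  fix \<zeta> :: "complex ^ 'd"
  have "\<zeta> = (\<Sum>j\<in>UNIV. Re (\<zeta> $ j) *\<^sub>R axis j 1 + Im (\<zeta> $ j) *\<^sub>R axis j \<i>)"
    unfolding vec_eq_iff
  proof
    fix i
    have "(\<Sum>j\<in>UNIV. Re (\<zeta> $ j) *\<^sub>R axis j 1 + Im (\<zeta> $ j) *\<^sub>R axis j \<i>) $ i = (\<Sum>j\<in>UNIV. if j = i then \<zeta> $ j else 0)"
      unfolding sum_component by (intro sum.cong) (auto simp: axis_def complex_eq_iff)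
    then show "\<zeta> $ i = (\<Sum>j\<in>UNIV. Re (\<zeta> $ j) *\<^sub>R axis j 1 + Im (\<zeta> $ j) *\<^sub>R axis j \<i>) $ i" by simp
  qed
  then have "f \<zeta> = f (\<Sum>j\<in>UNIV. Re (\<zeta> $ j) *\<^sub>R axis j 1 + Im (\<zeta> $ j) *\<^sub>R axis j \<i>)"
    by (rule arg_cong)
  also have "\<dots> = (\<Sum>j\<in>UNIV. Re (\<zeta> $ j) * f (axis j 1) + Im (\<zeta> $ j) * f (axis j \<i>))"
    by (simp add: sum add scaleR)
  finally have "complex_of_real (f \<zeta>) = (\<Sum>j\<in>UNIV. Re (\<zeta> $ j) * f (axis j 1) + Im (\<zeta> $ j) * f (axis j \<i>))"
    by simp
  also have "\<dots> = (\<Sum>j\<in>UNIV. (f (axis j 1) / 2 - \<i> * f (axis j \<i>) / 2) * (\<zeta> $ j) +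
      (f (axis j 1) / 2 + \<i> * f (axis j \<i>) / 2) * cnj (\<zeta> $ j))"
    unfolding of_real_sum by (intro sum.cong) (auto simp: complex_eq_iff field_simps)
  finally show "complex_of_real (f \<zeta>) = \<dots>" .
qed

text \<open>
  The functions \<open>h\<close> such that \<open>h \<zeta>\<^sup>\<alpha> cnj(\<zeta>\<^sup>\<beta>)\<close> has the same integral for both measures, for all \<open>\<alpha>, \<beta>\<close>,
  form a space \<open>T\<close> that is stable under multiplication by coordinates and their conjugates, hence by
  every real polynomial. This makes the induction over polynomial functions go through products; the
  Stone-Weierstrass theorem does the rest.
\<close>
lemma sphere_measure_continuous_integral_eq:
  fixes \<mu> \<nu> :: "(complex ^ 'd::finite) measure" and f :: "complex ^ 'd \<Rightarrow> real"
  assumes \<mu>: "sphere_measure \<mu>" and \<nu>: "sphere_measure \<nu>"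
    and eq: "moment_kernel \<mu> = moment_kernel \<nu>"
    and f: "continuous_on (sphere 0 1) f"
  shows "(\<integral>\<zeta>. f \<zeta> \<partial>\<mu>) = (\<integral>\<zeta>. f \<zeta> \<partial>\<nu>)"
proof -
  let ?S = "sphere 0 1 :: (complex ^ 'd) set"
  define T where "T h \<longleftrightarrow> continuous_on ?S h \<and> (\<forall>\<alpha> \<beta>.
     (\<integral>\<zeta>. h \<zeta> * (monomial \<alpha> \<zeta> * cnj (monomial \<beta> \<zeta>)) \<partial>\<mu>) = (\<integral>\<zeta>. h \<zeta> * (monomial \<alpha> \<zeta> * cnj (monomial \<beta> \<zeta>)) \<partial>\<nu>))"
    for h :: "complex ^ 'd \<Rightarrow> complex"
  have Tc: "continuous_on ?S h" if "T h" for h using that by (simp add: T_def)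
  have int: "integrable \<mu> (\<lambda>\<zeta>. h \<zeta> * (monomial \<alpha> \<zeta> * cnj (monomial \<beta> \<zeta>)))"
     "integrable \<nu> (\<lambda>\<zeta>. h \<zeta> * (monomial \<alpha> \<zeta> * cnj (monomial \<beta> \<zeta>)))" if "T h" for h \<alpha> \<beta>
    by (intro sphere_measure_integrable \<mu> \<nu> continuous_intros Tc that)+
  have Tadd: "T (\<lambda>\<zeta>. g \<zeta> + h \<zeta>)" if g: "T g" and h: "T h" for g h
    using that by (simp add: T_def ring_distribs int[OF g] int[OF h] continuous_on_add)
  have Tscale: "T (\<lambda>\<zeta>. c * h \<zeta>)" if "T h" for h c
    using that by (simp add: T_def mult.assoc continuous_on_mult)
  have T0: "T (\<lambda>\<zeta>. 0)" by (simp add: T_def)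
  have Tsum: "T (\<lambda>\<zeta>. \<Sum>j\<in>J. g j \<zeta>)" if "finite J" "\<And>j. T (g j)" for g and J :: "'d set"
    using that(1) by induction (simp_all add: T0 Tadd that)
  have Tz: "T (\<lambda>\<zeta>. (\<zeta> $ j) * h \<zeta>)" if "T h" for h j
    unfolding T_def
  proof (intro conjI allI)
    show "continuous_on ?S (\<lambda>\<zeta>. (\<zeta> $ j) * h \<zeta>)" by (intro continuous_intros Tc that)
    fix \<alpha> \<beta>
    have shift: "(\<zeta> $ j) * h \<zeta> * (monomial \<alpha> \<zeta> * cnj (monomial \<beta> \<zeta>)) =
        h \<zeta> * (monomial (\<alpha> + axis j 1) \<zeta> * cnj (monomial \<beta> \<zeta>))" for \<zeta>
      by (simp only: monomial_add monomial_axis mult_ac)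
    then show "(\<integral>\<zeta>. (\<zeta> $ j) * h \<zeta> * (monomial \<alpha> \<zeta> * cnj (monomial \<beta> \<zeta>)) \<partial>\<mu>) =
      (\<integral>\<zeta>. (\<zeta> $ j) * h \<zeta> * (monomial \<alpha> \<zeta> * cnj (monomial \<beta> \<zeta>)) \<partial>\<nu>)"
      using that unfolding T_def shift by blast
  qed
  have Tcz: "T (\<lambda>\<zeta>. cnj (\<zeta> $ j) * h \<zeta>)" if "T h" for h j
    unfolding T_def
  proof (intro conjI allI)
    show "continuous_on ?S (\<lambda>\<zeta>. cnj (\<zeta> $ j) * h \<zeta>)" by (intro continuous_intros Tc that)
    fix \<alpha> \<beta>
    have shift: "cnj (\<zeta> $ j) * h \<zeta> * (monomial \<alpha> \<zeta> * cnj (monomial \<beta> \<zeta>)) =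
        h \<zeta> * (monomial \<alpha> \<zeta> * cnj (monomial (\<beta> + axis j 1) \<zeta>))" for \<zeta>
      by (simp only: monomial_add monomial_axis mult_ac complex_cnj_mult)
    then show "(\<integral>\<zeta>. cnj (\<zeta> $ j) * h \<zeta> * (monomial \<alpha> \<zeta> * cnj (monomial \<beta> \<zeta>)) \<partial>\<mu>) =
      (\<integral>\<zeta>. cnj (\<zeta> $ j) * h \<zeta> * (monomial \<alpha> \<zeta> * cnj (monomial \<beta> \<zeta>)) \<partial>\<nu>)"
      using that unfolding T_def shift by blast
  qed
  have Tpoly: "T (\<lambda>\<zeta>. of_real (p \<zeta>) * h \<zeta>)" if "real_polynomial_function p" "T h" for p h
    using that
  proof (induction p arbitrary: h rule: real_polynomial_function.induct)
    case (linear p)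
    then obtain c c' where c: "\<And>\<zeta>. complex_of_real (p \<zeta>) = (\<Sum>j\<in>UNIV. c j * (\<zeta> $ j) + c' j * cnj (\<zeta> $ j))"
      using bounded_linear_complex_vec by blast
    have "T (\<lambda>\<zeta>. \<Sum>j\<in>UNIV. c j * ((\<zeta> $ j) * h \<zeta>) + c' j * (cnj (\<zeta> $ j) * h \<zeta>))"
      by (intro Tsum Tadd Tscale Tz Tcz linear.prems) simp
    then show ?case unfolding c sum_distrib_right by (simp add: ring_distribs mult.assoc)
  next
    case (const c)
    then show ?case by (rule Tscale)
  next
    case (add p q)
    then show ?case by (simp add: ring_distribs Tadd)
  next
    case (mult p q)
    then show ?case by (simp add: mult.assoc)
  qed
  have T1: "T (\<lambda>\<zeta>. 1)"
    using eq by (simp add: T_def moment_kernel_def fun_eq_iff)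
  have poly: "(\<integral>\<zeta>. p \<zeta> \<partial>\<mu>) = (\<integral>\<zeta>. p \<zeta> \<partial>\<nu>)" if "real_polynomial_function p" for p
  proof -
    have "(\<integral>\<zeta>. complex_of_real (p \<zeta>) * (monomial 0 \<zeta> * cnj (monomial 0 \<zeta>)) \<partial>\<mu>) =
       (\<integral>\<zeta>. complex_of_real (p \<zeta>) * (monomial 0 \<zeta> * cnj (monomial 0 \<zeta>)) \<partial>\<nu>)"
      using Tpoly[OF that T1] unfolding T_def mult_1_right by blast
    then show ?thesis by simp
  qed
  define C where "C = measure \<mu> (space \<mu>) + measure \<nu> (space \<nu>)"
  have C: "C \<ge> 0" by (simp add: C_def)
  have close: "\<bar>(\<integral>\<zeta>. f \<zeta> \<partial>\<mu>) - (\<integral>\<zeta>. f \<zeta> \<partial>\<nu>)\<bar> \<le> e * C" if e: "e > 0" for e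
  proof -
    obtain p where p: "real_polynomial_function p" "\<And>x. x \<in> ?S \<Longrightarrow> \<bar>f x - p x\<bar> < e"
      using Stone_Weierstrass_real_polynomial_function[OF compact_sphere f e] by blast
    have pc: "continuous_on ?S p"
      using p(1) by (simp add: continuous_on_polymonial_function real_polynomial_function_eq)
    have est: "\<bar>(\<integral>\<zeta>. f \<zeta> \<partial>\<rho>) - (\<integral>\<zeta>. p \<zeta> \<partial>\<rho>)\<bar> \<le> e * measure \<rho> (space \<rho>)" if \<rho>: "sphere_measure \<rho>" for \<rho>
    proof -
      interpret finite_measure \<rho> using \<rho> by (simp add: sphere_measure_def)
      have i: "integrable \<rho> f" "integrable \<rho> p" by (intro sphere_measure_integrable \<rho> f pc)+
      have "\<bar>(\<integral>\<zeta>. f \<zeta> \<partial>\<rho>) - (\<integral>\<zeta>. p \<zeta> \<partial>\<rho>)\<bar> = \<bar>\<integral>\<zeta>. f \<zeta> - p \<zeta> \<partial>\<rho>\<bar>" using i by simp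
      also have "\<dots> \<le> (\<integral>\<zeta>. \<bar>f \<zeta> - p \<zeta>\<bar> \<partial>\<rho>)" by (rule integral_abs_bound)
      also have "\<dots> \<le> (\<integral>\<zeta>. e \<partial>\<rho>)"
        using i p(2) by (intro integral_mono) (auto simp: sphere_measure_space[OF \<rho>] less_imp_le)
      finally show ?thesis by (simp add: mult.commute)
    qed
    show ?thesis using est[OF \<mu>] est[OF \<nu>] poly[OF p(1)] by (simp add: C_def ring_distribs)
  qed
  show ?thesis
  proof (rule ccontr)
    assume "(\<integral>\<zeta>. f \<zeta> \<partial>\<mu>) \<noteq> (\<integral>\<zeta>. f \<zeta> \<partial>\<nu>)"
    define D where "D = \<bar>(\<integral>\<zeta>. f \<zeta> \<partial>\<mu>) - (\<integral>\<zeta>. f \<zeta> \<partial>\<nu>)\<bar>"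
    have D: "D > 0" using \<open>_ \<noteq> _\<close> by (simp add: D_def)
    (* The factor C + 1 avoids dividing by zero when both measures vanish. *)
    then have "D \<le> D / (2 * (C + 1)) * C" using close[of "D / (2 * (C + 1))"] C by (simp add: D_def)
    also have "\<dots> = D * (C / (2 * (C + 1)))" by simp
    also have "\<dots> < D * 1" using D C by (intro mult_strict_left_mono) (auto simp: divide_simps)
    finally show False by simp
  qed
qed

lemma sphere_measure_closed_eq_limit:
  fixes \<mu> :: "(complex ^ 'd::finite) measure"
  assumes \<mu>: "sphere_measure \<mu>" and C: "closed C" "C \<noteq> {}"
  shows "(\<lambda>n. \<integral>\<zeta>. max 0 (1 - real n * infdist \<zeta> C) \<partial>\<mu>) \<longlonglongrightarrow> measure \<mu> (C \<inter> space \<mu>)"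
proof -
  interpret finite_measure \<mu> using \<mu> by (simp add: sphere_measure_def)
  have sets_C: "C \<inter> space \<mu> \<in> sets \<mu>"
    using C(1) \<mu> by (auto simp: sphere_measure_space[OF \<mu>] sphere_measure_def sets_restrict_space Int_commute)
  have "(\<lambda>n. \<integral>\<zeta>. max 0 (1 - real n * infdist \<zeta> C) \<partial>\<mu>) \<longlonglongrightarrow> (\<integral>\<zeta>. indicator (C \<inter> space \<mu>) \<zeta> \<partial>\<mu>)"
  proof (rule integral_dominated_convergence[where w = "\<lambda>_. 1"])
    show "(\<lambda>\<zeta>. max 0 (1 - real n * infdist \<zeta> C)) \<in> borel_measurable \<mu>" for n
      by (intro sphere_measure_measurable \<mu> continuous_intros)
    show "AE \<zeta> in \<mu>. (\<lambda>n. max 0 (1 - real n * infdist \<zeta> C)) \<longlonglongrightarrow> indicator (C \<inter> space \<mu>) \<zeta>"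
    proof (rule AE_I2)
      fix \<zeta> assume \<zeta>: "\<zeta> \<in> space \<mu>"
      show "(\<lambda>n. max 0 (1 - real n * infdist \<zeta> C)) \<longlonglongrightarrow> indicator (C \<inter> space \<mu>) \<zeta>"
      proof (cases "\<zeta> \<in> C")
        case False
        then have pos: "infdist \<zeta> C > 0"
          using C infdist_pos_not_in_closed by blast
        obtain N :: nat where N: "1 / infdist \<zeta> C \<le> real N" using real_arch_simple by blast
        have "max 0 (1 - real n * infdist \<zeta> C) = 0" if "n \<ge> N" for n
        proof -
          have "1 / infdist \<zeta> C \<le> real n" using N that by linarith
          then show ?thesis using pos by (simp add: field_simps)
        qed
        then have "\<forall>\<^sub>F n in sequentially. max 0 (1 - real n * infdist \<zeta> C) = 0"
          by (auto simp: eventually_sequentially)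
        then show ?thesis using False by (simp add: tendsto_eventually)
      qed (use \<zeta> in simp)
    qed
    show "AE \<zeta> in \<mu>. norm (max 0 (1 - real n * infdist \<zeta> C)) \<le> 1" for n
      by (auto simp: infdist_nonneg)
  qed (use sets_C in auto)
  then show ?thesis using sets_C by simp
qed

theorem sphere_measure_eqI_moments:
  fixes \<mu> \<nu> :: "(complex ^ 'd::finite) measure"
  assumes \<mu>: "sphere_measure \<mu>" and \<nu>: "sphere_measure \<nu>"
    and eq: "moment_kernel \<mu> = moment_kernel \<nu>"
  shows "\<mu> = \<nu>"
proof -
  let ?S = "sphere 0 1 :: (complex ^ 'd) set"
  interpret \<mu>: finite_measure \<mu> using \<mu> by (simp add: sphere_measure_def)
  interpret \<nu>: finite_measure \<nu> using \<nu> by (simp add: sphere_measure_def)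
  have idm: "(\<lambda>x. x) \<in> borel_measurable \<rho>" if "sphere_measure \<rho>" for \<rho> :: "(complex ^ 'd) measure"
    by (intro sphere_measure_measurable that continuous_intros)
  have closed: "emeasure \<mu> (C \<inter> ?S) = emeasure \<nu> (C \<inter> ?S)" if "closed C" for C
  proof (cases "C = {}")
    case False
    have "(\<lambda>n. \<integral>\<zeta>. max 0 (1 - real n * infdist \<zeta> C) \<partial>\<mu>) = (\<lambda>n. \<integral>\<zeta>. max 0 (1 - real n * infdist \<zeta> C) \<partial>\<nu>)"
      by (intro ext sphere_measure_continuous_integral_eq[OF \<mu> \<nu> eq] continuous_intros)
    then have "measure \<mu> (C \<inter> space \<mu>) = measure \<nu> (C \<inter> space \<nu>)"
      using sphere_measure_closed_eq_limit[OF \<mu> that False] sphere_measure_closed_eq_limit[OF \<nu> that False]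
        LIMSEQ_unique by metis
    then show ?thesis
      by (simp add: \<mu>.emeasure_eq_measure \<nu>.emeasure_eq_measure sphere_measure_space \<mu> \<nu>)
  qed simp
  have emb: "emeasure (distr \<rho> borel (\<lambda>x. x)) A = emeasure \<rho> (A \<inter> ?S)"
    if "sphere_measure \<rho>" "A \<in> sets borel" for \<rho> A
    using that by (simp add: emeasure_distr idm sphere_measure_space)
  have "distr \<mu> borel (\<lambda>x. x) = distr \<nu> borel (\<lambda>x. x)"
  proof (rule measure_eqI_generator_eq[where \<Omega> = UNIV and E = "{C. closed C}" and A = "\<lambda>_. UNIV"])
    show "emeasure (distr \<mu> borel (\<lambda>x. x)) X = emeasure (distr \<nu> borel (\<lambda>x. x)) X" if "X \<in> {C. closed C}" for X
      using that closed[of X] by (simp add: emb \<mu> \<nu>)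
    show "Int_stable {C :: (complex ^ 'd) set. closed C}" by (auto simp: Int_stable_def)
    show "emeasure (distr \<mu> borel (\<lambda>x. x)) UNIV \<noteq> \<infinity>"
      by (simp add: emb \<mu> \<mu>.emeasure_eq_measure)
  qed (auto simp: borel_eq_closed)
  then have all: "emeasure \<mu> (A \<inter> ?S) = emeasure \<nu> (A \<inter> ?S)" if "A \<in> sets borel" for A
    using emb[OF \<mu> that] emb[OF \<nu> that] by simp
  have sets_eq: "sets \<mu> = sets \<nu>" using \<mu> \<nu> by (simp add: sphere_measure_def)
  show ?thesis
  proof (rule measure_eqI[OF sets_eq])
    fix A assume "A \<in> sets \<mu>"
    then obtain B where B: "B \<in> sets borel" "A = B \<inter> ?S"
      using \<mu> by (auto simp: sphere_measure_def sets_restrict_space)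
    show "emeasure \<mu> A = emeasure \<nu> A" unfolding B(2) by (rule all[OF B(1)])
  qed
qed

section \<open>Weak limits of measures with bounded support\<close>

text \<open>
  A continuous 2-periodic function that vanishes on \<open>[0, 1/3]\<close> and equals \<open>1\<close> on \<open>[2/3, 1]\<close>: there
  \<open>cos (\<pi> y)\<close> is at least \<open>1/2\<close> and at most \<open>-1/2\<close>, respectively. It reads off the leading ternary
  digit of a Cantor number.
\<close>
definition schoenberg_wave :: "real \<Rightarrow> real" where
  "schoenberg_wave y = max 0 (min 1 (1/2 - cos (pi * y)))"

text \<open>
  The \<open>i\<close>-th of the \<open>D\<close> coordinates of Schoenberg's space-filling curve. Its \<open>k\<close>-th binary digit is
  stored in the ternary digit number \<open>k D + i\<close> of the parameter.
\<close>
definition schoenberg_coord :: "nat \<Rightarrow> nat \<Rightarrow> real \<Rightarrow> real" where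
  "schoenberg_coord D i t = (\<Sum>k. (1/2)^(k+1) * schoenberg_wave (3^(k*D+i) * t))"

definition ternary :: "(nat \<Rightarrow> bool) \<Rightarrow> real" where
  "ternary b = (\<Sum>j. of_bool (b j) * 2 / 3^(j+1))"

lemma schoenberg_wave_bounds: "0 \<le> schoenberg_wave y" "schoenberg_wave y \<le> 1"
  by (auto simp: schoenberg_wave_def)

lemma schoenberg_wave_digit:
  assumes "0 \<le> r" "r \<le> 1/3"
  shows "schoenberg_wave (2 * of_int n + of_bool c * 2/3 + r) = of_bool c"
proof -
  have "cos (pi * (2 * of_int n + of_bool c * 2/3 + r)) = cos (pi * (of_bool c * 2/3 + r) + 2 * pi * of_int n)"
    by (simp add: algebra_simps)
  also have "\<dots> = cos (pi * (of_bool c * 2/3 + r))"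
    by (simp add: cos_add)
  finally have eq: "cos (pi * (2 * of_int n + of_bool c * 2/3 + r)) = cos (pi * (of_bool c * 2/3 + r))" .
  show ?thesis
  proof (cases c)
    case True
    have "cos (pi * (of_bool c * 2/3 + r)) \<le> cos (2 * pi / 3)"
      using assms True by (intro cos_monotone_0_pi_le) (auto simp: field_simps)
    also have "\<dots> = -1/2" using cos_120 by simp
    finally show ?thesis using True eq by (simp add: schoenberg_wave_def)
  next
    case False
    have "cos (pi * (of_bool c * 2/3 + r)) \<ge> cos (pi / 3)"
      using assms False by (intro cos_monotone_0_pi_le) (auto simp: field_simps)
    moreover have "cos (pi / 3) = 1/2" using cos_60 by simp
    ultimately show ?thesis using False eq by (simp add: schoenberg_wave_def)
  qed
qed

lemma summable_ternary: "summable (\<lambda>j. of_bool (b j) * 2 / 3^(j+1) :: real)"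
proof (rule summable_comparison_test')
  show "summable (\<lambda>j. 2/3 * (1/3::real)^j)" by (intro summable_mult summable_geometric) auto
  show "norm (of_bool (b j) * 2 / 3^(j+1) :: real) \<le> 2/3 * (1/3)^j" for j
    by (simp add: power_divide)
qed

lemma ternary_bounds: "0 \<le> ternary b" "ternary b \<le> 1"
proof -
  show "0 \<le> ternary b" unfolding ternary_def by (intro suminf_nonneg summable_ternary) auto
  have "ternary b \<le> (\<Sum>j. 2/3 * (1/3::real)^j)" unfolding ternary_def
  proof (intro suminf_le summable_ternary)
    show "summable (\<lambda>j. 2/3 * (1/3::real)^j)" by (intro summable_mult summable_geometric) auto
  qed (simp add: power_divide)
  also have "\<dots> = 1" by (subst suminf_mult) (auto simp: suminf_geometric)
  finally show "ternary b \<le> 1" .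
qed

lemma ternary_Suc: "3 * ternary b = of_bool (b 0) * 2 + ternary (\<lambda>j. b (Suc j))"
proof -
  have "ternary b = (\<Sum>j. of_bool (b (Suc j)) * 2 / 3^(Suc j+1)) + of_bool (b 0) * 2 / 3"
    unfolding ternary_def
    using suminf_split_head[OF summable_ternary[of b]] by simp
  also have "(\<Sum>j. of_bool (b (Suc j)) * 2 / 3^(Suc j+1) :: real) = ternary (\<lambda>j. b (Suc j)) / 3"
    unfolding ternary_def by (subst suminf_divide[OF summable_ternary, symmetric]) (simp add: mult_ac)
  finally show ?thesis by simp
qed

lemma ternary_shift: "\<exists>n::int. 3 ^ m * ternary b = 2 * of_int n + ternary (\<lambda>j. b (j + m))"
proof (induction m)
  case (Suc m)
  then obtain n where n: "3 ^ m * ternary b = 2 * of_int n + ternary (\<lambda>j. b (j + m))" by blast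
  have "3 ^ Suc m * ternary b = 3 * (3 ^ m * ternary b)" by simp
  also have "\<dots> = 2 * of_int (3 * n + of_bool (b m)) + ternary (\<lambda>j. b (j + Suc m))"
    unfolding n distrib_left ternary_Suc by simp
  finally show ?case by blast
qed (auto intro: exI[of _ 0])

lemma schoenberg_wave_ternary: "schoenberg_wave (3 ^ m * ternary b) = of_bool (b m)"
proof -
  obtain n where n: "3 ^ m * ternary b = 2 * of_int n + ternary (\<lambda>j. b (j + m))"
    using ternary_shift by blast
  define r where "r = ternary (\<lambda>j. b (Suc j + m)) / 3"
  have r: "0 \<le> r" "r \<le> 1/3" using ternary_bounds[of "\<lambda>j. b (Suc j + m)"] by (auto simp: r_def)
  have "ternary (\<lambda>j. b (j + m)) = of_bool (b m) * 2/3 + r"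
    using ternary_Suc[of "\<lambda>j. b (j + m)"] by (simp add: r_def)
  then show ?thesis using n schoenberg_wave_digit[OF r, of n "b m"] by (simp add: add.assoc)
qed

lemma binary_expansion_sums:
  assumes "0 \<le> x" "x < 1"
  shows "(\<lambda>k. (1/2)^(k+1) * of_bool (odd \<lfloor>2^(k+1) * x\<rfloor>)) sums (x::real)"
proof -
  define A where "A n = of_int \<lfloor>2^n * x\<rfloor> / (2::real)^n" for n
  have step: "A (Suc k) - A k = (1/2)^(k+1) * of_bool (odd \<lfloor>2^(k+1) * x\<rfloor>)" for k
  proof -
    define z where "z = 2^k * x"
    have "\<lfloor>z\<rfloor> = \<lfloor>2 * z\<rfloor> div 2"
      using floor_divide_real_eq_div[of 2 "2*z"] by simp
    then have "\<lfloor>2 * z\<rfloor> = 2 * \<lfloor>z\<rfloor> + of_bool (odd \<lfloor>2*z\<rfloor>)"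
      by (simp add: mod_2_eq_odd[symmetric] del: mod_2_eq_odd)
    then have "real_of_int \<lfloor>2 * z\<rfloor> = real_of_int (2 * \<lfloor>z\<rfloor> + of_bool (odd \<lfloor>2*z\<rfloor>))" by metis
    moreover have double: "2^(k+1) * x = 2 * z" by (simp add: z_def)
    ultimately show ?thesis
      unfolding A_def Suc_eq_plus1 double z_def[symmetric] by (simp add: field_simps)
  qed
  have "A \<longlonglongrightarrow> x"
  proof (rule tendsto_sandwich)
    show "\<forall>\<^sub>F n in sequentially. x - (1/2)^n \<le> A n"
    proof (intro always_eventually allI)
      fix n
      have "2^n * x - 1 \<le> of_int \<lfloor>2^n * x\<rfloor>" by linarith
      then have "(2^n * x - 1) / 2^n \<le> A n" unfolding A_def by (intro divide_right_mono) auto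
      then show "x - (1/2)^n \<le> A n" by (simp add: field_simps)
    qed
    show "\<forall>\<^sub>F n in sequentially. A n \<le> x"
      by (intro always_eventually allI) (simp add: A_def field_simps)
    have "(\<lambda>n. x - (1/2)^n) \<longlonglongrightarrow> x - 0" by (intro tendsto_intros LIMSEQ_realpow_zero) auto
    then show "(\<lambda>n. x - (1/2)^n) \<longlonglongrightarrow> x" by simp
  qed auto
  moreover have "A 0 = 0" using assms by (simp add: A_def floor_eq_iff)
  ultimately have "(\<lambda>k. A (Suc k) - A k) sums x" using telescope_sums[of A x] by simp
  then show ?thesis unfolding step .
qed

lemma summable_half_power: "summable (\<lambda>k. (1/2::real)^(k+1))"
  using summable_geometric[of "1/2::real"] by (simp add: summable_mult)

lemma continuous_schoenberg_coord: "continuous_on UNIV (schoenberg_coord D i)"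
proof -
  have "uniform_limit UNIV (\<lambda>n t. \<Sum>k<n. (1/2)^(k+1) * schoenberg_wave (3^(k*D+i) * t))
     (\<lambda>t. schoenberg_coord D i t) sequentially"
    unfolding schoenberg_coord_def
  proof (rule Weierstrass_m_test[OF _ summable_half_power])
    show "norm ((1/2)^(k+1) * schoenberg_wave (3^(k*D+i) * t)) \<le> (1/2)^(k+1)" for k t
      using schoenberg_wave_bounds[of "3^(k*D+i) * t"] by (simp add: abs_mult)
  qed
  moreover have "continuous_on UNIV (\<lambda>t. \<Sum>k<n. (1/2)^(k+1) * schoenberg_wave (3^(k*D+i) * t))" for n
    unfolding schoenberg_wave_def by (intro continuous_intros)
  ultimately show ?thesis
    using uniform_limit_theorem by (metis (mono_tags, lifting) always_eventually trivial_limit_sequentially)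
qed

lemma schoenberg_coord_bounds: "\<bar>schoenberg_coord D i t\<bar> \<le> 1"
proof -
  have s: "summable (\<lambda>k. (1/2)^(k+1) * schoenberg_wave (3^(k*D+i) * t))"
    using schoenberg_wave_bounds
    by (intro summable_comparison_test'[OF summable_half_power]) (auto simp: abs_mult)
  have "schoenberg_coord D i t \<le> (\<Sum>k. (1/2::real)^(k+1))"
    unfolding schoenberg_coord_def
    using schoenberg_wave_bounds by (intro suminf_le s summable_half_power) auto
  also have "\<dots> = 1" using power_half_series by (simp add: sums_iff)
  finally have "schoenberg_coord D i t \<le> 1" .
  moreover have "0 \<le> schoenberg_coord D i t"
    unfolding schoenberg_coord_def
    using schoenberg_wave_bounds by (intro suminf_nonneg s) auto
  ultimately show ?thesis by simp
qed

lemma schoenberg_coord_ternary: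
  assumes i: "i < D" and x: "0 \<le> x i" "x i < 1"
  shows "schoenberg_coord D i (ternary (\<lambda>m. odd \<lfloor>2^(m div D + 1) * x (m mod D)\<rfloor>)) = x i"
proof -
  have "(k * D + i) div D = k" "(k * D + i) mod D = i" for k
    using i by auto
  then show ?thesis
    unfolding schoenberg_coord_def schoenberg_wave_ternary
    using binary_expansion_sums[OF x] by (simp add: sums_iff)
qed

text \<open>
  The curve \<open>g\<close> is Schoenberg's curve rescaled to the cube \<open>[-R, R]\<^sup>D\<close>, extended to the whole line by its
  formula. The section \<open>h\<close> interleaves the binary digits of the rescaled coordinates into the digits of
  a Cantor number, which is a discontinuous but Borel measurable operation.
\<close>
lemma bounded_continuous_curve_with_borel_section:
  fixes R :: real
  assumes R: "R > 0"
  obtains g :: "real \<Rightarrow> 'a::euclidean_space" and h :: "'a \<Rightarrow> real" where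
    "continuous_on UNIV g" "bounded (range g)" "h \<in> borel_measurable borel" 
    "range h \<subseteq> {0..1}" "\<And>y. norm y < R \<Longrightarrow> g (h y) = y"
proof -
  define D where "D = DIM('a)"
  obtain e where e: "bij_betw e {..<D} (Basis :: 'a set)"
    using ex_bij_betw_nat_finite[OF finite_Basis] by (metis D_def atLeast0LessThan)
  define x where "x y i = (y \<bullet> e i) / (2 * R) + 1/2" for y :: 'a and i
  define h where "h y = ternary (\<lambda>m. odd \<lfloor>2^(m div D + 1) * x y (m mod D)\<rfloor>)" for y
  define g where "g t = (\<Sum>i<D. ((2 * schoenberg_coord D i t - 1) * R) *\<^sub>R e i)" for t
  have eB: "e i \<in> Basis" if "i < D" for i using e that by (auto simp: bij_betw_def)
  show ?thesis
  proof
    show "continuous_on UNIV g" unfolding g_def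
      by (intro continuous_intros continuous_on_subset[OF continuous_schoenberg_coord]) auto
    show "bounded (range g)"
    proof (rule boundedI)
      fix y assume "y \<in> range g"
      then obtain t where t: "y = g t" by auto
      have "norm (g t) \<le> (\<Sum>i<D. 3 * R)" unfolding g_def
      proof (rule sum_norm_le)
        fix i assume "i \<in> {..<D}"
        then have "norm (e i) = 1" using eB by auto
        moreover have "\<bar>2 * schoenberg_coord D i t - 1\<bar> \<le> 3" using schoenberg_coord_bounds[of D i t] by linarith
        ultimately show "norm (((2 * schoenberg_coord D i t - 1) * R) *\<^sub>R e i) \<le> 3 * R"
          using R by (simp add: abs_mult)
      qed
      then show "norm y \<le> (\<Sum>i<D. 3 * R)" using t by simp
    qed
    have x_meas: "(\<lambda>y. x y i) \<in> borel_measurable borel" for i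
      unfolding x_def by measurable
    have "(\<lambda>y. of_bool (odd \<lfloor>2^(m div D + 1) * x y (m mod D)\<rfloor>) * 2 / 3 ^ (m+1) :: real) \<in> borel_measurable borel" for m
    proof -
      have "(\<lambda>y. \<lfloor>2^(m div D + 1) * x y (m mod D)\<rfloor>) \<in> borel \<rightarrow>\<^sub>M count_space UNIV"
        using x_meas by measurable
      then show ?thesis by (rule measurable_compose) auto
    qed
    then show "h \<in> borel_measurable borel"
      unfolding h_def[abs_def] ternary_def by (rule borel_measurable_suminf)
    show "range h \<subseteq> {0..1}" using ternary_bounds by (auto simp: h_def)
    fix y :: 'a assume y: "norm y < R"
    have x01: "0 \<le> x y i" "x y i < 1" if "i < D" for i
    proof -
      have "\<bar>y \<bullet> e i\<bar> < R" using y Basis_le_norm[OF eB[OF that], of y] by linarith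
      then show "0 \<le> x y i" "x y i < 1" using R by (auto simp: x_def field_simps abs_less_iff)
    qed
    have "g (h y) = (\<Sum>i<D. (y \<bullet> e i) *\<^sub>R e i)"
      unfolding g_def h_def
    proof (intro sum.cong refl)
      fix i assume i: "i \<in> {..<D}"
      then have "schoenberg_coord D i (ternary (\<lambda>m. odd \<lfloor>2^(m div D + 1) * x y (m mod D)\<rfloor>)) = x y i"
        using x01[of i] by (intro schoenberg_coord_ternary) auto
      then show "((2 * schoenberg_coord D i (ternary (\<lambda>m. odd \<lfloor>2^(m div D + 1) * x y (m mod D)\<rfloor>)) - 1) * R) *\<^sub>R e i = (y \<bullet> e i) *\<^sub>R e i"
        using R by (simp add: x_def field_simps)
    qed
    also have "\<dots> = (\<Sum>b\<in>Basis. (y \<bullet> b) *\<^sub>R b)"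
      by (rule sum.reindex_bij_betw[OF e])
    also have "\<dots> = y" by (rule euclidean_representation)
    finally show "g (h y) = y" .
  qed
qed

text \<open>
  Transport the measures to \<open>[0,1]\<close> along the section \<open>h\<close>, extract a weakly convergent subsequence by
  Helly's theorem, and push the limit forward along the continuous curve \<open>g\<close>. Since \<open>g \<circ> h\<close> is the
  identity on the supports, integrals of \<open>f\<close> upstairs are integrals of the continuous function \<open>f \<circ> g\<close>
  on the line.
\<close>
theorem weakly_convergent_subsequence_bounded_support:
  fixes M :: "nat \<Rightarrow> 'a::euclidean_space measure"
  assumes M: "\<And>n. prob_space (M n)" "\<And>n. sets (M n) = sets borel"
    and R: "\<And>n. AE x in M n. norm x < R"
  obtains r N where "strict_mono (r :: nat \<Rightarrow> nat)" "prob_space N" "sets N = sets borel"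
    "\<And>f :: 'a \<Rightarrow> complex. continuous_on UNIV f \<Longrightarrow> (\<lambda>n. \<integral>x. f x \<partial>M (r n)) \<longlonglongrightarrow> (\<integral>x. f x \<partial>N)"
proof -
  have "R > 0"
  proof (rule ccontr)
    assume "\<not> R > 0"
    then have "\<not> norm x < R" for x :: 'a using norm_ge_zero[of x] by linarith
    then show False using R[of 0] prob_space.AE_False[OF M(1)] by simp
  qed
  then obtain g :: "real \<Rightarrow> 'a" and h :: "'a \<Rightarrow> real" where g: "continuous_on UNIV g" "bounded (range g)"
    and h: "h \<in> borel_measurable borel" "range h \<subseteq> {0..1}" and gh: "\<And>y. norm y < R \<Longrightarrow> g (h y) = y"
    by (rule bounded_continuous_curve_with_borel_section) blast
  note [measurable_cong] = M(2)
  note [measurable] = h(1)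
  define L where "L n = distr (M n) borel h" for n
  have L: "real_distribution (L n)" for n
    unfolding L_def real_distribution_def real_distribution_axioms_def
    by (auto intro!: prob_space.prob_space_distr M(1))
  have "tight L"
    unfolding tight_def
  proof (intro conjI allI impI L)
    fix \<epsilon> :: real assume "\<epsilon> > 0"
    have "measure (L n) {-1<..1} = 1" for n
    proof -
      interpret prob_space "M n" by (rule M(1))
      have "h -` {-1<..1} \<inter> space (M n) = space (M n)" using h(2) by (auto simp: image_subset_iff) (smt (verit))
      then show ?thesis unfolding L_def by (subst measure_distr) (auto simp: prob_space)
    qed
    then show "\<exists>a b. a < b \<and> (\<forall>n. 1 - \<epsilon> < measure (L n) {a<..b})"
      using \<open>\<epsilon> > 0\<close> by (intro exI[of _ "-1"] exI[of _ 1]) auto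
  qed
  then obtain r P where r: "strict_mono (r :: nat \<Rightarrow> nat)" and P: "real_distribution P"
    and conv: "weak_conv_m (\<lambda>n. L (r n)) P"
    using tight_imp_convergent_subsubsequence[of L id] by (auto simp: strict_mono_id o_def)
  interpret P: real_distribution P by fact
  have gm [measurable]: "g \<in> borel_measurable borel" using g(1) by (rule borel_measurable_continuous_onI)
  define N where "N = distr P borel g"
  show ?thesis
  proof
    show "strict_mono r" by fact
    show "prob_space N" unfolding N_def by (intro P.prob_space_distr) simp
    show "sets N = sets borel" by (simp add: N_def)
    fix f :: "'a \<Rightarrow> complex" assume f: "continuous_on UNIV f"
    then have fm [measurable]: "f \<in> borel_measurable borel" by (rule borel_measurable_continuous_onI)
    have "bounded (f ` closure (range g))"
      using g(2) by (intro compact_imp_bounded compact_continuous_image continuous_on_subset[OF f]) auto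
    then obtain B where B: "\<And>y. y \<in> closure (range g) \<Longrightarrow> norm (f y) \<le> B"
      unfolding bounded_iff by blast
    have fg: "continuous_on UNIV (\<lambda>t. f (g t))"
      by (rule continuous_on_compose2[OF f g(1)]) auto
    have "(\<lambda>n. \<integral>t. f (g t) \<partial>L (r n)) \<longlonglongrightarrow> (\<integral>t. f (g t) \<partial>P)"
    proof (rule weak_conv_imp_integral_bdd_continuous_conv)
      show "isCont (\<lambda>t. f (g t)) t" for t
        using fg by (simp add: continuous_on_eq_continuous_at)
      show "norm (f (g t)) \<le> B" for t
        by (intro B subsetD[OF closure_subset]) auto
    qed (use L P conv in auto)
    moreover have "(\<integral>t. f (g t) \<partial>L n) = (\<integral>x. f x \<partial>M n)" for n
    proof -
      have "(\<integral>t. f (g t) \<partial>L n) = (\<integral>x. f (g (h x)) \<partial>M n)"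
        unfolding L_def by (rule integral_distr) measurable
      also have "\<dots> = (\<integral>x. f x \<partial>M n)"
        using R[of n] gh by (intro integral_cong_AE) (auto elim!: eventually_mono)
      finally show ?thesis .
    qed
    moreover have "(\<integral>t. f (g t) \<partial>P) = (\<integral>x. f x \<partial>N)"
      unfolding N_def by (rule integral_distr[symmetric]) measurable
    ultimately show "(\<lambda>n. \<integral>x. f x \<partial>M (r n)) \<longlonglongrightarrow> (\<integral>x. f x \<partial>N)" by simp
  qed
qed

text \<open>
  The limit measure lives on the sphere because the integrals of the continuous function
  \<open>min 1 | |\<zeta>| - 1 |\<close> pass to the limit.
\<close>
theorem sphere_moment_limit:
  fixes M :: "nat \<Rightarrow> (complex ^ 'd::finite) measure"
  assumes M: "\<And>n. prob_space (M n)" "\<And>n. sets (M n) = sets borel" "\<And>n. AE \<zeta> in M n. norm \<zeta> = 1"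
    and lim: "\<And>\<alpha> \<beta>. (\<lambda>n. \<integral>\<zeta>. monomial \<alpha> \<zeta> * cnj (monomial \<beta> \<zeta>) \<partial>M n) \<longlonglongrightarrow> L \<alpha> \<beta>"
  obtains N where "prob_space N" "sets N = sets borel" "AE \<zeta> in N. norm \<zeta> = 1"
    "\<And>\<alpha> \<beta>. (\<integral>\<zeta>. monomial \<alpha> \<zeta> * cnj (monomial \<beta> \<zeta>) \<partial>N) = L \<alpha> \<beta>"
proof -
  (* The bound must exceed 1, as the section of the curve covers open balls only. *)
  have bound: "AE \<zeta> in M n. norm \<zeta> < 2" for n using M(3)[of n] by eventually_elim simp
  obtain r N where r: "strict_mono (r :: nat \<Rightarrow> nat)" and N: "prob_space N" "sets N = sets borel"
    and conv: "\<And>f :: complex ^ 'd \<Rightarrow> complex. continuous_on UNIV f \<Longrightarrow> (\<lambda>n. \<integral>x. f x \<partial>M (r n)) \<longlonglongrightarrow> (\<integral>x. f x \<partial>N)"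
    by (rule weakly_convergent_subsequence_bounded_support[OF M(1,2) bound]) (rule that)
  interpret N: prob_space N by fact
  note [measurable_cong] = N(2)
  have "AE \<zeta> in N. norm \<zeta> = 1"
  proof -
    define g where "g \<zeta> = min 1 \<bar>norm \<zeta> - 1\<bar>" for \<zeta> :: "complex ^ 'd"
    have g_nonneg: "0 \<le> g \<zeta>" for \<zeta> by (simp add: g_def)
    have gm [measurable]: "g \<in> borel_measurable borel"
      unfolding g_def[abs_def] by measurable
    have "(\<integral>\<zeta>. complex_of_real (g \<zeta>) \<partial>M n) = 0" for n
    proof -
      have "AE \<zeta> in M n. complex_of_real (g \<zeta>) = 0" using M(3)[of n] by eventually_elim (simp add: g_def)
      then show ?thesis by (rule integral_eq_zero_AE)
    qed
    moreover have "(\<lambda>n. \<integral>\<zeta>. complex_of_real (g \<zeta>) \<partial>M (r n)) \<longlonglongrightarrow> (\<integral>\<zeta>. complex_of_real (g \<zeta>) \<partial>N)"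
      by (rule conv) (auto simp: g_def intro!: continuous_intros)
    ultimately have "(\<integral>\<zeta>. complex_of_real (g \<zeta>) \<partial>N) = 0" by (simp add: LIMSEQ_const_iff)
    then have "(\<integral>\<zeta>. g \<zeta> \<partial>N) = 0" by simp
    moreover have "integrable N g"
      by (rule N.integrable_const_bound[of _ 1]) (auto simp: g_def)
    ultimately have "AE \<zeta> in N. g \<zeta> = 0"
      using integral_nonneg_eq_0_iff_AE[of N g] g_nonneg by simp
    then show ?thesis by eventually_elim (auto simp: g_def min_def split: if_splits)
  qed
  moreover have "(\<integral>\<zeta>. monomial \<alpha> \<zeta> * cnj (monomial \<beta> \<zeta>) \<partial>N) = L \<alpha> \<beta>" for \<alpha> \<beta>
  proof (rule LIMSEQ_unique)
    show "(\<lambda>n. \<integral>\<zeta>. monomial \<alpha> \<zeta> * cnj (monomial \<beta> \<zeta>) \<partial>M (r n)) \<longlonglongrightarrow> (\<integral>\<zeta>. monomial \<alpha> \<zeta> * cnj (monomial \<beta> \<zeta>) \<partial>N)"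
      by (intro conv continuous_intros)
    show "(\<lambda>n. \<integral>\<zeta>. monomial \<alpha> \<zeta> * cnj (monomial \<beta> \<zeta>) \<partial>M (r n)) \<longlonglongrightarrow> L \<alpha> \<beta>"
      using LIMSEQ_subseq_LIMSEQ[OF lim r] by (simp add: o_def)
  qed
  ultimately show ?thesis using that N by blast
qed

section \<open>Sums over multi-indices of a fixed degree\<close>

definition multi_fact :: "'d::finite multi_index \<Rightarrow> real" where
  "multi_fact \<alpha> = (\<Prod>i\<in>UNIV. fact (\<alpha> $ i))"

definition degree_slice :: "nat \<Rightarrow> 'd::finite multi_index set" where
  "degree_slice n = {\<gamma>. total_degree \<gamma> = n}"

lemma finite_degree_slice [simp]: "finite (degree_slice n)"
  unfolding degree_slice_def by (rule finite_subset[OF _ finite_total_degree_le[of n]]) auto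

lemma multi_fact_pos [simp]: "0 < multi_fact \<alpha>"
  by (simp add: multi_fact_def prod_pos)

lemma total_degree_add: "total_degree (\<alpha> + \<beta>) = total_degree \<alpha> + total_degree \<beta>"
  by (simp add: total_degree_def sum.distrib)

lemma total_degree_axis [simp]: "total_degree (axis j k) = k"
  by (simp add: total_degree_def axis_def)

lemma total_degree_zero [simp]: "total_degree 0 = 0"
  by (simp add: total_degree_def)

lemma multi_diff_add: "\<alpha> \<le> \<gamma> \<Longrightarrow> \<gamma> - \<alpha> + \<alpha> = (\<gamma> :: 'd::finite multi_index)"
  by (simp add: vec_eq_iff less_eq_vec_def)

lemma total_degree_diff: "\<alpha> \<le> \<gamma> \<Longrightarrow> total_degree (\<gamma> - \<alpha>) = total_degree \<gamma> - total_degree \<alpha>"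
  by (metis add_diff_cancel_right' multi_diff_add total_degree_add)

lemma total_degree_mono: "\<alpha> \<le> \<gamma> \<Longrightarrow> total_degree \<alpha> \<le> total_degree \<gamma>"
  by (metis le_add2 multi_diff_add total_degree_add)

lemma degree_slice_0 [simp]: "degree_slice 0 = {0 :: 'd::finite multi_index}"
  by (auto simp: degree_slice_def total_degree_def vec_eq_iff)

lemma multi_fact_add_axis: "multi_fact (\<gamma> + axis j 1) = real (\<gamma> $ j + 1) * multi_fact \<gamma>"
proof -
  have "multi_fact (\<gamma> + axis j 1) = fact (\<gamma> $ j + 1) * (\<Prod>i\<in>UNIV - {j}. fact ((\<gamma> + axis j 1) $ i))"
    unfolding multi_fact_def by (subst prod.remove[of _ j]) (auto simp: axis_def)
  also have "(\<Prod>i\<in>UNIV - {j}. fact ((\<gamma> + axis j 1) $ i)) = (\<Prod>i\<in>UNIV - {j}. fact (\<gamma> $ i) :: real)"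
    by (intro prod.cong) (auto simp: axis_def)
  also have "fact (\<gamma> $ j + 1) * \<dots> = real (\<gamma> $ j + 1) * multi_fact \<gamma>"
    unfolding multi_fact_def by (subst (2) prod.remove[of _ j]) (auto simp: algebra_simps)
  finally show ?thesis .
qed

lemma sum_degree_slice_shift:
  assumes "n = total_degree \<alpha> + m"
  shows "(\<Sum>\<gamma> | \<gamma> \<in> degree_slice n \<and> \<alpha> \<le> \<gamma>. f \<gamma>) = (\<Sum>\<gamma>\<in>degree_slice m. f (\<gamma> + \<alpha>))"
  by (rule sum.reindex_bij_witness[of _ "\<lambda>\<gamma>. \<gamma> + \<alpha>" "\<lambda>\<gamma>. \<gamma> - \<alpha>"])
     (use assms in \<open>auto simp: degree_slice_def total_degree_add multi_diff_add total_degree_diff less_eq_vec_def vec_eq_iff\<close>)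

text \<open>
  The multinomial form of the shift identity, by induction on \<open>n\<close>: weighting the slice of degree
  \<open>n + 1\<close> by \<open>\<Sum>\<^sub>j \<gamma>\<^sub>j = n + 1\<close> and lowering \<open>\<gamma>\<close> at \<open>j\<close> in the \<open>j\<close>-th summand turns the sum into one over the
  slice of degree \<open>n\<close>.
\<close>
lemma sum_degree_slice_of_shift_invariant:
  fixes F :: "'d::finite multi_index \<Rightarrow> 'v::real_vector"
  assumes F: "\<And>\<gamma>. F \<gamma> = (\<Sum>j\<in>UNIV. F (\<gamma> + axis j 1))"
  shows "(\<Sum>\<gamma>\<in>degree_slice n. (1 / multi_fact \<gamma>) *\<^sub>R F \<gamma>) = (1 / fact n) *\<^sub>R F 0"
proof (induction n)
  case 0
  then show ?case by (simp add: multi_fact_def)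
next
  case (Suc n)
  have le: "axis j 1 \<le> \<gamma> \<longleftrightarrow> \<gamma> $ j \<noteq> 0" for j and \<gamma> :: "'d multi_index"
    by (auto simp: less_eq_vec_def axis_def)
  have "real (Suc n) *\<^sub>R (\<Sum>\<gamma>\<in>degree_slice (Suc n). (1 / multi_fact \<gamma>) *\<^sub>R F \<gamma>)
      = (\<Sum>\<gamma>\<in>degree_slice (Suc n). (\<Sum>j\<in>UNIV. real (\<gamma> $ j)) *\<^sub>R (1 / multi_fact \<gamma>) *\<^sub>R F \<gamma>)"
    unfolding scaleR_right.sum
    by (intro sum.cong) (auto simp: degree_slice_def total_degree_def simp flip: of_nat_sum)
  also have "\<dots> = (\<Sum>j\<in>UNIV. \<Sum>\<gamma>\<in>degree_slice (Suc n). (real (\<gamma> $ j) / multi_fact \<gamma>) *\<^sub>R F \<gamma>)"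
    unfolding scaleR_left.sum by (subst sum.swap) simp
  also have "\<dots> = (\<Sum>j\<in>UNIV. \<Sum>\<gamma>\<in>degree_slice n. (1 / multi_fact \<gamma>) *\<^sub>R F (\<gamma> + axis j 1))"
  proof (rule sum.cong[OF refl])
    fix j :: 'd
    have "(\<Sum>\<gamma>\<in>degree_slice (Suc n). (real (\<gamma> $ j) / multi_fact \<gamma>) *\<^sub>R F \<gamma>)
       = (\<Sum>\<gamma> | \<gamma> \<in> degree_slice (Suc n) \<and> axis j 1 \<le> \<gamma>. (real (\<gamma> $ j) / multi_fact \<gamma>) *\<^sub>R F \<gamma>)"
      by (rule sum.mono_neutral_right) (auto simp: le[unfolded One_nat_def])
    also have "\<dots> = (\<Sum>\<gamma>\<in>degree_slice n. (real ((\<gamma> + axis j 1) $ j) / multi_fact (\<gamma> + axis j 1)) *\<^sub>R F (\<gamma> + axis j 1))"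
      by (rule sum_degree_slice_shift) simp
    also have "\<dots> = (\<Sum>\<gamma>\<in>degree_slice n. (1 / multi_fact \<gamma>) *\<^sub>R F (\<gamma> + axis j 1))"
    proof (rule sum.cong[OF refl])
      fix \<gamma> :: "'d multi_index"
      have "real ((\<gamma> + axis j 1) $ j) = real (\<gamma> $ j + 1)" by simp
      then have "real ((\<gamma> + axis j 1) $ j) / multi_fact (\<gamma> + axis j 1) = 1 / multi_fact \<gamma>"
        by (simp only: multi_fact_add_axis) simp
      then show "(real ((\<gamma> + axis j 1) $ j) / multi_fact (\<gamma> + axis j 1)) *\<^sub>R F (\<gamma> + axis j 1) =
          (1 / multi_fact \<gamma>) *\<^sub>R F (\<gamma> + axis j 1)"
        by (simp only:)
    qed
    finally show "(\<Sum>\<gamma>\<in>degree_slice (Suc n). (real (\<gamma> $ j) / multi_fact \<gamma>) *\<^sub>R F \<gamma>) =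
      (\<Sum>\<gamma>\<in>degree_slice n. (1 / multi_fact \<gamma>) *\<^sub>R F (\<gamma> + axis j 1))" .
  qed
  also have "\<dots> = (\<Sum>\<gamma>\<in>degree_slice n. (1 / multi_fact \<gamma>) *\<^sub>R (\<Sum>j\<in>UNIV. F (\<gamma> + axis j 1)))"
    unfolding scaleR_right.sum by (rule sum.swap)
  also have "\<dots> = (\<Sum>\<gamma>\<in>degree_slice n. (1 / multi_fact \<gamma>) *\<^sub>R F \<gamma>)"
    by (simp only: F[symmetric])
  also have "\<dots> = (1 / fact n) *\<^sub>R F 0" by (rule Suc.IH)
  also have "\<dots> = real (Suc n) *\<^sub>R ((1 / fact (Suc n)) *\<^sub>R F 0)"
    by simp
  finally show ?case by (subst (asm) scaleR_cancel_left) simp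
qed

text \<open>
  The function \<open>\<gamma> \<mapsto> (\<gamma>+\<alpha>)! / (|\<gamma>+\<alpha>|+d-1)!\<close> (up to a constant, the Dirichlet moments of the simplex)
  itself satisfies the shift identity, so the multinomial form evaluates this sum.
\<close>
lemma sum_rising_degree_slice:
  fixes \<alpha> :: "'d::finite multi_index"
  shows "(\<Sum>\<gamma>\<in>degree_slice n. multi_fact (\<gamma> + \<alpha>) / multi_fact \<gamma>) =
    fact (n + total_degree \<alpha> + CARD('d) - 1) * multi_fact \<alpha> / (fact (total_degree \<alpha> + CARD('d) - 1) * fact n)"
proof -
  obtain d where d: "CARD('d) = Suc d"
    using zero_less_card_finite[where 'a='d] by (metis gr0_implies_Suc)
  define F where "F \<gamma> = multi_fact (\<gamma> + \<alpha>) / fact (total_degree (\<gamma> + \<alpha>) + d)" for \<gamma>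
  have "F \<gamma> = (\<Sum>j\<in>UNIV. F (\<gamma> + axis j 1))" for \<gamma>
  proof -
    define D where "D = total_degree (\<gamma> + \<alpha>)"
    have "(\<Sum>j\<in>UNIV. F (\<gamma> + axis j 1)) = (\<Sum>j\<in>UNIV. real ((\<gamma> + \<alpha>) $ j + 1) * multi_fact (\<gamma> + \<alpha>) / fact (D + 1 + d))"
      unfolding F_def D_def
    proof (intro sum.cong refl)
      fix j :: 'd
      have "\<gamma> + axis j 1 + \<alpha> = (\<gamma> + \<alpha>) + axis j 1" by (simp add: ac_simps)
      then show "multi_fact (\<gamma> + axis j 1 + \<alpha>) / fact (total_degree (\<gamma> + axis j 1 + \<alpha>) + d) =
          real ((\<gamma> + \<alpha>) $ j + 1) * multi_fact (\<gamma> + \<alpha>) / fact (total_degree (\<gamma> + \<alpha>) + 1 + d)"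
        by (simp only: multi_fact_add_axis total_degree_add total_degree_axis)
    qed
    also have "\<dots> = (\<Sum>j\<in>UNIV. real ((\<gamma> + \<alpha>) $ j + 1)) * multi_fact (\<gamma> + \<alpha>) / fact (D + 1 + d)"
      by (simp add: sum_distrib_right sum_divide_distrib)
    also have "(\<Sum>j\<in>UNIV. real ((\<gamma> + \<alpha>) $ j + 1)) = real (D + Suc d)"
      unfolding of_nat_sum[symmetric] sum.distrib by (simp add: D_def total_degree_def sum.distrib d)
    also have "real (D + Suc d) * multi_fact (\<gamma> + \<alpha>) / fact (D + 1 + d) = multi_fact (\<gamma> + \<alpha>) / fact (D + d)"
      by (simp del: of_nat_Suc of_nat_add)
    also have "\<dots> = F \<gamma>" by (simp add: F_def D_def)
    finally show ?thesis by simp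
  qed
  from sum_degree_slice_of_shift_invariant[of F n, OF this]
  have "(\<Sum>\<gamma>\<in>degree_slice n. 1 / multi_fact \<gamma> * F \<gamma>) = F 0 / fact n" by simp
  also have "(\<Sum>\<gamma>\<in>degree_slice n. 1 / multi_fact \<gamma> * F \<gamma>) =
     (\<Sum>\<gamma>\<in>degree_slice n. multi_fact (\<gamma> + \<alpha>) / multi_fact \<gamma>) / fact (n + total_degree \<alpha> + d)"
    unfolding sum_divide_distrib F_def
    by (intro sum.cong) (auto simp: total_degree_add degree_slice_def)
  finally show ?thesis by (simp add: F_def d field_simps)
qed

text \<open>
  Vandermonde's convolution for \<open>e choose b\<close> with \<open>e = a + (e - a)\<close>, written with factorials. A summand
  whose second binomial coefficient vanishes is recorded by the condition \<open>a + b \<le> e + k\<close>, as the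
  factorial in the denominator would be taken of a truncated difference.
\<close>
lemma vandermonde_fact:
  assumes "a \<le> e" "b \<le> e"
  shows "fact e / (fact (e - a) * fact (e - b)) =
    (\<Sum>k\<le>b. if a + b \<le> e + k then fact k * real (a choose k) * real (b choose k) / fact (e + k - (a + b)) else 0)"
proof -
  have "(fact b / fact (e - a)) * real (e choose b) =
     (\<Sum>k\<le>b. (fact b / fact (e - a)) * (real (a choose k) * real ((e - a) choose (b - k))))"
  proof -
    have "real (e choose b) = real (\<Sum>k\<le>b. (a choose k) * ((e - a) choose (b - k)))"
      using vandermonde[of a "e - a" b] assms by simp
    then show ?thesis unfolding sum_distrib_left[symmetric] by simp
  qed
  also have "\<dots> = (\<Sum>k\<le>b. if a + b \<le> e + k then fact k * real (a choose k) * real (b choose k) / fact (e + k - (a + b)) else 0)"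
  proof (intro sum.cong refl)
    fix k assume k: "k \<in> {..b}"
    show "(fact b / fact (e - a)) * (real (a choose k) * real ((e - a) choose (b - k))) =
      (if a + b \<le> e + k then fact k * real (a choose k) * real (b choose k) / fact (e + k - (a + b)) else 0)"
    proof (cases "a + b \<le> e + k")
      case True
      then have *: "b - k \<le> e - a" "e - a - (b - k) = e + k - (a + b)" using k assms by auto
      show ?thesis using True k
        by (simp add: binomial_fact[OF *(1)] binomial_fact[of k b] *(2))
    next
      case False
      then have "(e - a) choose (b - k) = 0" using assms k by (intro binomial_eq_0) auto
      then show ?thesis using False by simp
    qed
  qed
  finally show ?thesis using assms by (simp add: binomial_fact field_simps)
qed

lemma finite_multi_index_atMost [simp]: "finite {..\<beta> :: 'd::finite multi_index}"
  by (rule finite_subset[OF _ finite_total_degree_le[of "total_degree \<beta>"]]) (auto intro: total_degree_mono)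

lemma prod_sum_atMost_multi_index:
  fixes f :: "'d::finite \<Rightarrow> nat \<Rightarrow> 'c::comm_semiring_1"
  shows "(\<Prod>i\<in>UNIV. \<Sum>k\<le>\<beta> $ i. f i k) = (\<Sum>\<kappa>\<le>\<beta>. \<Prod>i\<in>UNIV. f i (\<kappa> $ i))"
proof -
  have "(\<Prod>i\<in>UNIV. \<Sum>k\<le>\<beta> $ i. f i k) = (\<Sum>g\<in>PiE UNIV (\<lambda>i. {..\<beta> $ i}). \<Prod>i\<in>UNIV. f i (g i))"
    by (rule prod_sum_PiE) auto
  also have "\<dots> = (\<Sum>\<kappa>\<le>\<beta>. \<Prod>i\<in>UNIV. f i (\<kappa> $ i))"
    by (rule sum.reindex_bij_witness[of _ vec_nth vec_lambda]) (auto simp: less_eq_vec_def PiE_iff)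
  finally show ?thesis .
qed

text \<open>
  The coefficients \<open>\<kappa>! (\<alpha> choose \<kappa>) (\<beta> choose \<kappa>)\<close> of Wick's formula for the normal ordering of
  annihilation and creation operators.
\<close>
definition contraction_coeff :: "'d::finite multi_index \<Rightarrow> 'd multi_index \<Rightarrow> 'd multi_index \<Rightarrow> real" where
  "contraction_coeff \<alpha> \<beta> \<kappa> = (\<Prod>i\<in>UNIV. fact (\<kappa> $ i) * real (\<alpha> $ i choose \<kappa> $ i) * real (\<beta> $ i choose \<kappa> $ i))"

lemma contraction_coeff_0 [simp]: "contraction_coeff \<alpha> \<beta> 0 = 1"
  by (simp add: contraction_coeff_def)

lemma contraction_coeff_eq_0:
  assumes "\<not> \<kappa> \<le> \<alpha>"
  shows "contraction_coeff \<alpha> \<beta> \<kappa> = 0"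
proof -
  obtain i where "\<alpha> $ i < \<kappa> $ i" using assms by (auto simp: less_eq_vec_def not_le)
  then have "\<alpha> $ i choose \<kappa> $ i = 0" by (rule binomial_eq_0)
  then show ?thesis unfolding contraction_coeff_def by (intro prod_zero) auto
qed

lemma multi_vandermonde:
  fixes \<alpha> \<beta> \<epsilon> :: "'d::finite multi_index"
  assumes "\<alpha> \<le> \<epsilon>" "\<beta> \<le> \<epsilon>"
  shows "multi_fact \<epsilon> / (multi_fact (\<epsilon> - \<alpha>) * multi_fact (\<epsilon> - \<beta>)) =
    (\<Sum>\<kappa>\<le>\<beta>. if \<alpha> + \<beta> \<le> \<epsilon> + \<kappa> then contraction_coeff \<alpha> \<beta> \<kappa> / multi_fact (\<epsilon> + \<kappa> - (\<alpha> + \<beta>)) else 0)"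
proof -
  have "multi_fact \<epsilon> / (multi_fact (\<epsilon> - \<alpha>) * multi_fact (\<epsilon> - \<beta>)) =
    (\<Prod>i\<in>UNIV. fact (\<epsilon> $ i) / (fact (\<epsilon> $ i - \<alpha> $ i) * fact (\<epsilon> $ i - \<beta> $ i)))"
    by (simp add: multi_fact_def prod_dividef prod.distrib)
  also have "\<dots> = (\<Prod>i\<in>UNIV. \<Sum>k\<le>\<beta> $ i. if \<alpha> $ i + \<beta> $ i \<le> \<epsilon> $ i + k
      then fact k * real (\<alpha> $ i choose k) * real (\<beta> $ i choose k) / fact (\<epsilon> $ i + k - (\<alpha> $ i + \<beta> $ i)) else 0)"
    using assms by (intro prod.cong refl vandermonde_fact) (auto simp: less_eq_vec_def)
  also have "\<dots> = (\<Sum>\<kappa>\<le>\<beta>. \<Prod>i\<in>UNIV. if \<alpha> $ i + \<beta> $ i \<le> \<epsilon> $ i + \<kappa> $ i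
      then fact (\<kappa> $ i) * real (\<alpha> $ i choose \<kappa> $ i) * real (\<beta> $ i choose \<kappa> $ i) / fact (\<epsilon> $ i + \<kappa> $ i - (\<alpha> $ i + \<beta> $ i)) else 0)"
    by (rule prod_sum_atMost_multi_index)
  also have "\<dots> = (\<Sum>\<kappa>\<le>\<beta>. if \<alpha> + \<beta> \<le> \<epsilon> + \<kappa> then contraction_coeff \<alpha> \<beta> \<kappa> / multi_fact (\<epsilon> + \<kappa> - (\<alpha> + \<beta>)) else 0)"
  proof (intro sum.cong refl)
    fix \<kappa> :: "'d multi_index"
    show "(\<Prod>i\<in>UNIV. if \<alpha> $ i + \<beta> $ i \<le> \<epsilon> $ i + \<kappa> $ i
      then fact (\<kappa> $ i) * real (\<alpha> $ i choose \<kappa> $ i) * real (\<beta> $ i choose \<kappa> $ i) / fact (\<epsilon> $ i + \<kappa> $ i - (\<alpha> $ i + \<beta> $ i)) else 0) =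
      (if \<alpha> + \<beta> \<le> \<epsilon> + \<kappa> then contraction_coeff \<alpha> \<beta> \<kappa> / multi_fact (\<epsilon> + \<kappa> - (\<alpha> + \<beta>)) else 0)"
    proof (cases "\<alpha> + \<beta> \<le> \<epsilon> + \<kappa>")
      case True
      then show ?thesis
        by (simp add: less_eq_vec_def contraction_coeff_def multi_fact_def prod_dividef)
    next
      case False
      then obtain i where "\<not> \<alpha> $ i + \<beta> $ i \<le> \<epsilon> $ i + \<kappa> $ i" by (auto simp: less_eq_vec_def)
      then show ?thesis using False by (simp only: if_False) (rule prod_zero, auto)
    qed
  qed
  finally show ?thesis .
qed

text \<open>
  After the Vandermonde convolution the inner sum runs over \<open>\<epsilon>\<close> with \<open>\<epsilon> + \<kappa> \<ge> \<alpha> + \<beta>\<close>. In terms of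
  \<open>\<gamma> = \<epsilon> + \<kappa> - \<alpha> - \<beta>\<close> it is the multinomial form of the shift identity at \<open>(\<alpha>-\<kappa>, \<beta>-\<kappa>)\<close>.
\<close>
lemma sum_slice_antinormal_order:
  fixes K :: "'d::finite kernel"
  assumes K: "\<And>\<alpha> \<beta>. K \<alpha> \<beta> = (\<Sum>j\<in>UNIV. K (\<alpha> + axis j 1) (\<beta> + axis j 1))"
    and e: "total_degree \<alpha> + total_degree \<beta> \<le> e"
  shows "(\<Sum>\<epsilon> | \<epsilon> \<in> degree_slice e \<and> \<alpha> \<le> \<epsilon> \<and> \<beta> \<le> \<epsilon>.
      (multi_fact \<epsilon> / (multi_fact (\<epsilon> - \<alpha>) * multi_fact (\<epsilon> - \<beta>))) *\<^sub>R K (\<epsilon> - \<beta>) (\<epsilon> - \<alpha>)) =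
    (\<Sum>\<kappa> | \<kappa> \<le> \<alpha> \<and> \<kappa> \<le> \<beta>. (contraction_coeff \<alpha> \<beta> \<kappa> / fact (e + total_degree \<kappa> - (total_degree \<alpha> + total_degree \<beta>)))
       *\<^sub>R K (\<alpha> - \<kappa>) (\<beta> - \<kappa>))" (is "?lhs = ?rhs")
proof -
  let ?E = "{\<epsilon>. \<epsilon> \<in> degree_slice e \<and> \<alpha> \<le> \<epsilon> \<and> \<beta> \<le> \<epsilon>}"
  have finE: "finite ?E" by (rule finite_subset[OF _ finite_degree_slice[of e]]) auto
  have "?lhs = (\<Sum>\<epsilon>\<in>?E. \<Sum>\<kappa>\<le>\<beta>. (if \<alpha> + \<beta> \<le> \<epsilon> + \<kappa> then contraction_coeff \<alpha> \<beta> \<kappa> / multi_fact (\<epsilon> + \<kappa> - (\<alpha> + \<beta>)) else 0)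
      *\<^sub>R K (\<epsilon> - \<beta>) (\<epsilon> - \<alpha>))"
    by (intro sum.cong refl) (simp add: multi_vandermonde scaleR_left.sum)
  also have "\<dots> = (\<Sum>\<kappa>\<le>\<beta>. \<Sum>\<epsilon>\<in>?E. (if \<alpha> + \<beta> \<le> \<epsilon> + \<kappa> then contraction_coeff \<alpha> \<beta> \<kappa> / multi_fact (\<epsilon> + \<kappa> - (\<alpha> + \<beta>)) else 0)
      *\<^sub>R K (\<epsilon> - \<beta>) (\<epsilon> - \<alpha>))"
    by (rule sum.swap)
  also have "\<dots> = (\<Sum>\<kappa> | \<kappa> \<le> \<alpha> \<and> \<kappa> \<le> \<beta>. \<Sum>\<epsilon>\<in>?E. (if \<alpha> + \<beta> \<le> \<epsilon> + \<kappa> then contraction_coeff \<alpha> \<beta> \<kappa> / multi_fact (\<epsilon> + \<kappa> - (\<alpha> + \<beta>)) else 0)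
      *\<^sub>R K (\<epsilon> - \<beta>) (\<epsilon> - \<alpha>))"
  proof (rule sum.mono_neutral_right)
    have "contraction_coeff \<alpha> \<beta> \<kappa> = 0" if "\<kappa> \<in> {..\<beta>} - {\<kappa>. \<kappa> \<le> \<alpha> \<and> \<kappa> \<le> \<beta>}" for \<kappa>
      using that by (intro contraction_coeff_eq_0) auto
    then show "\<forall>\<kappa>\<in>{..\<beta>} - {\<kappa>. \<kappa> \<le> \<alpha> \<and> \<kappa> \<le> \<beta>}. (\<Sum>\<epsilon>\<in>?E.
        (if \<alpha> + \<beta> \<le> \<epsilon> + \<kappa> then contraction_coeff \<alpha> \<beta> \<kappa> / multi_fact (\<epsilon> + \<kappa> - (\<alpha> + \<beta>)) else 0)
        *\<^sub>R K (\<epsilon> - \<beta>) (\<epsilon> - \<alpha>)) = 0"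
      by (intro ballI sum.neutral) (simp only: div_0 if_cancel scale_zero_left)
  qed auto
  also have "\<dots> = ?rhs"
  proof (rule sum.cong[OF refl])
    fix \<kappa> assume "\<kappa> \<in> {\<kappa>. \<kappa> \<le> \<alpha> \<and> \<kappa> \<le> \<beta>}"
    then have \<kappa>: "\<And>i. \<kappa> $ i \<le> \<alpha> $ i" "\<And>i. \<kappa> $ i \<le> \<beta> $ i" by (auto simp: less_eq_vec_def)
    have td: "total_degree \<kappa> \<le> total_degree \<alpha>"
      using \<kappa> by (intro total_degree_mono) (auto simp: less_eq_vec_def)
    define m where "m = e + total_degree \<kappa> - (total_degree \<alpha> + total_degree \<beta>)"
    have "(\<Sum>\<epsilon>\<in>?E. (if \<alpha> + \<beta> \<le> \<epsilon> + \<kappa> then contraction_coeff \<alpha> \<beta> \<kappa> / multi_fact (\<epsilon> + \<kappa> - (\<alpha> + \<beta>)) else 0)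
      *\<^sub>R K (\<epsilon> - \<beta>) (\<epsilon> - \<alpha>)) = (\<Sum>\<epsilon> | \<epsilon> \<in> ?E \<and> \<alpha> + \<beta> \<le> \<epsilon> + \<kappa>. (contraction_coeff \<alpha> \<beta> \<kappa> / multi_fact (\<epsilon> + \<kappa> - (\<alpha> + \<beta>)))
      *\<^sub>R K (\<epsilon> - \<beta>) (\<epsilon> - \<alpha>))"
      using finE by (intro sum.mono_neutral_cong_right) auto
    also have "\<dots> = (\<Sum>\<gamma>\<in>degree_slice m. (contraction_coeff \<alpha> \<beta> \<kappa> / multi_fact \<gamma>) *\<^sub>R K (\<alpha> - \<kappa> + \<gamma>) (\<beta> - \<kappa> + \<gamma>))"
    proof (rule sum.reindex_bij_witness[of _ "\<lambda>\<gamma>. \<gamma> + (\<alpha> + \<beta> - \<kappa>)" "\<lambda>\<epsilon>. \<epsilon> + \<kappa> - (\<alpha> + \<beta>)"])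
      fix \<epsilon> assume \<epsilon>: "\<epsilon> \<in> {\<epsilon>. \<epsilon> \<in> ?E \<and> \<alpha> + \<beta> \<le> \<epsilon> + \<kappa>}"
      then have le: "\<And>i. \<alpha> $ i + \<beta> $ i \<le> \<epsilon> $ i + \<kappa> $ i" by (auto simp: less_eq_vec_def)
      show "\<epsilon> + \<kappa> - (\<alpha> + \<beta>) + (\<alpha> + \<beta> - \<kappa>) = \<epsilon>"
        unfolding vec_eq_iff
      proof
        show "(\<epsilon> + \<kappa> - (\<alpha> + \<beta>) + (\<alpha> + \<beta> - \<kappa>)) $ i = \<epsilon> $ i" for i
          using le[of i] \<kappa>[of i] by simp
      qed
      show "\<epsilon> + \<kappa> - (\<alpha> + \<beta>) \<in> degree_slice m"
        using \<epsilon> by (simp add: degree_slice_def m_def total_degree_diff total_degree_add)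
      have "\<epsilon> - \<beta> = \<alpha> - \<kappa> + (\<epsilon> + \<kappa> - (\<alpha> + \<beta>))" "\<epsilon> - \<alpha> = \<beta> - \<kappa> + (\<epsilon> + \<kappa> - (\<alpha> + \<beta>))"
        unfolding vec_eq_iff
      proof -
        have "(\<epsilon> - \<beta>) $ i = (\<alpha> - \<kappa> + (\<epsilon> + \<kappa> - (\<alpha> + \<beta>))) $ i"
          "(\<epsilon> - \<alpha>) $ i = (\<beta> - \<kappa> + (\<epsilon> + \<kappa> - (\<alpha> + \<beta>))) $ i" for i
          using le[of i] \<kappa>[of i] by simp_all
        then show "\<forall>i. (\<epsilon> - \<beta>) $ i = (\<alpha> - \<kappa> + (\<epsilon> + \<kappa> - (\<alpha> + \<beta>))) $ i"
          "\<forall>i. (\<epsilon> - \<alpha>) $ i = (\<beta> - \<kappa> + (\<epsilon> + \<kappa> - (\<alpha> + \<beta>))) $ i" by blast+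
      qed
      then show "(contraction_coeff \<alpha> \<beta> \<kappa> / multi_fact (\<epsilon> + \<kappa> - (\<alpha> + \<beta>))) *\<^sub>R
          K (\<alpha> - \<kappa> + (\<epsilon> + \<kappa> - (\<alpha> + \<beta>))) (\<beta> - \<kappa> + (\<epsilon> + \<kappa> - (\<alpha> + \<beta>))) =
          (contraction_coeff \<alpha> \<beta> \<kappa> / multi_fact (\<epsilon> + \<kappa> - (\<alpha> + \<beta>))) *\<^sub>R K (\<epsilon> - \<beta>) (\<epsilon> - \<alpha>)"
        by simp
    next
      fix \<gamma> :: "'d multi_index" assume \<gamma>: "\<gamma> \<in> degree_slice m"
      have \<kappa>': "\<kappa> $ i \<le> \<alpha> $ i + \<beta> $ i" for i using \<kappa>(1)[of i] by simp
      show "\<gamma> + (\<alpha> + \<beta> - \<kappa>) + \<kappa> - (\<alpha> + \<beta>) = \<gamma>"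
        unfolding vec_eq_iff
      proof
        show "(\<gamma> + (\<alpha> + \<beta> - \<kappa>) + \<kappa> - (\<alpha> + \<beta>)) $ i = \<gamma> $ i" for i
          using \<kappa>'[of i] by simp
      qed
      have "\<kappa> \<le> \<alpha> + \<beta>" using \<kappa>' by (simp add: less_eq_vec_def)
      then have "total_degree (\<gamma> + (\<alpha> + \<beta> - \<kappa>)) = e"
        using \<gamma> e td by (simp add: degree_slice_def total_degree_add total_degree_diff m_def)
      moreover have "\<alpha> $ i \<le> \<gamma> $ i + (\<alpha> $ i + \<beta> $ i - \<kappa> $ i)" "\<beta> $ i \<le> \<gamma> $ i + (\<alpha> $ i + \<beta> $ i - \<kappa> $ i)" for i
        using \<kappa>[of i] by auto
      ultimately show "\<gamma> + (\<alpha> + \<beta> - \<kappa>) \<in> {\<epsilon>. \<epsilon> \<in> ?E \<and> \<alpha> + \<beta> \<le> \<epsilon> + \<kappa>}"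
        using \<kappa>' by (auto simp: less_eq_vec_def degree_slice_def)
    qed
    also have "\<dots> = contraction_coeff \<alpha> \<beta> \<kappa> *\<^sub>R (\<Sum>\<gamma>\<in>degree_slice m. (1 / multi_fact \<gamma>) *\<^sub>R K (\<alpha> - \<kappa> + \<gamma>) (\<beta> - \<kappa> + \<gamma>))"
      by (simp add: scaleR_right.sum)
    also have "(\<Sum>\<gamma>\<in>degree_slice m. (1 / multi_fact \<gamma>) *\<^sub>R K (\<alpha> - \<kappa> + \<gamma>) (\<beta> - \<kappa> + \<gamma>)) = (1 / fact m) *\<^sub>R K (\<alpha> - \<kappa>) (\<beta> - \<kappa>)"
    proof -
      have "K (\<alpha> - \<kappa> + \<gamma>) (\<beta> - \<kappa> + \<gamma>) =
          (\<Sum>j\<in>UNIV. K (\<alpha> - \<kappa> + (\<gamma> + axis j 1)) (\<beta> - \<kappa> + (\<gamma> + axis j 1)))" for \<gamma>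
        unfolding add.assoc[symmetric] by (rule K)
      from sum_degree_slice_of_shift_invariant[of "\<lambda>\<gamma>. K (\<alpha> - \<kappa> + \<gamma>) (\<beta> - \<kappa> + \<gamma>)" m, OF this]
      show ?thesis by simp
    qed
    finally show "(\<Sum>\<epsilon>\<in>?E. (if \<alpha> + \<beta> \<le> \<epsilon> + \<kappa> then contraction_coeff \<alpha> \<beta> \<kappa> / multi_fact (\<epsilon> + \<kappa> - (\<alpha> + \<beta>)) else 0)
      *\<^sub>R K (\<epsilon> - \<beta>) (\<epsilon> - \<alpha>)) = (contraction_coeff \<alpha> \<beta> \<kappa> / fact (e + total_degree \<kappa> - (total_degree \<alpha> + total_degree \<beta>)))
       *\<^sub>R K (\<alpha> - \<kappa>) (\<beta> - \<kappa>)"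
      by (simp add: m_def)
  qed
  finally show ?thesis .
qed

section \<open>The moments of the uniform measure on the sphere\<close>

lemma fact_add_asymp: "(\<lambda>n. fact (n + a) / (fact n * real n ^ a)) \<longlonglongrightarrow> 1"
proof (induction a)
  case 0
  then show ?case by simp
next
  case (Suc a)
  have "(\<lambda>n. 1 + real (a + 1) / real n) \<longlonglongrightarrow> 1 + 0" by (intro tendsto_intros lim_const_over_n)
  from tendsto_mult[OF Suc this]
  have "(\<lambda>n. fact (n + a) / (fact n * real n ^ a) * (1 + real (a + 1) / real n)) \<longlonglongrightarrow> 1" by simp
  moreover have "\<forall>\<^sub>F n in sequentially. fact (n + a) / (fact n * real n ^ a) * (1 + real (a + 1) / real n) =
      fact (n + Suc a) / (fact n * real n ^ Suc a)"
    using eventually_gt_at_top[of 0] by eventually_elim (simp add: field_simps)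
  ultimately show ?case by (rule Lim_transform_eventually)
qed

lemma power_le_fact_quotient: "fact g * real g ^ a \<le> fact (g + a)"
proof (induction a)
  case (Suc a)
  have "fact g * real g ^ Suc a = real g * (fact g * real g ^ a)" by simp
  also have "\<dots> \<le> real (g + Suc a) * fact (g + a)" by (intro mult_mono Suc) auto
  finally show ?case by (simp del: of_nat_add of_nat_Suc)
qed simp

lemma fact_quotient_le_power: "fact (g + a) \<le> fact g * real (g + a) ^ a"
proof (induction a)
  case (Suc a)
  have "fact (g + Suc a) = real (g + Suc a) * fact (g + a)" by (simp del: of_nat_add of_nat_Suc)
  also have "\<dots> \<le> real (g + Suc a) * (fact g * real (g + a) ^ a)" by (intro mult_left_mono Suc) auto
  also have "\<dots> \<le> real (g + Suc a) * (fact g * real (g + Suc a) ^ a)"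
    by (intro mult_left_mono power_mono) auto
  finally show ?case by (simp add: mult_ac)
qed simp

text \<open>
  The sum over lattice points of the simplex is squeezed between two sums that
  \<open>sum_rising_degree_slice\<close> evaluates exactly: powers lie between falling and rising factorials, and
  falling factorials are rising ones shifted by \<open>\<alpha>\<close>. Both bounds have the same asymptotics.
\<close>
lemma monomial_moment_simplex_limit:
  fixes \<alpha> :: "'d::finite multi_index"
  shows "(\<lambda>n. (\<Sum>\<gamma>\<in>degree_slice n. \<Prod>i\<in>UNIV. (real (\<gamma> $ i) / real n) ^ (\<alpha> $ i)) / card (degree_slice n :: 'd multi_index set))
    \<longlonglongrightarrow> multi_fact \<alpha> * fact (CARD('d) - 1) / fact (total_degree \<alpha> + CARD('d) - 1)"
proof -
  obtain d where d: "CARD('d) = Suc d"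
    using zero_less_card_finite[where 'a='d] by (metis gr0_implies_Suc)
  define a where "a = total_degree \<alpha>"
  define w where "w = multi_fact \<alpha> * fact d / fact (a + d)"
  define P where "P n = (\<Sum>\<gamma>\<in>degree_slice n. \<Prod>i\<in>UNIV. real (\<gamma> $ i) ^ (\<alpha> $ i))" for n
  define c where "c n = real (card (degree_slice n :: 'd multi_index set))" for n
  (* The case of exponent zero counts the slice. *)
  have c: "c n = fact (n + d) / (fact d * fact n)" for n
    using sum_rising_degree_slice[where n = n and \<alpha> = "0 :: 'd multi_index"]
    by (simp add: c_def d multi_fact_def)
  have cpos: "c n > 0" for n unfolding c by simp
  have eq: "(\<Sum>\<gamma>\<in>degree_slice n. \<Prod>i\<in>UNIV. (real (\<gamma> $ i) / real n) ^ (\<alpha> $ i)) / c n = P n / (c n * real n ^ a)" for n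
    by (simp add: P_def power_divide prod_dividef sum_divide_distrib a_def total_degree_def power_sum[symmetric] mult.commute)
  have upper: "P n \<le> fact (n + a + d) * multi_fact \<alpha> / (fact (a + d) * fact n)" for n
  proof -
    have "P n \<le> (\<Sum>\<gamma>\<in>degree_slice n. multi_fact (\<gamma> + \<alpha>) / multi_fact \<gamma>)"
      unfolding P_def multi_fact_def prod_dividef[symmetric]
      using power_le_fact_quotient by (intro sum_mono prod_mono) (auto simp: field_simps)
    then show ?thesis by (simp add: sum_rising_degree_slice d a_def)
  qed
  have lower: "fact (n + d) * multi_fact \<alpha> / (fact (a + d) * fact (n - a)) \<le> P n" if n: "n \<ge> a" for n
  proof -
    have "fact (n + d) * multi_fact \<alpha> / (fact (a + d) * fact (n - a)) =
        (\<Sum>\<gamma>\<in>degree_slice (n - a). multi_fact (\<gamma> + \<alpha>) / multi_fact \<gamma>)"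
      unfolding sum_rising_degree_slice using n by (simp add: d a_def)
    also have "\<dots> \<le> (\<Sum>\<gamma>\<in>degree_slice (n - a). \<Prod>i\<in>UNIV. real ((\<gamma> + \<alpha>) $ i) ^ (\<alpha> $ i))"
      unfolding multi_fact_def prod_dividef[symmetric]
      using fact_quotient_le_power by (intro sum_mono prod_mono) (auto simp: field_simps)
    also have "\<dots> = (\<Sum>\<gamma> | \<gamma> \<in> degree_slice n \<and> \<alpha> \<le> \<gamma>. \<Prod>i\<in>UNIV. real (\<gamma> $ i) ^ (\<alpha> $ i))"
      using n by (subst sum_degree_slice_shift[where n = n and \<alpha> = \<alpha> and m = "n - a"]) (auto simp: a_def)
    also have "\<dots> \<le> P n"
      unfolding P_def by (intro sum_mono2) (auto intro!: prod_nonneg)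
    finally show ?thesis .
  qed
  have "(\<lambda>n. P n / (c n * real n ^ a)) \<longlonglongrightarrow> w"
  proof (rule tendsto_sandwich)
    define U where "U n = w * (fact (n + (a + d)) / (fact n * real n ^ (a + d)) / (fact (n + d) / (fact n * real n ^ d)))" for n
    define V where "V n = w * (fact (n - a + a) / (fact (n - a) * real (n - a) ^ a) * (real (n - a) / real (n - a + a)) ^ a)" for n
    show "\<forall>\<^sub>F n in sequentially. P n / (c n * real n ^ a) \<le> U n"
      using eventually_gt_at_top[of 0]
    proof eventually_elim
      case (elim n)
      have "P n / (c n * real n ^ a) \<le> (fact (n + a + d) * multi_fact \<alpha> / (fact (a + d) * fact n)) / (c n * real n ^ a)"
        using cpos[of n] by (intro divide_right_mono upper) auto
      also have "\<dots> = U n" using elim by (simp add: c U_def w_def power_add field_simps)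
      finally show ?case .
    qed
    show "\<forall>\<^sub>F n in sequentially. V n \<le> P n / (c n * real n ^ a)"
      using eventually_gt_at_top[of a]
    proof eventually_elim
      case (elim n)
      have "V n = (fact (n + d) * multi_fact \<alpha> / (fact (a + d) * fact (n - a))) / (c n * real n ^ a)"
        using elim by (simp add: c V_def w_def power_divide)
      also have "\<dots> \<le> P n / (c n * real n ^ a)"
        using cpos[of n] elim by (intro divide_right_mono lower) auto
      finally show ?case .
    qed
    have "U \<longlonglongrightarrow> w * (1 / 1)"
      unfolding U_def[abs_def] by (intro tendsto_intros fact_add_asymp) simp
    then show "U \<longlonglongrightarrow> w" by simp
    have "(\<lambda>n. 1 - real a / real (n + a)) \<longlonglongrightarrow> 1 - 0"
      by (intro tendsto_intros LIMSEQ_ignore_initial_segment lim_const_over_n)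
    moreover have "\<forall>\<^sub>F n in sequentially. 1 - real a / real (n + a) = real n / real (n + a)"
      using eventually_gt_at_top[of 0] by eventually_elim (simp add: field_simps)
    ultimately have "(\<lambda>n. real n / real (n + a)) \<longlonglongrightarrow> 1"
      using Lim_transform_eventually by fastforce
    then have "(\<lambda>n. w * (fact (n + a) / (fact n * real n ^ a) * (real n / real (n + a)) ^ a)) \<longlonglongrightarrow> w * (1 * 1 ^ a)"
      by (intro tendsto_intros fact_add_asymp)
    then have "(\<lambda>n. V (n + a)) \<longlonglongrightarrow> w" by (simp add: V_def)
    then show "V \<longlonglongrightarrow> w" by (rule LIMSEQ_offset)
  qed
  then show ?thesis unfolding eq[symmetric] by (simp add: w_def c_def d a_def)
qed

lemma primitive_root_of_unity:
  assumes "N > 0"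
  obtains \<omega> :: complex where "norm \<omega> = 1" "\<And>m. \<omega> ^ m = 1 \<longleftrightarrow> N dvd m"
proof
  define \<omega> where "\<omega> = exp (2 * of_real pi * \<i> * of_nat 1 / of_nat N)"
  show "norm \<omega> = 1" by (simp add: \<omega>_def norm_exp_eq_Re)
  show "\<omega> ^ m = 1 \<longleftrightarrow> N dvd m" for m
    using complex_root_unity_eq_1[of N m] assms
    by (simp add: \<omega>_def exp_of_nat_mult[symmetric] mult_ac)
qed

lemma root_of_unity_orthogonality:
  fixes \<omega> :: complex
  assumes \<omega>: "norm \<omega> = 1" "\<And>m. \<omega> ^ m = 1 \<longleftrightarrow> N dvd m" and ab: "a < N" "b < N"
  shows "(\<Sum>k<N. (\<omega> ^ k) ^ a * cnj (\<omega> ^ k) ^ b) = (if a = b then of_nat N else 0)"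
proof -
  have unit: "\<omega> ^ k * cnj (\<omega> ^ k) = 1" for k
    using \<omega>(1) by (simp add: complex_norm_square[symmetric] norm_power del: complex_cnj_power)
  have "(\<omega> ^ k) ^ (b + m) * cnj (\<omega> ^ k) ^ b = (\<omega> ^ m) ^ k" for k m b
  proof -
    have "(\<omega> ^ k) ^ (b + m) * cnj (\<omega> ^ k) ^ b = (\<omega> ^ k * cnj (\<omega> ^ k)) ^ b * (\<omega> ^ k) ^ m"
      by (simp add: power_add power_mult_distrib mult_ac)
    then show ?thesis unfolding unit by (simp add: power_mult[symmetric] mult.commute)
  qed
  note red = this
  have geom: "(\<Sum>k<N. (\<omega> ^ m) ^ k) = 0" if "0 < m" "m < N" for m
  proof -
    have "\<omega> ^ m \<noteq> 1" using \<omega>(2)[of m] that by (auto dest: dvd_imp_le)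
    moreover have "(\<omega> ^ m) ^ N = 1" using \<omega>(2)[of "m * N"] by (simp add: power_mult[symmetric])
    ultimately show ?thesis by (simp add: geometric_sum)
  qed
  have pos: "(\<Sum>k<N. (\<omega> ^ k) ^ a * cnj (\<omega> ^ k) ^ b) = 0" if "b < a" "a < N" for a b
  proof -
    have a: "a = b + (a - b)" using that by simp
    have "(\<Sum>k<N. (\<omega> ^ k) ^ a * cnj (\<omega> ^ k) ^ b) = (\<Sum>k<N. (\<omega> ^ (a - b)) ^ k)"
      by (subst a) (simp only: red)
    then show ?thesis using geom[of "a - b"] that by simp
  qed
  (* Conjugation exchanges the two exponents. *)
  consider "a = b" | "b < a" | "a < b" by linarith
  then show ?thesis
  proof cases
    case 1
    then show ?thesis using red[of _ b 0] by simp
  next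
    case 2
    then show ?thesis using pos[OF 2 ab(1)] by simp
  next
    case 3
    have "(\<Sum>k<N. (\<omega> ^ k) ^ a * cnj (\<omega> ^ k) ^ b) = cnj (\<Sum>k<N. (\<omega> ^ k) ^ b * cnj (\<omega> ^ k) ^ a)"
      by (simp add: mult.commute)
    then show ?thesis unfolding pos[OF 3 ab(2)] using 3 by simp
  qed
qed

lemma uniform_point_measure_integral:
  fixes f :: "'b::topological_space \<Rightarrow> complex" and z :: "'a \<Rightarrow> 'b"
  assumes A: "finite A" and f: "f \<in> borel_measurable borel"
  shows "(\<integral>x. f x \<partial>distr (uniform_count_measure A) borel z) = (\<Sum>x\<in>A. f (z x)) / of_nat (card A)"
proof -
  have "z \<in> uniform_count_measure A \<rightarrow>\<^sub>M borel"
    by (auto simp: measurable_def space_uniform_count_measure sets_uniform_count_measure)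
  then have "(\<integral>x. f x \<partial>distr (uniform_count_measure A) borel z) = (\<integral>x. f (z x) \<partial>uniform_count_measure A)"
    by (rule integral_distr) (rule f)
  also have "\<dots> = (\<Sum>x\<in>A. f (z x)) / of_nat (card A)"
    using A by (simp add: uniform_count_measure_def lebesgue_integral_point_measure_finite
        scaleR_conv_of_real sum_divide_distrib divide_simps)
  finally show ?thesis .
qed

text \<open>
  The measure is uniform on the points with \<open>|\<zeta>\<^sub>i|\<^sup>2 = \<gamma>\<^sub>i / n\<close>, where \<open>|\<gamma>| = n\<close>, and with \<open>n\<close>-th roots of
  unity as phases. Averaging over the phases makes distinct monomials of small degree orthogonal.
\<close>
lemma sphere_grid_moments:
  assumes n: "n > 0"
  obtains M :: "(complex ^ 'd::finite) measure" where "prob_space M" "sets M = sets borel"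
    "AE \<zeta> in M. norm \<zeta> = 1"
    "\<And>\<alpha> \<beta>. (\<And>i. \<alpha> $ i < n) \<Longrightarrow> (\<And>i. \<beta> $ i < n) \<Longrightarrow>
      (\<integral>\<zeta>. monomial \<alpha> \<zeta> * cnj (monomial \<beta> \<zeta>) \<partial>M) =
      (if \<alpha> = \<beta> then complex_of_real ((\<Sum>\<gamma>\<in>degree_slice n. \<Prod>i\<in>UNIV. (real (\<gamma> $ i) / real n) ^ (\<alpha> $ i)) /
          card (degree_slice n :: 'd multi_index set)) else 0)"
proof -
  obtain \<omega> :: complex where \<omega>: "norm \<omega> = 1" "\<And>m. \<omega> ^ m = 1 \<longleftrightarrow> n dvd m"
    using primitive_root_of_unity[OF n] by blast
  define T where "T = {..(\<chi> i. n - 1) :: nat ^ 'd}"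
  define A where "A = (degree_slice n :: 'd multi_index set) \<times> T"
  define z where "z = (\<lambda>(\<gamma> :: 'd multi_index, k :: nat ^ 'd). (\<chi> i. complex_of_real (sqrt (real (\<gamma> $ i) / n)) * \<omega> ^ (k $ i)))"
  define M where "M = distr (uniform_count_measure A) borel z"
  have finT: "finite T" by (simp add: T_def)
  have torus: "(\<Sum>k\<in>T. \<Prod>i\<in>UNIV. g i (k $ i)) = (\<Prod>i\<in>UNIV. \<Sum>k<n. g i k)" for g :: "'d \<Rightarrow> nat \<Rightarrow> complex"
  proof -
    have "{..n - 1} = {..<n}" using n by auto
    then show ?thesis unfolding T_def by (subst prod_sum_atMost_multi_index[symmetric]) simp
  qed
  have cT: "of_nat (card T) = (of_nat n :: complex) ^ CARD('d)"
    using torus[of "\<lambda>_ _. 1"] by simp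
  have finA: "finite A" using finT by (simp add: A_def)
  have "axis undefined n \<in> (degree_slice n :: 'd multi_index set)"
    by (simp add: degree_slice_def)
  moreover have "0 \<in> T" by (simp add: T_def less_eq_vec_def)
  ultimately have neA: "A \<noteq> {}" by (auto simp: A_def)
  have zm: "z \<in> uniform_count_measure A \<rightarrow>\<^sub>M borel"
    by (auto simp: measurable_def space_uniform_count_measure sets_uniform_count_measure)
  show ?thesis
  proof
    show "prob_space M" unfolding M_def
      by (intro prob_space.prob_space_distr prob_space_uniform_count_measure finA neA zm)
    show "sets M = sets borel" by (simp add: M_def)
    have "norm (z x) = 1" if x: "x \<in> A" for x
    proof -
      obtain \<gamma> k where x': "x = (\<gamma>, k)" "\<gamma> \<in> degree_slice n" using x by (auto simp: A_def)
      have "(\<Sum>i\<in>UNIV. (norm (z x $ i))\<^sup>2) = (\<Sum>i\<in>UNIV. real (\<gamma> $ i)) / n"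
        by (simp add: z_def x'(1) norm_mult norm_power \<omega>(1) sum_divide_distrib)
      also have "\<dots> = 1"
        using x'(2) n by (simp add: degree_slice_def total_degree_def flip: of_nat_sum)
      finally show ?thesis by (simp add: norm_vec_def L2_set_def)
    qed
    then show "AE \<zeta> in M. norm \<zeta> = 1"
      unfolding M_def by (subst AE_distr_iff[OF zm]) (auto simp: space_uniform_count_measure)
    fix \<alpha> \<beta> :: "'d multi_index" assume small: "\<And>i. \<alpha> $ i < n" "\<And>i. \<beta> $ i < n"
    (* The moduli and the phases of a grid point vary independently, so the sum factors. *)
    define R where "R \<gamma> = (\<Prod>i\<in>UNIV. complex_of_real (sqrt (real (\<gamma> $ i) / n)) ^ (\<alpha> $ i + \<beta> $ i))" for \<gamma> :: "'d multi_index"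
    have val: "monomial \<alpha> (z (\<gamma>, k)) * cnj (monomial \<beta> (z (\<gamma>, k))) =
        R \<gamma> * (\<Prod>i\<in>UNIV. (\<omega> ^ (k $ i)) ^ (\<alpha> $ i) * cnj (\<omega> ^ (k $ i)) ^ (\<beta> $ i))" for \<gamma> k
      by (simp add: monomial_def z_def R_def prod.distrib[symmetric] power_mult_distrib power_add mult_ac)
    have "(\<integral>\<zeta>. monomial \<alpha> \<zeta> * cnj (monomial \<beta> \<zeta>) \<partial>M) =
        (\<Sum>x\<in>A. monomial \<alpha> (z x) * cnj (monomial \<beta> (z x))) / of_nat (card A)"
      unfolding M_def
      by (intro uniform_point_measure_integral finA borel_measurable_continuous_onI continuous_intros)
    also have "(\<Sum>x\<in>A. monomial \<alpha> (z x) * cnj (monomial \<beta> (z x))) =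
        (\<Sum>\<gamma>\<in>degree_slice n. R \<gamma>) * (\<Sum>k\<in>T. \<Prod>i\<in>UNIV. (\<omega> ^ (k $ i)) ^ (\<alpha> $ i) * cnj (\<omega> ^ (k $ i)) ^ (\<beta> $ i))"
      unfolding A_def sum_product sum.cartesian_product
      by (intro sum.cong refl) (auto simp only: val)
    also have "(\<Sum>k\<in>T. \<Prod>i\<in>UNIV. (\<omega> ^ (k $ i)) ^ (\<alpha> $ i) * cnj (\<omega> ^ (k $ i)) ^ (\<beta> $ i)) =
        (\<Prod>i\<in>UNIV. if \<alpha> $ i = \<beta> $ i then of_nat n else 0)"
      by (subst torus) (simp only: root_of_unity_orthogonality[OF \<omega> small])
    also have "\<dots> = (if \<alpha> = \<beta> then of_nat (card T) else 0)"
    proof (cases "\<alpha> = \<beta>")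
      case False
      then obtain i where "\<alpha> $ i \<noteq> \<beta> $ i" by (auto simp: vec_eq_iff)
      then have "(\<Prod>i\<in>UNIV. if \<alpha> $ i = \<beta> $ i then of_nat n else 0 :: complex) = 0"
        by (intro prod_zero) auto
      then show ?thesis using False by simp
    qed (simp add: cT)
    also have "(\<Sum>\<gamma>\<in>degree_slice n. R \<gamma>) * (if \<alpha> = \<beta> then of_nat (card T) else 0) / of_nat (card A) =
      (if \<alpha> = \<beta> then complex_of_real ((\<Sum>\<gamma>\<in>degree_slice n. \<Prod>i\<in>UNIV. (real (\<gamma> $ i) / real n) ^ (\<alpha> $ i)) /
          card (degree_slice n :: 'd multi_index set)) else 0)"
    proof (cases "\<alpha> = \<beta>")
      case True
      have "R \<gamma> = complex_of_real (\<Prod>i\<in>UNIV. (real (\<gamma> $ i) / real n) ^ (\<alpha> $ i))" for \<gamma>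
        unfolding R_def True of_real_prod of_real_power[symmetric]
        by (simp only: mult_2[symmetric] power_mult) simp
      moreover have "card T \<noteq> 0" using cT n by (metis of_nat_0 of_nat_eq_0_iff power_eq_0_iff neq0_conv)
      ultimately show ?thesis using True by (simp add: A_def card_cartesian_product)
    qed simp
    finally show "(\<integral>\<zeta>. monomial \<alpha> \<zeta> * cnj (monomial \<beta> \<zeta>) \<partial>M) = \<dots>" .
  qed
qed

text \<open>
  The moments obtained are those of the normalised surface measure of the sphere. Only these moments
  matter, so the measure is taken as a limit of grid measures.
\<close>
theorem uniform_sphere_moments:
  obtains \<sigma> :: "(complex ^ 'd::finite) measure" where "prob_space \<sigma>" "sets \<sigma> = sets borel"
    "AE \<zeta> in \<sigma>. norm \<zeta> = 1"
    "\<And>\<alpha> \<beta>. (\<integral>\<zeta>. monomial \<alpha> \<zeta> * cnj (monomial \<beta> \<zeta>) \<partial>\<sigma>) =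
      (if \<alpha> = \<beta> then complex_of_real (multi_fact \<alpha> * fact (CARD('d) - 1) / fact (total_degree \<alpha> + CARD('d) - 1)) else 0)"
proof -
  define good where "good n M \<longleftrightarrow> prob_space M \<and> sets M = sets borel \<and> (AE \<zeta> in M. norm \<zeta> = 1) \<and>
    (\<forall>\<alpha> \<beta>. (\<forall>i. \<alpha> $ i < n) \<longrightarrow> (\<forall>i. \<beta> $ i < n) \<longrightarrow>
      (\<integral>\<zeta>. monomial \<alpha> \<zeta> * cnj (monomial \<beta> \<zeta>) \<partial>M) =
      (if \<alpha> = \<beta> then complex_of_real ((\<Sum>\<gamma>\<in>degree_slice n. \<Prod>i\<in>UNIV. (real (\<gamma> $ i) / real n) ^ (\<alpha> $ i)) /
          card (degree_slice n :: 'd multi_index set)) else 0))"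
    for n and M :: "(complex ^ 'd) measure"
  have "\<exists>M. good (Suc n) M" for n
    by (rule sphere_grid_moments[of "Suc n", where 'd='d]) (auto simp: good_def simp del: of_nat_Suc)
  then obtain M where M: "\<And>n. good (Suc n) (M n)" by metis
  define L where "L \<alpha> \<beta> = (if \<alpha> = \<beta> then complex_of_real (multi_fact \<alpha> * fact (CARD('d) - 1) / fact (total_degree \<alpha> + CARD('d) - 1)) else 0)"
    for \<alpha> \<beta> :: "'d multi_index"
  have lim: "(\<lambda>n. \<integral>\<zeta>. monomial \<alpha> \<zeta> * cnj (monomial \<beta> \<zeta>) \<partial>M n) \<longlonglongrightarrow> L \<alpha> \<beta>" for \<alpha> \<beta>
  proof -
    define Q where "Q n = (\<Sum>\<gamma>\<in>degree_slice n. \<Prod>i\<in>UNIV. (real (\<gamma> $ i) / real n) ^ (\<alpha> $ i)) / card (degree_slice n :: 'd multi_index set)" for n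
    have "(\<lambda>n. if \<alpha> = \<beta> then complex_of_real (Q (Suc n)) else 0) \<longlonglongrightarrow> L \<alpha> \<beta>"
    proof (cases "\<alpha> = \<beta>")
      case True
      have "(\<lambda>n. complex_of_real (Q (Suc n))) \<longlonglongrightarrow>
          complex_of_real (multi_fact \<alpha> * fact (CARD('d) - 1) / fact (total_degree \<alpha> + CARD('d) - 1))"
        unfolding Q_def by (intro tendsto_of_real LIMSEQ_Suc[OF monomial_moment_simplex_limit])
      then show ?thesis unfolding L_def using True by (simp only: if_True simp_thms)
    qed (simp add: L_def)
    moreover have "\<forall>\<^sub>F n in sequentially. (if \<alpha> = \<beta> then complex_of_real (Q (Suc n)) else 0) =
        (\<integral>\<zeta>. monomial \<alpha> \<zeta> * cnj (monomial \<beta> \<zeta>) \<partial>M n)"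
      using eventually_ge_at_top[of "total_degree \<alpha> + total_degree \<beta>"]
    proof eventually_elim
      case (elim n)
      have "\<gamma> $ i \<le> total_degree \<gamma>" for \<gamma> :: "'d multi_index" and i
        unfolding total_degree_def by (rule member_le_sum) auto
      then have "\<forall>i. \<alpha> $ i < Suc n" "\<forall>i. \<beta> $ i < Suc n"
        using elim by (meson add_leD1 add_leD2 le_imp_less_Suc le_trans)+
      then show ?case using M[of n] unfolding good_def Q_def by presburger
    qed
    ultimately show ?thesis by (rule Lim_transform_eventually)
  qed
  have Mp: "prob_space (M n)" "sets (M n) = sets borel" "AE \<zeta> in M n. norm \<zeta> = 1" for n
    using M[of n] by (auto simp: good_def)
  show ?thesis
    by (rule sphere_moment_limit[OF Mp lim]) (use that in \<open>auto simp: L_def\<close>)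
qed

section \<open>Kernels satisfying the shift identity are moment kernels\<close>

lemma real_average_tendsto:
  fixes f :: "nat \<Rightarrow> real"
  assumes f: "f \<longlonglongrightarrow> l"
    and E: "\<And>n. finite (E n)" "\<And>n e. e \<in> E n \<Longrightarrow> n \<le> e" "\<And>n. card (E n) \<le> n"
    and card: "(\<lambda>n. real (card (E n)) / real n) \<longlonglongrightarrow> 1"
  shows "(\<lambda>n. (\<Sum>e\<in>E n. f e) / real n) \<longlonglongrightarrow> l"
proof -
  have "(\<lambda>n. (\<Sum>e\<in>E n. f e - l) / real n) \<longlonglongrightarrow> 0"
  proof (rule LIMSEQ_I)
    fix r :: real assume r: "r > 0"
    obtain N where N: "\<And>n. n \<ge> N \<Longrightarrow> norm (f n - l) < r / 2"
      using LIMSEQ_D[OF f, of "r / 2"] r by auto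
    have "norm ((\<Sum>e\<in>E n. f e - l) / real n - 0) < r" if n: "n \<ge> N" for n
    proof -
      have "norm (\<Sum>e\<in>E n. f e - l) \<le> (\<Sum>e\<in>E n. r / 2)"
      proof (rule sum_norm_le)
        fix e assume "e \<in> E n"
        then have "e \<ge> N" using E(2)[of e n] n by linarith
        then show "norm (f e - l) \<le> r / 2" using N[of e] by linarith
      qed
      also have "\<dots> = real (card (E n)) * (r / 2)" by simp
      also have "\<dots> \<le> real n * (r / 2)" using E(3)[of n] r by (intro mult_right_mono) auto
      finally have "norm (\<Sum>e\<in>E n. f e - l) \<le> real n * (r / 2)" .
      then have "norm ((\<Sum>e\<in>E n. f e - l) / real n) \<le> r / 2"
        using r by (cases "n = 0") (auto simp: field_simps)
      then have "norm ((\<Sum>e\<in>E n. f e - l) / real n) < r"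
        by (rule le_less_trans) (use r in simp)
      then show ?thesis by simp
    qed
    then show "\<exists>N. \<forall>n\<ge>N. norm ((\<Sum>e\<in>E n. f e - l) / real n - 0) < r" by blast
  qed
  moreover have "(\<lambda>n. real (card (E n)) / real n * l) \<longlonglongrightarrow> 1 * l"
    by (intro tendsto_intros card)
  ultimately have "(\<lambda>n. (\<Sum>e\<in>E n. f e - l) / real n + real (card (E n)) / real n * l) \<longlonglongrightarrow> 0 + 1 * l"
    by (rule tendsto_add)
  moreover have "(\<Sum>e\<in>E n. f e - l) / real n + real (card (E n)) / real n * l = (\<Sum>e\<in>E n. f e) / real n" for n
    by (simp add: sum_subtractf diff_divide_distrib)
  ultimately show ?thesis by simp
qed

text \<open>
  Chosen such that \<open>coherent_weight d m ^ 2\<close> times the moment factor \<open>d! / (m+d)!\<close> equals \<open>m!\<close>, where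
  \<open>d + 1\<close> is the dimension; then the overlaps of all large degrees have asymptotically equal size.
\<close>
definition coherent_weight :: "nat \<Rightarrow> nat \<Rightarrow> real" where
  "coherent_weight d m = sqrt (fact m * fact (m + d) / fact d)"

text \<open>
  The weight with which the slice of degree \<open>e\<close> contributes \<open>K(\<alpha>-\<kappa>, \<beta>-\<kappa>)\<close> to the moment at
  \<open>(\<alpha>, \<beta>)\<close>, up to the contraction coefficient; \<open>a, b, k\<close> are the degrees of \<open>\<alpha>, \<beta>, \<kappa>\<close>.
\<close>
definition overlap_ratio :: "nat \<Rightarrow> nat \<Rightarrow> nat \<Rightarrow> nat \<Rightarrow> nat \<Rightarrow> real" where
  "overlap_ratio d a b k e = coherent_weight d (e - b) * coherent_weight d (e - a) * fact d /
     (fact (e + d) * fact (e + k - (a + b)))"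

text \<open>
  With \<open>e = p + a + b\<close>, each \<open>(p+x)!\<close> is asymptotically \<open>p! p\<^sup>x\<close>; collecting powers leaves \<open>p\<^sup>-\<^sup>k\<close>.
\<close>
lemma overlap_ratio_tendsto: "overlap_ratio d a b k \<longlonglongrightarrow> (if k = 0 then 1 else 0)"
proof (rule LIMSEQ_offset[where k = "a + b"])
  define F where "F x p = fact (p + x) / (fact p * real p ^ x)" for x p
  have F: "F x \<longlonglongrightarrow> 1" for x unfolding F_def[abs_def] by (rule fact_add_asymp)
  have fF: "fact (p + x) = F x p * (fact p * real p ^ x)" if "p > 0" for x p
    using that by (simp add: F_def)
  have "(\<lambda>p. sqrt (F a p * F (a + d) p * (F b p * F (b + d) p)) / (F (a + b + d) p * F k p) * (1 / real p) ^ k)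
      \<longlonglongrightarrow> sqrt (1 * 1 * (1 * 1)) / (1 * 1) * 0 ^ k"
    by (intro tendsto_intros F lim_const_over_n) simp
  also have "sqrt (1 * 1 * (1 * 1)) / (1 * 1) * 0 ^ k = (if k = 0 then 1 else (0 :: real))" by simp
  finally have "(\<lambda>p. sqrt (F a p * F (a + d) p * (F b p * F (b + d) p)) / (F (a + b + d) p * F k p) * (1 / real p) ^ k)
      \<longlonglongrightarrow> (if k = 0 then 1 else 0)" .
  moreover have "\<forall>\<^sub>F p in sequentially.
      sqrt (F a p * F (a + d) p * (F b p * F (b + d) p)) / (F (a + b + d) p * F k p) * (1 / real p) ^ k
      = overlap_ratio d a b k (p + (a + b))"
    using eventually_gt_at_top[of 0]
  proof eventually_elim
    case (elim p)
    have "coherent_weight d (p + a) * coherent_weight d (p + b) * fact d =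
        sqrt (fact (p + a) * fact (p + a + d) * (fact (p + b) * fact (p + b + d)))"
      by (simp add: coherent_weight_def real_sqrt_mult real_sqrt_divide)
    also have "\<dots> = sqrt (fact (p + a) * fact (p + (a + d)) * (fact (p + b) * fact (p + (b + d))))"
      by (simp only: add.assoc)
    also have "\<dots> = sqrt (F a p * F (a + d) p * (F b p * F (b + d) p) * ((fact p)\<^sup>2 * real p ^ (a + b + d))\<^sup>2)"
      unfolding fF[OF elim] by (simp add: power_add power2_eq_square mult_ac)
    also have "\<dots> = sqrt (F a p * F (a + d) p * (F b p * F (b + d) p)) * ((fact p)\<^sup>2 * real p ^ (a + b + d))"
      by (simp add: real_sqrt_mult)
    finally have num: "coherent_weight d (p + a) * coherent_weight d (p + b) * fact d = \<dots>" .
    have "fact (p + (a + b + d)) * fact (p + k) = F (a + b + d) p * F k p * real p ^ k * ((fact p)\<^sup>2 * real p ^ (a + b + d))"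
      unfolding fF[OF elim] by (simp add: power2_eq_square mult_ac)
    moreover have "fact p ^ 2 * real p ^ (a + b + d) \<noteq> 0" using elim by simp
    ultimately have "coherent_weight d (p + a) * coherent_weight d (p + b) * fact d / (fact (p + (a + b + d)) * fact (p + k)) =
        sqrt (F a p * F (a + d) p * (F b p * F (b + d) p)) / (F (a + b + d) p * F k p * real p ^ k)"
      unfolding num by simp
    moreover have idx: "p + (a + b) - b = p + a" "p + (a + b) - a = p + b" "p + (a + b) + k - (a + b) = p + k"
      "p + (a + b) + d = p + (a + b + d)" by simp_all
    ultimately show ?case unfolding overlap_ratio_def idx by (simp add: power_one_over divide_inverse power_inverse)
  qed
  ultimately show "(\<lambda>p. overlap_ratio d a b k (p + (a + b))) \<longlonglongrightarrow> (if k = 0 then 1 else 0)"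
    by (rule Lim_transform_eventually)
qed

text \<open>
  The degrees \<open>e\<close> for which both \<open>e - a\<close> and \<open>e - b\<close> lie in \<open>[n, 2n)\<close> are all but \<open>|a - b|\<close> of \<open>n\<close>
  consecutive ones, so the average over them is a Cesaro mean.
\<close>
lemma overlap_average_tendsto:
  "(\<lambda>n. (\<Sum>e\<in>{n + max a b..<2 * n + min a b}. overlap_ratio d a b k e) / real n) \<longlonglongrightarrow> (if k = 0 then 1 else 0)"
proof (rule real_average_tendsto[OF overlap_ratio_tendsto])
  define t where "t = max a b - min a b"
  have "(\<lambda>n. 1 - real t / real n) \<longlonglongrightarrow> 1 - 0" by (intro tendsto_intros lim_const_over_n)
  then have "(\<lambda>n. 1 - real t / real n) \<longlonglongrightarrow> 1" by simp
  moreover have "\<forall>\<^sub>F n in sequentially. 1 - real t / real n = real (card {n + max a b..<2 * n + min a b}) / real n"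
    using eventually_gt_at_top[of t]
  proof eventually_elim
    case (elim n)
    have "card {n + max a b..<2 * n + min a b} = n - t" by (simp add: t_def)
    then show ?case using elim by (simp add: field_simps of_nat_diff)
  qed
  ultimately show "(\<lambda>n. real (card {n + max a b..<2 * n + min a b}) / real n) \<longlonglongrightarrow> 1"
    by (rule Lim_transform_eventually)
qed auto

definition coherent_coeff :: "nat \<Rightarrow> 'd::finite multi_index \<Rightarrow> real" where
  "coherent_coeff d \<delta> = coherent_weight d (total_degree \<delta>) / multi_fact \<delta>"

definition degree_window :: "nat \<Rightarrow> 'd::finite multi_index set" where
  "degree_window n = {\<delta>. n \<le> total_degree \<delta> \<and> total_degree \<delta> < 2 * n}"

lemma finite_degree_window [simp]: "finite (degree_window n)"
  unfolding degree_window_def by (rule finite_subset[OF _ finite_total_degree_le[of "2 * n"]]) auto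

text \<open>
  The left-hand side is \<open>n\<close> times the moment of the coherent density at \<open>(\<alpha>, \<beta>)\<close>, with \<open>w\<close> the moments
  of the uniform measure. Grouping the pairs \<open>(\<delta>, \<delta>')\<close> by \<open>\<epsilon> = \<alpha> + \<delta>' = \<beta> + \<delta>\<close> and then by the degree
  of \<open>\<epsilon>\<close> reduces it to \<open>sum_slice_antinormal_order\<close>.
\<close>
lemma sum_window_overlap:
  fixes K :: "'d::finite kernel"
  defines "d \<equiv> CARD('d) - 1"
  defines "w \<equiv> \<lambda>\<epsilon> :: 'd multi_index. multi_fact \<epsilon> * fact d / fact (total_degree \<epsilon> + d)"
  assumes K: "\<And>\<alpha> \<beta>. K \<alpha> \<beta> = (\<Sum>j\<in>UNIV. K (\<alpha> + axis j 1) (\<beta> + axis j 1))"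
    and n: "n \<ge> total_degree \<alpha>" "n \<ge> total_degree \<beta>"
  shows "(\<Sum>\<delta>\<in>degree_window n. \<Sum>\<delta>'\<in>degree_window n.
      if \<alpha> + \<delta>' = \<beta> + \<delta> then (coherent_coeff d \<delta> * coherent_coeff d \<delta>' * w (\<alpha> + \<delta>')) *\<^sub>R K \<delta> \<delta>' else 0) =
    (\<Sum>\<kappa> | \<kappa> \<le> \<alpha> \<and> \<kappa> \<le> \<beta>. (contraction_coeff \<alpha> \<beta> \<kappa> *
      (\<Sum>e\<in>{n + max (total_degree \<alpha>) (total_degree \<beta>)..<2 * n + min (total_degree \<alpha>) (total_degree \<beta>)}.
        overlap_ratio d (total_degree \<alpha>) (total_degree \<beta>) (total_degree \<kappa>) e)) *\<^sub>R K (\<alpha> - \<kappa>) (\<beta> - \<kappa>))"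
proof -
  define a b where "a = total_degree \<alpha>" and "b = total_degree \<beta>"
  define E where "E = {n + max a b..<2 * n + min a b}"
  define S where "S e = {\<epsilon>. \<epsilon> \<in> degree_slice e \<and> \<alpha> \<le> \<epsilon> \<and> \<beta> \<le> \<epsilon>}" for e
  define W where "W = (degree_window n :: 'd multi_index set)"
  define X where "X = (\<lambda>(\<delta>, \<delta>'). (coherent_coeff d \<delta> * coherent_coeff d \<delta>' * w (\<alpha> + \<delta>')) *\<^sub>R K \<delta> \<delta>')"
  have finS: "finite (S e)" for e
    unfolding S_def by (rule finite_subset[OF _ finite_degree_slice[of e]]) auto
  have finW: "finite W" by (simp add: W_def)
  have "(\<Sum>\<delta>\<in>W. \<Sum>\<delta>'\<in>W. if \<alpha> + \<delta>' = \<beta> + \<delta> then (coherent_coeff d \<delta> * coherent_coeff d \<delta>' * w (\<alpha> + \<delta>')) *\<^sub>R K \<delta> \<delta>' else 0)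
      = (\<Sum>p\<in>W \<times> W. if \<alpha> + snd p = \<beta> + fst p then X p else 0)"
    by (simp add: sum.cartesian_product X_def case_prod_beta cong: if_cong)
  also have "\<dots> = (\<Sum>p | p \<in> W \<times> W \<and> \<alpha> + snd p = \<beta> + fst p. X p)"
    using finW by (intro sum.inter_filter[symmetric]) auto
  also have "\<dots> = (\<Sum>q\<in>Sigma E S. X (snd q - \<beta>, snd q - \<alpha>))"
  proof (rule sum.reindex_bij_witness[of _ "\<lambda>q. (snd q - \<beta>, snd q - \<alpha>)" "\<lambda>p. (total_degree (\<beta> + fst p), \<beta> + fst p)"])
    fix p assume p: "p \<in> {p. p \<in> W \<times> W \<and> \<alpha> + snd p = \<beta> + fst p}"
    then have eq: "\<alpha> + snd p = \<beta> + fst p" by simp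
    have "\<beta> + fst p - \<alpha> = snd p" "\<beta> + fst p - \<beta> = fst p" using eq[symmetric] by (simp_all add: vec_eq_iff)
    then show "(snd (total_degree (\<beta> + fst p), \<beta> + fst p) - \<beta>, snd (total_degree (\<beta> + fst p), \<beta> + fst p) - \<alpha>) = p"
      by (simp add: prod_eq_iff)
    then show "X (snd (total_degree (\<beta> + fst p), \<beta> + fst p) - \<beta>, snd (total_degree (\<beta> + fst p), \<beta> + fst p) - \<alpha>) = X p"
      by simp
    have "a + total_degree (snd p) = b + total_degree (fst p)"
      using arg_cong[OF eq, of total_degree] by (simp add: total_degree_add a_def b_def)
    then have "total_degree (\<beta> + fst p) \<in> E"
      using p by (auto simp: E_def W_def degree_window_def total_degree_add b_def[symmetric])
    moreover have "\<alpha> \<le> \<beta> + fst p" unfolding eq[symmetric] by (simp add: less_eq_vec_def)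
    ultimately show "(total_degree (\<beta> + fst p), \<beta> + fst p) \<in> Sigma E S"
      by (simp add: S_def degree_slice_def less_eq_vec_def)
  next
    fix q assume q: "q \<in> Sigma E S"
    then have \<epsilon>: "\<alpha> \<le> snd q" "\<beta> \<le> snd q" "total_degree (snd q) = fst q" "fst q \<in> E"
      by (auto simp: S_def degree_slice_def)
    have "\<beta> + (snd q - \<beta>) = snd q" "\<alpha> + (snd q - \<alpha>) = snd q"
      using multi_diff_add[OF \<epsilon>(1)] multi_diff_add[OF \<epsilon>(2)] by (simp_all add: add.commute)
    moreover have "snd q - \<beta> \<in> W" "snd q - \<alpha> \<in> W"
      using \<epsilon> by (auto simp: W_def degree_window_def total_degree_diff E_def a_def[symmetric] b_def[symmetric])
    ultimately show "(total_degree (\<beta> + fst (snd q - \<beta>, snd q - \<alpha>)), \<beta> + fst (snd q - \<beta>, snd q - \<alpha>)) = q"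
      "(snd q - \<beta>, snd q - \<alpha>) \<in> {p. p \<in> W \<times> W \<and> \<alpha> + snd p = \<beta> + fst p}"
      using \<epsilon> by (simp_all add: prod_eq_iff)
  qed
  also have "\<dots> = (\<Sum>e\<in>E. \<Sum>\<epsilon>\<in>S e. X (\<epsilon> - \<beta>, \<epsilon> - \<alpha>))"
    using finS by (subst sum.Sigma) (auto simp: E_def case_prod_beta)
  also have "\<dots> = (\<Sum>e\<in>E. \<Sum>\<kappa> | \<kappa> \<le> \<alpha> \<and> \<kappa> \<le> \<beta>. (contraction_coeff \<alpha> \<beta> \<kappa> * overlap_ratio d a b (total_degree \<kappa>) e)
      *\<^sub>R K (\<alpha> - \<kappa>) (\<beta> - \<kappa>))"
  proof (rule sum.cong[OF refl])
    fix e assume e: "e \<in> E"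
    have ab: "a + b \<le> e" using e n by (auto simp: E_def a_def b_def)
    define g where "g = coherent_weight d (e - b) * coherent_weight d (e - a) * fact d / fact (e + d)"
    have "(\<Sum>\<epsilon>\<in>S e. X (\<epsilon> - \<beta>, \<epsilon> - \<alpha>)) =
      (\<Sum>\<epsilon>\<in>S e. g *\<^sub>R (multi_fact \<epsilon> / (multi_fact (\<epsilon> - \<alpha>) * multi_fact (\<epsilon> - \<beta>))) *\<^sub>R K (\<epsilon> - \<beta>) (\<epsilon> - \<alpha>))"
    proof (rule sum.cong[OF refl])
      fix \<epsilon> assume "\<epsilon> \<in> S e"
      then have \<epsilon>: "\<alpha> \<le> \<epsilon>" "\<beta> \<le> \<epsilon>" "total_degree \<epsilon> = e" by (auto simp: S_def degree_slice_def)
      have "\<alpha> + (\<epsilon> - \<alpha>) = \<epsilon>" using multi_diff_add[OF \<epsilon>(1)] by (simp add: add.commute)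
      then show "X (\<epsilon> - \<beta>, \<epsilon> - \<alpha>) = g *\<^sub>R (multi_fact \<epsilon> / (multi_fact (\<epsilon> - \<alpha>) * multi_fact (\<epsilon> - \<beta>))) *\<^sub>R K (\<epsilon> - \<beta>) (\<epsilon> - \<alpha>)"
        using \<epsilon> by (simp add: X_def w_def coherent_coeff_def g_def total_degree_diff a_def b_def field_simps)
    qed
    also have "\<dots> = g *\<^sub>R (\<Sum>\<kappa> | \<kappa> \<le> \<alpha> \<and> \<kappa> \<le> \<beta>. (contraction_coeff \<alpha> \<beta> \<kappa> / fact (e + total_degree \<kappa> - (a + b)))
       *\<^sub>R K (\<alpha> - \<kappa>) (\<beta> - \<kappa>))"
      unfolding scaleR_right.sum[symmetric] S_def a_def b_def
      using ab by (subst sum_slice_antinormal_order[where K = K, OF K]) (simp_all add: a_def b_def)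
    also have "\<dots> = (\<Sum>\<kappa> | \<kappa> \<le> \<alpha> \<and> \<kappa> \<le> \<beta>. (contraction_coeff \<alpha> \<beta> \<kappa> * overlap_ratio d a b (total_degree \<kappa>) e)
      *\<^sub>R K (\<alpha> - \<kappa>) (\<beta> - \<kappa>))"
      unfolding scaleR_right.sum by (intro sum.cong refl) (simp add: g_def overlap_ratio_def mult_ac)
    finally show "(\<Sum>\<epsilon>\<in>S e. X (\<epsilon> - \<beta>, \<epsilon> - \<alpha>)) = \<dots>" .
  qed
  also have "\<dots> = (\<Sum>\<kappa> | \<kappa> \<le> \<alpha> \<and> \<kappa> \<le> \<beta>. (contraction_coeff \<alpha> \<beta> \<kappa> * (\<Sum>e\<in>E. overlap_ratio d a b (total_degree \<kappa>) e))
      *\<^sub>R K (\<alpha> - \<kappa>) (\<beta> - \<kappa>))"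
    by (subst sum.swap) (simp add: sum_distrib_left scaleR_left.sum)
  finally show ?thesis by (simp only: W_def E_def a_def b_def)
qed

lemma bilin_on_hermitian_real:
  assumes "hermitian_on F M"
  shows "bilin_on F (\<lambda>\<delta>. cnj (c \<delta>)) M c = complex_of_real (Re (bilin_on F (\<lambda>\<delta>. cnj (c \<delta>)) M c))"
proof -
  have "cnj (bilin_on F (\<lambda>\<delta>. cnj (c \<delta>)) M c) = (\<Sum>\<delta>\<in>F. \<Sum>\<delta>'\<in>F. c \<delta> * cnj (M \<delta> \<delta>') * cnj (c \<delta>'))"
    by (simp add: bilin_on_def)
  also have "\<dots> = (\<Sum>\<delta>\<in>F. \<Sum>\<delta>'\<in>F. cnj (c \<delta>') * M \<delta>' \<delta> * c \<delta>)"
  proof (intro sum.cong refl)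
    fix \<delta> \<delta>' assume "\<delta> \<in> F" "\<delta>' \<in> F"
    then have "M \<delta>' \<delta> = cnj (M \<delta> \<delta>')" using assms unfolding hermitian_on_def by blast
    then show "c \<delta> * cnj (M \<delta> \<delta>') * cnj (c \<delta>') = cnj (c \<delta>') * M \<delta>' \<delta> * c \<delta>" by simp
  qed
  also have "\<dots> = bilin_on F (\<lambda>\<delta>. cnj (c \<delta>)) M c"
    unfolding bilin_on_def by (rule sum.swap)
  finally have "Im (bilin_on F (\<lambda>\<delta>. cnj (c \<delta>)) M c) = 0"
    by (metis complex_cnj_cancel_iff complex_cnj_complex_of_real cnj.simps(2) neg_equal_zero)
  then show ?thesis by (simp add: complex_eq_iff)
qed

lemma integrable_supported_on_sphere:
  fixes f :: "complex ^ 'd::finite \<Rightarrow> complex"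
  assumes "prob_space \<sigma>" and [measurable_cong]: "sets \<sigma> = sets borel" and S: "AE \<zeta> in \<sigma>. norm \<zeta> = 1"
    and f: "continuous_on UNIV f"
  shows "integrable \<sigma> f"
proof -
  interpret prob_space \<sigma> by fact
  have "bounded (f ` sphere 0 1)"
    using f by (intro compact_imp_bounded compact_continuous_image) (auto intro: continuous_on_subset)
  then obtain B where "\<forall>y\<in>f ` sphere 0 1. norm y \<le> B" unfolding bounded_iff by blast
  then have B: "norm (f x) \<le> B" if "norm x = 1" for x using that by simp
  have [measurable]: "f \<in> borel_measurable borel" using f by (rule borel_measurable_continuous_onI)
  show ?thesis
    using S by (intro integrable_const_bound[of _ B]) (auto elim!: eventually_mono intro: B)
qed

text \<open>
  Up to normalisation this is the expectation of \<open>K\<close>, as a positive operator on polynomials, in a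
  coherent state at \<open>\<zeta>\<close> whose degrees are restricted to \<open>[n, 2n)\<close> (the Husimi function).
\<close>
definition coherent_density :: "'d::finite kernel \<Rightarrow> nat \<Rightarrow> complex ^ 'd \<Rightarrow> real" where
  "coherent_density K n \<zeta> = Re (bilin_on (degree_window n)
     (\<lambda>\<delta>. cnj (of_real (coherent_coeff (CARD('d) - 1) \<delta>) * monomial \<delta> \<zeta>)) K
     (\<lambda>\<delta>. of_real (coherent_coeff (CARD('d) - 1) \<delta>) * monomial \<delta> \<zeta>)) / real n"

lemma coherent_density_nonneg:
  assumes "positive_kernel K"
  shows "0 \<le> coherent_density K n \<zeta>"
proof -
  have "0 \<le> Re (bilin_on (degree_window n) (\<lambda>\<delta>. cnj (c \<delta>)) K c)" for c
    using assms by (simp add: positive_kernel_def pos_semidef_on_def)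
  then show ?thesis unfolding coherent_density_def by (rule divide_nonneg_nonneg) simp
qed

lemma coherent_density_expand:
  fixes K :: "'d::finite kernel"
  assumes "positive_kernel K"
  defines "a \<equiv> coherent_coeff (CARD('d) - 1)"
  shows "complex_of_real (coherent_density K n \<zeta>) =
    (\<Sum>\<delta>\<in>degree_window n. \<Sum>\<delta>'\<in>degree_window n.
       (a \<delta> * a \<delta>') *\<^sub>R (K \<delta> \<delta>' * (monomial \<delta>' \<zeta> * cnj (monomial \<delta> \<zeta>)))) / of_nat n"
proof -
  have "hermitian_on (degree_window n) K"
    using assms by (simp add: positive_kernel_def pos_semidef_on_def)
  then show ?thesis
    unfolding coherent_density_def of_real_divide of_real_of_nat_eq
    by (subst bilin_on_hermitian_real[symmetric])
       (simp_all add: bilin_on_def a_def scaleR_conv_of_real mult_ac)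
qed

lemma continuous_on_coherent_density:
  "continuous_on A (coherent_density K n)"
  unfolding coherent_density_def[abs_def] bilin_on_def divide_inverse by (intro continuous_intros)

text \<open>
  The densities \<open>coherent_density K n\<close> with respect to the uniform measure have moments \<open>J n\<close> tending to
  \<open>K\<close>. Their masses \<open>Z n\<close> tend to \<open>m = K(0,0) > 0\<close>, so they can be normalised for large \<open>n\<close>, and a
  weak limit is the required probability measure.
\<close>
theorem positive_kernel_sphere_moments:
  fixes K :: "'d::finite kernel"
  assumes pos: "positive_kernel K"
    and K: "\<And>\<alpha> \<beta>. K \<alpha> \<beta> = (\<Sum>j\<in>UNIV. K (\<alpha> + axis j 1) (\<beta> + axis j 1))"
    and K0: "K 0 0 = complex_of_real m" "m > 0"
  obtains N :: "(complex ^ 'd) measure" where "prob_space N" "sets N = sets borel" "AE \<zeta> in N. norm \<zeta> = 1"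
    "\<And>\<alpha> \<beta>. (\<integral>\<zeta>. monomial \<alpha> \<zeta> * cnj (monomial \<beta> \<zeta>) \<partial>N) = K \<alpha> \<beta> / of_real m"
proof -
  define d where "d = CARD('d) - 1"
  obtain \<sigma> :: "(complex ^ 'd) measure" where \<sigma>: "prob_space \<sigma>" "sets \<sigma> = sets borel" "AE \<zeta> in \<sigma>. norm \<zeta> = 1"
    and \<sigma>_mom: "\<And>\<alpha> \<beta>. (\<integral>\<zeta>. monomial \<alpha> \<zeta> * cnj (monomial \<beta> \<zeta>) \<partial>\<sigma>) =
      (if \<alpha> = \<beta> then complex_of_real (multi_fact \<alpha> * fact (CARD('d) - 1) / fact (total_degree \<alpha> + CARD('d) - 1)) else 0)"
    by (rule uniform_sphere_moments) (rule that)
  interpret \<sigma>: prob_space \<sigma> by fact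
  note [measurable_cong] = \<sigma>(2)
  define w where "w \<epsilon> = multi_fact \<epsilon> * fact d / fact (total_degree \<epsilon> + d)" for \<epsilon> :: "'d multi_index"
  have \<sigma>_w: "(\<integral>\<zeta>. monomial \<alpha> \<zeta> * cnj (monomial \<beta> \<zeta>) \<partial>\<sigma>) = (if \<alpha> = \<beta> then complex_of_real (w \<alpha>) else 0)" for \<alpha> \<beta>
  proof -
    have "total_degree \<alpha> + CARD('d) - 1 = total_degree \<alpha> + d"
      using zero_less_card_finite[where 'a='d] by (simp add: d_def)
    then show ?thesis unfolding \<sigma>_mom w_def d_def by presburger
  qed
  define q where "q = coherent_density K"
  have q_nonneg: "0 \<le> q n \<zeta>" for n \<zeta> unfolding q_def by (rule coherent_density_nonneg[OF pos])
  have q_cont: "continuous_on UNIV (q n)" for n unfolding q_def by (rule continuous_on_coherent_density)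
  have qm [measurable]: "q n \<in> borel_measurable borel" for n
    by (rule borel_measurable_continuous_onI) (rule q_cont)
  note int = integrable_supported_on_sphere[OF \<sigma>]
  define J where "J n \<alpha> \<beta> = (\<integral>\<zeta>. complex_of_real (q n \<zeta>) * (monomial \<alpha> \<zeta> * cnj (monomial \<beta> \<zeta>)) \<partial>\<sigma>)" for n \<alpha> \<beta>
  have J_eq: "J n \<alpha> \<beta> = (\<Sum>\<delta>\<in>degree_window n. \<Sum>\<delta>'\<in>degree_window n.
      if \<alpha> + \<delta>' = \<beta> + \<delta> then (coherent_coeff d \<delta> * coherent_coeff d \<delta>' * w (\<alpha> + \<delta>')) *\<^sub>R K \<delta> \<delta>' else 0) / of_nat n" for n \<alpha> \<beta>
  proof -
    have "J n \<alpha> \<beta> = (\<integral>\<zeta>. (\<Sum>\<delta>\<in>degree_window n. \<Sum>\<delta>'\<in>degree_window n.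
       (coherent_coeff d \<delta> * coherent_coeff d \<delta>') *\<^sub>R (K \<delta> \<delta>' * (monomial (\<alpha> + \<delta>') \<zeta> * cnj (monomial (\<beta> + \<delta>) \<zeta>)))) / of_nat n \<partial>\<sigma>)"
      unfolding J_def q_def coherent_density_expand[OF pos] d_def[symmetric]
      unfolding times_divide_eq_left sum_distrib_right
      by (intro Bochner_Integration.integral_cong refl arg_cong2[where f = "(/)"] sum.cong)
         (simp add: monomial_add mult_ac)
    also have "\<dots> = (\<Sum>\<delta>\<in>degree_window n. \<Sum>\<delta>'\<in>degree_window n.
       (coherent_coeff d \<delta> * coherent_coeff d \<delta>') *\<^sub>R (K \<delta> \<delta>' * (\<integral>\<zeta>. monomial (\<alpha> + \<delta>') \<zeta> * cnj (monomial (\<beta> + \<delta>) \<zeta>) \<partial>\<sigma>))) / of_nat n"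
    proof -
      have i: "integrable \<sigma> (\<lambda>\<zeta>. monomial \<alpha> \<zeta> * cnj (monomial \<beta> \<zeta>))" for \<alpha> \<beta>
        by (intro int continuous_intros)
      show ?thesis by (simp add: i del: integral_mult_right_zero)
    qed
    also have "\<dots> = (\<Sum>\<delta>\<in>degree_window n. \<Sum>\<delta>'\<in>degree_window n.
      if \<alpha> + \<delta>' = \<beta> + \<delta> then (coherent_coeff d \<delta> * coherent_coeff d \<delta>' * w (\<alpha> + \<delta>')) *\<^sub>R K \<delta> \<delta>' else 0) / of_nat n"
      unfolding \<sigma>_w by (intro arg_cong2[where f = "(/)"] sum.cong refl) (auto simp: scaleR_conv_of_real)
    finally show ?thesis .
  qed
  (* Only the term with \<kappa> = 0 survives in the limit. *)
  have J_lim: "(\<lambda>n. J n \<alpha> \<beta>) \<longlonglongrightarrow> K \<alpha> \<beta>" for \<alpha> \<beta>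
  proof -
    define A where "A n \<kappa> = (\<Sum>e\<in>{n + max (total_degree \<alpha>) (total_degree \<beta>)..<2 * n + min (total_degree \<alpha>) (total_degree \<beta>)}.
        overlap_ratio d (total_degree \<alpha>) (total_degree \<beta>) (total_degree \<kappa>) e)" for n and \<kappa> :: "'d multi_index"
    have A: "(\<lambda>n. A n \<kappa> / real n) \<longlonglongrightarrow> (if total_degree \<kappa> = 0 then 1 else 0)" for \<kappa>
      unfolding A_def by (rule overlap_average_tendsto)
    have fin: "finite {\<kappa>. \<kappa> \<le> \<alpha> \<and> \<kappa> \<le> \<beta>}"
      by (rule finite_subset[OF _ finite_multi_index_atMost[of \<alpha>]]) auto
    have "(\<lambda>n. \<Sum>\<kappa> | \<kappa> \<le> \<alpha> \<and> \<kappa> \<le> \<beta>. (contraction_coeff \<alpha> \<beta> \<kappa> * (A n \<kappa> / real n)) *\<^sub>R K (\<alpha> - \<kappa>) (\<beta> - \<kappa>))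
      \<longlonglongrightarrow> (\<Sum>\<kappa> | \<kappa> \<le> \<alpha> \<and> \<kappa> \<le> \<beta>. (contraction_coeff \<alpha> \<beta> \<kappa> * (if total_degree \<kappa> = 0 then 1 else 0)) *\<^sub>R K (\<alpha> - \<kappa>) (\<beta> - \<kappa>))"
      by (intro tendsto_intros A)
    also have "(\<Sum>\<kappa> | \<kappa> \<le> \<alpha> \<and> \<kappa> \<le> \<beta>. (contraction_coeff \<alpha> \<beta> \<kappa> * (if total_degree \<kappa> = 0 then 1 else 0)) *\<^sub>R K (\<alpha> - \<kappa>) (\<beta> - \<kappa>))
      = (\<Sum>\<kappa> | \<kappa> \<le> \<alpha> \<and> \<kappa> \<le> \<beta>. if \<kappa> = 0 then K \<alpha> \<beta> else 0)"
    proof (intro sum.cong refl)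
      fix \<kappa> :: "'d multi_index"
      have "total_degree \<kappa> = 0 \<longleftrightarrow> \<kappa> = 0" by (auto simp: total_degree_def vec_eq_iff)
      moreover have "\<alpha> - 0 = \<alpha>" "\<beta> - 0 = \<beta>" by (simp_all add: vec_eq_iff)
      ultimately show "(contraction_coeff \<alpha> \<beta> \<kappa> * (if total_degree \<kappa> = 0 then 1 else 0)) *\<^sub>R K (\<alpha> - \<kappa>) (\<beta> - \<kappa>) = (if \<kappa> = 0 then K \<alpha> \<beta> else 0)"
        by (cases "\<kappa> = 0") simp_all
    qed
    also have "\<dots> = K \<alpha> \<beta>" using fin by (subst sum.delta) (auto simp: less_eq_vec_def)
    finally have "(\<lambda>n. \<Sum>\<kappa> | \<kappa> \<le> \<alpha> \<and> \<kappa> \<le> \<beta>. (contraction_coeff \<alpha> \<beta> \<kappa> * (A n \<kappa> / real n)) *\<^sub>R K (\<alpha> - \<kappa>) (\<beta> - \<kappa>)) \<longlonglongrightarrow> K \<alpha> \<beta>" .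
    moreover have "\<forall>\<^sub>F n in sequentially. (\<Sum>\<kappa> | \<kappa> \<le> \<alpha> \<and> \<kappa> \<le> \<beta>. (contraction_coeff \<alpha> \<beta> \<kappa> * (A n \<kappa> / real n)) *\<^sub>R K (\<alpha> - \<kappa>) (\<beta> - \<kappa>)) = J n \<alpha> \<beta>"
      using eventually_ge_at_top[of "total_degree \<alpha> + total_degree \<beta>"]
    proof eventually_elim
      case (elim n)
      then have n: "n \<ge> total_degree \<alpha>" "n \<ge> total_degree \<beta>" by auto
      show ?case
        unfolding J_eq w_def d_def
        unfolding sum_window_overlap[where K = K, OF K n] sum_divide_distrib
        by (rule sum.cong[OF refl]) (simp add: A_def d_def scaleR_conv_of_real)
    qed
    ultimately show ?thesis by (rule Lim_transform_eventually)
  qed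
  define Z where "Z n = (\<integral>\<zeta>. q n \<zeta> \<partial>\<sigma>)" for n
  have JZ: "J n 0 0 = complex_of_real (Z n)" for n
    by (simp add: J_def Z_def)
  have Z_lim: "Z \<longlonglongrightarrow> m"
    using J_lim[of 0 0] unfolding JZ K0 by (simp add: tendsto_of_real_iff)
  then have "\<forall>\<^sub>F n in sequentially. Z n > 0" using K0(2) by (rule order_tendstoD)
  then obtain n0 where n0: "\<And>n. n \<ge> n0 \<Longrightarrow> Z n > 0" by (auto simp: eventually_sequentially)
  define M where "M n = density \<sigma> (\<lambda>\<zeta>. ennreal (q (n + n0) \<zeta> / Z (n + n0)))" for n
  have int_q: "integrable \<sigma> (q n)" for n
  proof -
    have "integrable \<sigma> (\<lambda>\<zeta>. complex_of_real (q n \<zeta>))" by (intro int continuous_intros q_cont)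
    from integrable_Re[OF this] show ?thesis by simp
  qed
  have M1: "prob_space (M n)" for n
  proof
    have "emeasure (M n) (space (M n)) = (\<integral>\<^sup>+ \<zeta>. ennreal (q (n + n0) \<zeta> / Z (n + n0)) \<partial>\<sigma>)"
      unfolding M_def by (subst emeasure_density) (auto intro!: nn_integral_cong)
    also have "\<dots> = ennreal (\<integral>\<zeta>. q (n + n0) \<zeta> / Z (n + n0) \<partial>\<sigma>)"
      using n0[of "n + n0"] q_nonneg int_q by (intro nn_integral_eq_integral) auto
    also have "(\<integral>\<zeta>. q (n + n0) \<zeta> / Z (n + n0) \<partial>\<sigma>) = 1"
      using n0[of "n + n0"] by (simp add: Z_def)
    finally show "emeasure (M n) (space (M n)) = 1" by simp
  qed
  have M2: "sets (M n) = sets borel" for n by (simp add: M_def \<sigma>(2))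
  have M3: "AE \<zeta> in M n. norm \<zeta> = 1" for n
    unfolding M_def using \<sigma>(3) by (subst AE_density) (auto elim!: eventually_mono)
  have M_mom: "(\<integral>\<zeta>. monomial \<alpha> \<zeta> * cnj (monomial \<beta> \<zeta>) \<partial>M n) = J (n + n0) \<alpha> \<beta> / complex_of_real (Z (n + n0))" for n \<alpha> \<beta>
  proof -
    have [measurable]: "(\<lambda>\<zeta>. monomial \<alpha> \<zeta> * cnj (monomial \<beta> \<zeta>)) \<in> borel_measurable borel"
      by (intro borel_measurable_continuous_onI continuous_intros)
    have "(\<integral>\<zeta>. monomial \<alpha> \<zeta> * cnj (monomial \<beta> \<zeta>) \<partial>M n) =
        (\<integral>\<zeta>. (q (n + n0) \<zeta> / Z (n + n0)) *\<^sub>R (monomial \<alpha> \<zeta> * cnj (monomial \<beta> \<zeta>)) \<partial>\<sigma>)"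
      unfolding M_def using n0[of "n + n0"] q_nonneg by (intro integral_density) auto
    also have "\<dots> = (\<integral>\<zeta>. complex_of_real (q (n + n0) \<zeta>) * (monomial \<alpha> \<zeta> * cnj (monomial \<beta> \<zeta>)) / complex_of_real (Z (n + n0)) \<partial>\<sigma>)"
      by (simp add: scaleR_conv_of_real)
    also have "\<dots> = J (n + n0) \<alpha> \<beta> / complex_of_real (Z (n + n0))" by (simp add: J_def)
    finally show ?thesis .
  qed
  have "(\<lambda>n. \<integral>\<zeta>. monomial \<alpha> \<zeta> * cnj (monomial \<beta> \<zeta>) \<partial>M n) \<longlonglongrightarrow> K \<alpha> \<beta> / complex_of_real m" for \<alpha> \<beta>
    unfolding M_mom using K0(2)
    by (intro tendsto_divide tendsto_of_real LIMSEQ_ignore_initial_segment J_lim Z_lim) simp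
  from sphere_moment_limit[OF M1 M2 M3 this] show ?thesis using that by blast
qed

text \<open>
  The probability measure just found is multiplied by \<open>m\<close> and restricted from the whole space to the
  sphere, which carries its full mass.
\<close>
theorem positive_kernel_is_moment_kernel:
  fixes K :: "'d::finite kernel"
  assumes pos: "positive_kernel K"
    and K: "\<And>\<alpha> \<beta>. K \<alpha> \<beta> = (\<Sum>j\<in>UNIV. K (\<alpha> + axis j 1) (\<beta> + axis j 1))"
    and K0: "K 0 0 = complex_of_real m" "m > 0"
  shows "\<exists>\<mu>. sphere_measure \<mu> \<and> moment_kernel \<mu> = K"
proof -
  let ?S = "sphere 0 1 :: (complex ^ 'd) set"
  obtain N :: "(complex ^ 'd) measure" where N: "prob_space N" "sets N = sets borel" "AE \<zeta> in N. norm \<zeta> = 1"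
    and mom: "\<And>\<alpha> \<beta>. (\<integral>\<zeta>. monomial \<alpha> \<zeta> * cnj (monomial \<beta> \<zeta>) \<partial>N) = K \<alpha> \<beta> / of_real m"
    by (rule positive_kernel_sphere_moments[OF pos K K0]) (rule that)
  interpret N: prob_space N by fact
  note [measurable_cong] = N(2)
  have [measurable]: "?S \<in> sets borel" by simp
  define D where "D = density N (\<lambda>_. ennreal m)"
  define \<mu> where "\<mu> = restrict_space D ?S"
  have setsD: "sets D = sets borel" by (simp add: D_def N(2))
  have "finite_measure D"
  proof
    have "emeasure D (space D) = ennreal m * emeasure N (space N)"
      unfolding D_def by (subst emeasure_density) (auto simp: nn_integral_cmult)
    then show "emeasure D (space D) \<noteq> \<infinity>" by (simp add: N.emeasure_space_1)
  qed
  then have "finite_measure \<mu>"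
    unfolding \<mu>_def by (rule finite_measure_restrict_space) (simp add: setsD)
  moreover have "sets \<mu> = sets (restrict_space borel ?S)"
    unfolding \<mu>_def by (rule sets_restrict_space_cong) (rule setsD)
  ultimately have "sphere_measure \<mu>" by (simp add: sphere_measure_def)
  moreover have "moment_kernel \<mu> \<alpha> \<beta> = K \<alpha> \<beta>" for \<alpha> \<beta>
  proof -
    have [measurable]: "(\<lambda>\<zeta>. monomial \<alpha> \<zeta> * cnj (monomial \<beta> \<zeta>)) \<in> borel_measurable borel"
      by (intro borel_measurable_continuous_onI continuous_intros)
    have "moment_kernel \<mu> \<alpha> \<beta> = (\<integral>\<zeta>. indicator ?S \<zeta> *\<^sub>R (monomial \<alpha> \<zeta> * cnj (monomial \<beta> \<zeta>)) \<partial>D)"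
      unfolding moment_kernel_def \<mu>_def by (subst integral_restrict_space) (auto simp: setsD)
    also have "\<dots> = (\<integral>\<zeta>. m *\<^sub>R (indicator ?S \<zeta> *\<^sub>R (monomial \<alpha> \<zeta> * cnj (monomial \<beta> \<zeta>))) \<partial>N)"
      unfolding D_def using K0(2) by (intro integral_density) auto
    also have "\<dots> = (\<integral>\<zeta>. m *\<^sub>R (monomial \<alpha> \<zeta> * cnj (monomial \<beta> \<zeta>)) \<partial>N)"
    proof (rule integral_cong_AE)
      show "AE \<zeta> in N. m *\<^sub>R (indicator ?S \<zeta> *\<^sub>R (monomial \<alpha> \<zeta> * cnj (monomial \<beta> \<zeta>))) =
          m *\<^sub>R (monomial \<alpha> \<zeta> * cnj (monomial \<beta> \<zeta>))"
        using N(3) by eventually_elim (simp add: indicator_def)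
    qed measurable
    also have "\<dots> = K \<alpha> \<beta>" using K0(2) mom by (simp add: scaleR_conv_of_real)
    finally show ?thesis .
  qed
  ultimately show ?thesis by blast
qed

section \<open>The moment problem\<close>

text \<open>Under the integral sign this is \<open>\<Sum>\<^sub>j |\<zeta>\<^sub>j|\<^sup>2 = 1\<close>.\<close>
lemma moment_kernel_shift_identity:
  assumes \<mu>: "sphere_measure \<mu>"
  shows "moment_kernel \<mu> \<alpha> \<beta> = (\<Sum>j\<in>UNIV. moment_kernel \<mu> (\<alpha> + axis j 1) (\<beta> + axis j 1))"
proof -
  have "(\<Sum>j\<in>UNIV. moment_kernel \<mu> (\<alpha> + axis j 1) (\<beta> + axis j 1)) =
      (\<integral>\<zeta>. (\<Sum>j\<in>UNIV. monomial (\<alpha> + axis j 1) \<zeta> * cnj (monomial (\<beta> + axis j 1) \<zeta>)) \<partial>\<mu>)"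
    unfolding moment_kernel_def
    by (rule Bochner_Integration.integral_sum[symmetric]) (intro sphere_measure_integrable[OF \<mu>] continuous_intros)
  also have "\<dots> = moment_kernel \<mu> \<alpha> \<beta>"
    unfolding moment_kernel_def
  proof (rule Bochner_Integration.integral_cong[OF refl])
    fix \<zeta> assume "\<zeta> \<in> space \<mu>"
    then have "(\<Sum>j\<in>UNIV. (norm (\<zeta> $ j))\<^sup>2) = 1"
      by (simp add: sphere_measure_space[OF \<mu>] norm_vec_def L2_set_def)
    then have one: "(\<Sum>j\<in>UNIV. \<zeta> $ j * cnj (\<zeta> $ j)) = 1"
      by (simp only: complex_norm_square[symmetric] of_real_sum[symmetric] of_real_1)
    have "(\<Sum>j\<in>UNIV. monomial (\<alpha> + axis j 1) \<zeta> * cnj (monomial (\<beta> + axis j 1) \<zeta>)) =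
      monomial \<alpha> \<zeta> * cnj (monomial \<beta> \<zeta>) * (\<Sum>j\<in>UNIV. \<zeta> $ j * cnj (\<zeta> $ j))"
      unfolding sum_distrib_left by (intro sum.cong refl) (simp only: monomial_add monomial_axis complex_cnj_mult mult_ac)
    then show "(\<Sum>j\<in>UNIV. monomial (\<alpha> + axis j 1) \<zeta> * cnj (monomial (\<beta> + axis j 1) \<zeta>)) = monomial \<alpha> \<zeta> * cnj (monomial \<beta> \<zeta>)"
      by (simp only: one mult_1_right)
  qed
  finally show ?thesis by simp
qed

lemma moment_kernel_diag: "moment_kernel \<mu> \<alpha> \<alpha> = complex_of_real (\<integral>\<zeta>. (cmod (monomial \<alpha> \<zeta>))\<^sup>2 \<partial>\<mu>)"
  unfolding moment_kernel_def by (simp only: complex_norm_square[symmetric] integral_complex_of_real)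

theorem theorem3p10:
  fixes \<gamma> :: "'d::{finite,linorder} kernel"
    and s :: "'d multi_index \<Rightarrow> real"
    and K :: "'d kernel"
  assumes "\<And>\<alpha> \<beta>. \<gamma> \<alpha> \<beta> \<in> ball 0 1"
    and "\<And>\<alpha>. \<gamma> \<alpha> \<alpha> = 0"
    and "\<And>\<alpha> \<beta>. \<gamma> \<beta> \<alpha> = cnj (\<gamma> \<alpha> \<beta>)"
    and "\<And>\<alpha>. s \<alpha> > 0"
    and "positive_kernel K"
    and "has_verblunsky K \<gamma>"
    and "\<And>\<alpha>. K \<alpha> \<alpha> = of_real (s \<alpha>)"
  shows "((\<exists>!\<mu>. solves_moment_problem \<gamma> s \<mu>) \<longleftrightarrow>
            (\<forall>\<alpha> \<beta>. K \<alpha> \<beta> = (\<Sum>j\<in>UNIV. K (\<alpha> + axis j 1) (\<beta> + axis j 1)))) \<and>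
         ((\<exists>!\<mu>. solves_moment_problem \<gamma> s \<mu>) \<longrightarrow>
            (\<forall>\<mu>. solves_moment_problem \<gamma> s \<mu> \<longrightarrow> moment_kernel \<mu> = K))"
proof -
  have mk: "moment_kernel \<mu> = K" if "solves_moment_problem \<gamma> s \<mu>" for \<mu>
  proof (rule pos_def_kernel_eqI_verblunsky)
    show "pos_def_kernel (moment_kernel \<mu>)" "pos_def_kernel K"
      using that assms(6) by (auto simp: solves_moment_problem_def has_verblunsky_def)
    show "moment_kernel \<mu> \<alpha> \<alpha> = K \<alpha> \<alpha>" for \<alpha>
      using that assms(7) by (simp add: solves_moment_problem_def moment_kernel_diag)
    show "verblunsky (moment_kernel \<mu>) \<alpha> \<beta> = verblunsky K \<alpha> \<beta>" for \<alpha> \<beta>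
      using that assms(6) by (simp add: solves_moment_problem_def has_verblunsky_def)
  qed
  have sphere: "sphere_measure \<mu>" if "solves_moment_problem \<gamma> s \<mu>" for \<mu>
    using that by (simp add: solves_moment_problem_def)
  have "\<exists>!\<mu>. solves_moment_problem \<gamma> s \<mu>"
    if shift: "\<forall>\<alpha> \<beta>. K \<alpha> \<beta> = (\<Sum>j\<in>UNIV. K (\<alpha> + axis j 1) (\<beta> + axis j 1))"
  proof -
    obtain \<mu> where \<mu>: "sphere_measure \<mu>" "moment_kernel \<mu> = K"
      using positive_kernel_is_moment_kernel[OF assms(5) shift[rule_format] assms(7) assms(4)] by blast
    have "(\<integral>\<zeta>. (cmod (monomial \<alpha> \<zeta>))\<^sup>2 \<partial>\<mu>) = s \<alpha>" for \<alpha>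
      using moment_kernel_diag[of \<mu> \<alpha>] assms(7)[of \<alpha>] \<mu>(2) by simp
    then have "solves_moment_problem \<gamma> s \<mu>"
      using \<mu> assms(6) by (simp add: solves_moment_problem_def)
    then show ?thesis
      using sphere_measure_eqI_moments sphere mk by (metis (no_types, lifting))
  qed
  moreover have "\<forall>\<alpha> \<beta>. K \<alpha> \<beta> = (\<Sum>j\<in>UNIV. K (\<alpha> + axis j 1) (\<beta> + axis j 1))"
    if ex1: "\<exists>!\<mu>. solves_moment_problem \<gamma> s \<mu>"
  proof -
    obtain \<mu> where \<mu>: "solves_moment_problem \<gamma> s \<mu>" using ex1 by blast
    show ?thesis using moment_kernel_shift_identity[OF sphere[OF \<mu>]] unfolding mk[OF \<mu>] by blast
  qed
  ultimately show ?thesis using mk by blast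
qed

end
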